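(* Let $M$ be a connected, simply connected, oriented smooth surface and let $f:M\to\mathbb{R}^4$ be an applicable elliptic Lagrangian immersion. Then $f$ admits an associated family of noncongruent elliptic Lagrangian immersions parametrized by $\mathbb{R}$: there is a family $(f_\lambda)_{\lambda\in\mathbb{R}}$ of elliptic Lagrangian immersions $f_\lambda:M\to\mathbb{R}^4$ with $f_0=f$, all having the same Fubini cubic form as $f$, and such that $f_\lambda$ and $f_\mu$ are not congruent whenever $\lambda\neq\mu$.
   Context: Symplectic group. $\mathbb{R}^4$ carries the symplectic form $\Omega(X,Y)={}^tXJY$, $J=\begin{pmatrix}0&I_2\\-I_2&0\end{pmatrix}$. $\mathrm{Sp}(4,\mathbb{R})=\{\mathbf{X}\in\mathrm{GL}(4,\mathbb{R}):{}^t\mathbf{X}J\mathbf{X}=J\}$. The affine symplectic group $\mathcal{S}(4,\mathbb{R})=\mathbb{R}^4\rtimes\mathrm{Sp}(4,\mathbb{R})$ consists of the matrices $\mathbf{S}(P,\mathbf{X})=\begin{pmatrix}1&0\\P&\mathbf{X}\end{pmatrix}$, $P\in\mathbb{R}^4$, $\mathbf{X}\in\mathrm{Sp}(4,\mathbb{R})$, acting on $\mathbb{R}^4$ by $v\mapsto P+\mathbf{X}v$. Two immersions $f,\widetilde f:M\to\mathbb{R}^4$ are congruent if $\widetilde f=D\cdot f$ for some $D\in\mathcal{S}(4,\mathbb{R})$. Lagrangian immersions. A smooth immersion $f:M\to\mathbb{R}^4$ is Lagrangian if $f^*\Omega=0$. Its Gauss map $\mathcal{T}_f$ sends $q$ to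 the plane $df(T_qM)$, translated to the origin, with the orientation OPPOSITE to the one induced by $df$ from $M$; it takes values in the manifold $\Lambda_2^+$ of oriented Lagrangian 2-planes. A symplectic frame field along $f$ on an open connected set $U\subset M$ is a smooth map $\mathbf{S}=\mathbf{S}(f,\mathbf{X}):U\to\mathcal{S}(4,\mathbb{R})$; write $X_1,\dots,X_4$ for the columns of $\mathbf{X}$. Define real 1-forms on $U$ by $df=\sum_j\tau^jX_j$, $dX_j=\sum_i\theta^i_jX_i$, with $\theta=\begin{pmatrix}\alpha&\beta\\\gamma&-{}^t\alpha\end{pmatrix}$, where $\alpha=(\alpha^i_j)$ is $2\times2$ and $\beta=(\beta^i_j)$, $\gamma=(\gamma^i_j)$ are symmetric $2\times2$. The frame is of first order if $\mathcal{T}_f=[X_1\wedge X_2]$ as oriented planes (equivalently $\tau^3=\tau^4=0$ and $\tau^1\wedge\tau^2<0$). $f$ is elliptic if its Gauss map is a spacelike immersion for the natural signature $(2,1)$ conformal structure of $\Lambda_2^+$, i.e. if for first order frames the quadratic form $g=-\gamma^1_1\gamma^2_2+(\gamma^2_1)^2$ is positive definite. Fubini cubic form. A first order frame is of second order if $\gamma^1_1+\gamma^2_2=0$; such frames exist locally. For such a frame put $\omega=\tfrac12(\gamma^1_1-\gamma^2_2)+i\gamma^2_1$ and $\tau=\tau^1-i\tau^2$; $\tau$ is a nowhere zero complex multiple of $\omega$. The Fubini cubic form of $f$ is the complex-valued cubic differential $\mathcal{F}=\tau^2\omega$, which is independent of the second order frame and globally defined on $M$. Applicability. An elliptic Lagrangian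 immersion $f:M\to\mathbb{R}^4$ is applicable if there exists an elliptic Lagrangian immersion $\widetilde f:M\to\mathbb{R}^4$, not congruent to $f$, with the same Fubini cubic form. *)

theory Defs
  imports "HOL-Analysis.Analysis"
begin

section \<open>Smooth maps on open subsets of normed spaces\<close>

text \<open>Meaningful for open \<open>U\<close> and finite-dimensional domain, where requiring every directional
  derivative to be \<open>C\<^sup>k\<close> is the same as requiring the derivative to be \<open>C\<^sup>k\<close>.\<close>

primrec Ck_on :: "nat \<Rightarrow> 'a::euclidean_space set \<Rightarrow> ('a \<Rightarrow> 'b::real_normed_vector) \<Rightarrow> bool" where
  "Ck_on 0 U f \<longleftrightarrow> continuous_on U f"
| "Ck_on (Suc k) U f \<longleftrightarrow>
     f differentiable_on U \<and> (\<forall>v. Ck_on k U (\<lambda>x. frechet_derivative f (at x) v))"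

definition smooth_on :: "'a::euclidean_space set \<Rightarrow> ('a \<Rightarrow> 'b::real_normed_vector) \<Rightarrow> bool" where
  "smooth_on U f \<longleftrightarrow> (\<forall>k. Ck_on k U f)"


section \<open>Oriented smooth surfaces\<close>

text \<open>A chart is its domain together with a coordinate map, of which only the values on the
  domain matter. A surface is an open set \<open>M\<close> of an ambient Hausdorff, second countable type (it
  may be the whole type) with an oriented smooth atlas, which need not be maximal. Smooth maps on
  \<open>M\<close> are total functions of which only the values on \<open>M\<close> matter.\<close>

type_synonym 'm chart = "'m set \<times> ('m \<Rightarrow> real^2)"
type_synonym 'm atlas = "'m chart set"

definition chart_dom :: "'m chart \<Rightarrow> 'm set" where
  "chart_dom c = fst c"

definition chart_map :: "'m chart \<Rightarrow> 'm \<Rightarrow> real^2" where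
  "chart_map c = snd c"

definition chart_inv :: "'m chart \<Rightarrow> real^2 \<Rightarrow> 'm" where
  "chart_inv c = inv_into (chart_dom c) (chart_map c)"

definition is_chart :: "'m::topological_space chart \<Rightarrow> bool" where
  "is_chart c \<longleftrightarrow>
     open (chart_dom c) \<and> open (chart_map c ` chart_dom c) \<and>
     homeomorphism (chart_dom c) (chart_map c ` chart_dom c) (chart_map c) (chart_inv c)"

definition oriented_compatible :: "'m chart \<Rightarrow> 'm chart \<Rightarrow> bool" where
  "oriented_compatible c c' \<longleftrightarrow>
     (let D = chart_map c ` (chart_dom c \<inter> chart_dom c'); h = chart_map c' \<circ> chart_inv c
      in smooth_on D h \<and> (\<forall>x\<in>D. 0 < det (matrix (frechet_derivative h (at x)))))"

definition oriented_smooth_surface ::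
  "'m::{t2_space, second_countable_topology} set \<Rightarrow> 'm atlas \<Rightarrow> bool" where
  "oriented_smooth_surface M A \<longleftrightarrow>
     (\<Union>c\<in>A. chart_dom c) = M \<and> (\<forall>c\<in>A. is_chart c) \<and>
     (\<forall>c\<in>A. \<forall>c'\<in>A. oriented_compatible c c')"

definition smooth_map_on :: "'m atlas \<Rightarrow> 'm set \<Rightarrow> ('m \<Rightarrow> 'b::real_normed_vector) \<Rightarrow> bool" where
  "smooth_map_on A W F \<longleftrightarrow>
     (\<forall>c\<in>A. smooth_on (chart_map c ` (chart_dom c \<inter> W)) (F \<circ> chart_inv c))"

text \<open>Tangent vectors at \<open>q\<close> are represented by their components \<open>v\<close> in a chart \<open>c\<close> around \<open>q\<close>.
  Differential forms, and the cubic form below, are accordingly functions of \<open>c\<close>, \<open>q\<close>, \<open>v\<close>.\<close>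

definition differential ::
  "('m \<Rightarrow> 'b::real_normed_vector) \<Rightarrow> 'm chart \<Rightarrow> 'm \<Rightarrow> real^2 \<Rightarrow> 'b" where
  "differential F c q v = frechet_derivative (F \<circ> chart_inv c) (at (chart_map c q)) v"


section \<open>The affine symplectic group\<close>

definition J4 :: "real^4^4" where
  "J4 = vector [vector [ 0,  0, 1, 0],
                vector [ 0,  0, 0, 1],
                vector [-1,  0, 0, 0],
                vector [ 0, -1, 0, 0]]"

definition Omega :: "real^4 \<Rightarrow> real^4 \<Rightarrow> real" where
  "Omega X Y = X \<bullet> (J4 *v Y)"

definition Sp4 :: "(real^4^4) set" where
  "Sp4 = {X. invertible X \<and> transpose X ** J4 ** X = J4}"

text \<open>The pair \<open>(P, X)\<close> stands for the block matrix with rows \<open>(1, 0)\<close> and \<open>(P, X)\<close>.\<close>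

definition affine_Sp4 :: "((real^4) \<times> (real^4^4)) set" where
  "affine_Sp4 = UNIV \<times> Sp4"

definition affine_act :: "(real^4) \<times> (real^4^4) \<Rightarrow> real^4 \<Rightarrow> real^4" where
  "affine_act D v = fst D + snd D *v v"

definition congruent_maps :: "'m set \<Rightarrow> ('m \<Rightarrow> real^4) \<Rightarrow> ('m \<Rightarrow> real^4) \<Rightarrow> bool" where
  "congruent_maps M f f' \<longleftrightarrow> (\<exists>D\<in>affine_Sp4. \<forall>q\<in>M. f' q = affine_act D (f q))"


section \<open>Lagrangian immersions and symplectic frames\<close>

definition lagrangian_immersion :: "'m set \<Rightarrow> 'm atlas \<Rightarrow> ('m \<Rightarrow> real^4) \<Rightarrow> bool" where
  "lagrangian_immersion M A f \<longleftrightarrow>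
     smooth_map_on A M f \<and>
     (\<forall>c\<in>A. \<forall>q\<in>chart_dom c. inj (differential f c q)) \<and>
     (\<forall>c\<in>A. \<forall>q\<in>chart_dom c. \<forall>v w. Omega (differential f c q v) (differential f c q w) = 0)"

text \<open>An oriented plane is represented by the set of its positively oriented bases.\<close>

definition oriented_plane :: "real^4 \<Rightarrow> real^4 \<Rightarrow> ((real^4) \<times> (real^4)) set" where
  "oriented_plane X Y =
     {(a *\<^sub>R X + b *\<^sub>R Y, c *\<^sub>R X + d *\<^sub>R Y) | a b c d. 0 < a * d - b * c}"

text \<open>The negative determinant gives the tangent plane the orientation opposite to that of the
  surface.\<close>

definition gauss_map :: "'m atlas \<Rightarrow> ('m \<Rightarrow> real^4) \<Rightarrow> 'm \<Rightarrow> ((real^4) \<times> (real^4)) set" where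
  "gauss_map A f q =
     {(differential f c q v, differential f c q w) | c v w.
        c \<in> A \<and> q \<in> chart_dom c \<and> v$1 * w$2 - v$2 * w$1 < 0}"

text \<open>The frame \<open>S(f, X)\<close> along \<open>f\<close> is given by its linear part \<open>X\<close>.\<close>

definition symplectic_frame ::
  "'m::topological_space set \<Rightarrow> 'm atlas \<Rightarrow> ('m \<Rightarrow> real^4) \<Rightarrow> 'm set \<Rightarrow> ('m \<Rightarrow> real^4^4) \<Rightarrow> bool" where
  "symplectic_frame M A f W X \<longleftrightarrow>
     W \<subseteq> M \<and> open W \<and> connected W \<and>
     (\<forall>q\<in>W. (f q, X q) \<in> affine_Sp4) \<and>
     smooth_map_on A W (\<lambda>q. (f q, X q))"

text \<open>The equations \<open>df = \<Sum>\<^sub>j \<tau>\<^sup>j X\<^sub>j\<close> and \<open>dX\<^sub>j = \<Sum>\<^sub>i \<theta>\<^sup>i\<^sub>j X\<^sub>i\<close>, solved for \<open>\<tau>\<close> and \<open>\<theta>\<close>.\<close>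

definition tau_form ::
  "('m \<Rightarrow> real^4) \<Rightarrow> ('m \<Rightarrow> real^4^4) \<Rightarrow> 'm chart \<Rightarrow> 'm \<Rightarrow> real^2 \<Rightarrow> real^4" where
  "tau_form f X c q v = matrix_inv (X q) *v differential f c q v"

definition theta_form ::
  "('m \<Rightarrow> real^4^4) \<Rightarrow> 'm chart \<Rightarrow> 'm \<Rightarrow> real^2 \<Rightarrow> real^4^4" where
  "theta_form X c q v = matrix_inv (X q) ** differential X c q v"

text \<open>\<open>\<gamma>\<close> is the lower left block of \<open>\<theta>\<close>.\<close>

definition gamma11 :: "('m \<Rightarrow> real^4^4) \<Rightarrow> 'm chart \<Rightarrow> 'm \<Rightarrow> real^2 \<Rightarrow> real" where
  "gamma11 X c q v = theta_form X c q v $ 3 $ 1"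

definition gamma21 :: "('m \<Rightarrow> real^4^4) \<Rightarrow> 'm chart \<Rightarrow> 'm \<Rightarrow> real^2 \<Rightarrow> real" where
  "gamma21 X c q v = theta_form X c q v $ 4 $ 1"

definition gamma22 :: "('m \<Rightarrow> real^4^4) \<Rightarrow> 'm chart \<Rightarrow> 'm \<Rightarrow> real^2 \<Rightarrow> real" where
  "gamma22 X c q v = theta_form X c q v $ 4 $ 2"

definition first_order_frame ::
  "'m::topological_space set \<Rightarrow> 'm atlas \<Rightarrow> ('m \<Rightarrow> real^4) \<Rightarrow> 'm set \<Rightarrow> ('m \<Rightarrow> real^4^4) \<Rightarrow> bool" where
  "first_order_frame M A f W X \<longleftrightarrow>
     symplectic_frame M A f W X \<and>
     (\<forall>q\<in>W. gauss_map A f q = oriented_plane (column 1 (X q)) (column 2 (X q)))"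

definition second_order_frame ::
  "'m::topological_space set \<Rightarrow> 'm atlas \<Rightarrow> ('m \<Rightarrow> real^4) \<Rightarrow> 'm set \<Rightarrow> ('m \<Rightarrow> real^4^4) \<Rightarrow> bool" where
  "second_order_frame M A f W X \<longleftrightarrow>
     first_order_frame M A f W X \<and>
     (\<forall>c\<in>A. \<forall>q\<in>W \<inter> chart_dom c. \<forall>v. gamma11 X c q v + gamma22 X c q v = 0)"

definition elliptic_lagrangian_immersion ::
  "'m::topological_space set \<Rightarrow> 'm atlas \<Rightarrow> ('m \<Rightarrow> real^4) \<Rightarrow> bool" where
  "elliptic_lagrangian_immersion M A f \<longleftrightarrow>
     lagrangian_immersion M A f \<and>
     (\<forall>W X. first_order_frame M A f W X \<longrightarrow>
        (\<forall>c\<in>A. \<forall>q\<in>W \<inter> chart_dom c. \<forall>v. v \<noteq> 0 \<longrightarrow>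
           0 < - gamma11 X c q v * gamma22 X c q v + (gamma21 X c q v)\<^sup>2))"


section \<open>The Fubini cubic form and applicability\<close>

definition omega_form :: "('m \<Rightarrow> real^4^4) \<Rightarrow> 'm chart \<Rightarrow> 'm \<Rightarrow> real^2 \<Rightarrow> complex" where
  "omega_form X c q v = Complex ((gamma11 X c q v - gamma22 X c q v) / 2) (gamma21 X c q v)"

definition tau_complex ::
  "('m \<Rightarrow> real^4) \<Rightarrow> ('m \<Rightarrow> real^4^4) \<Rightarrow> 'm chart \<Rightarrow> 'm \<Rightarrow> real^2 \<Rightarrow> complex" where
  "tau_complex f X c q v = Complex (tau_form f X c q v $ 1) (- (tau_form f X c q v $ 2))"

text \<open>A cubic differential is identified with the homogeneous cubic polynomial function it induces
  on each tangent space. For elliptic \<open>f\<close>, second order frames exist locally and the value does not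
  depend on the frame, so the description below is proper at every point of \<open>M\<close>.\<close>

definition fubini_form ::
  "'m::topological_space set \<Rightarrow> 'm atlas \<Rightarrow> ('m \<Rightarrow> real^4) \<Rightarrow> 'm chart \<Rightarrow> 'm \<Rightarrow> real^2 \<Rightarrow> complex" where
  "fubini_form M A f c q v =
     (THE z. \<exists>W X. second_order_frame M A f W X \<and> q \<in> W \<and>
        z = (tau_complex f X c q v)\<^sup>2 * omega_form X c q v)"

definition same_fubini_form ::
  "'m::topological_space set \<Rightarrow> 'm atlas \<Rightarrow> ('m \<Rightarrow> real^4) \<Rightarrow> ('m \<Rightarrow> real^4) \<Rightarrow> bool" where
  "same_fubini_form M A f f' \<longleftrightarrow>
     (\<forall>c\<in>A. \<forall>q\<in>chart_dom c. \<forall>v. fubini_form M A f c q v = fubini_form M A f' c q v)"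

definition applicable ::
  "'m::topological_space set \<Rightarrow> 'm atlas \<Rightarrow> ('m \<Rightarrow> real^4) \<Rightarrow> bool" where
  "applicable M A f \<longleftrightarrow>
     elliptic_lagrangian_immersion M A f \<and>
     (\<exists>f'. elliptic_lagrangian_immersion M A f' \<and> \<not> congruent_maps M f f' \<and>
        same_fubini_form M A f f')"

end

theory Submission
  imports Defs
begin

text \<open>For a Lagrangian immersion \<open>f\<close> put \<open>C(u, v, w) = \<Omega>(f\<^sub>w, f\<^sub>u\<^sub>v)\<close>, a symmetric cubic form. In second order
  frames \<open>\<F>\<close> has the form \<open>h \<tau>\<^sup>3\<close> with real part \<open>C\<close>, so elliptic immersions have the same Fubini form
  if and only if they have the same \<open>C\<close>; ellipticity says that
  \<open>- det C(\<cdot>, \<cdot>, v) > 0\<close> for \<open>v \<noteq> 0\<close>.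
  The form \<open>C\<close> and its first derivatives determine all products \<open>\<Omega>\<close> between the first and second
  derivatives of \<open>f\<close>, which span \<open>\<real>\<^sup>4\<close>. Hence, if \<open>f\<close> and \<open>f'\<close> have the same \<open>C\<close>, there is a unique map
  \<open>\<Phi> : M \<rightarrow> Sp(4, \<real>)\<close> taking the 2-jet of \<open>f\<close> to that of \<open>f'\<close>. The form \<open>B = \<Phi>\<^sup>-\<^sup>1 d\<Phi>\<close> annihilates the
  tangent planes of \<open>f\<close> and takes values in them, so that \<open>B\<^sub>u B\<^sub>v = 0\<close> and \<open>dB = 0\<close>. Therefore
  \<open>\<lambda>B\<close> is flat for every real \<open>\<lambda>\<close>, and the solutions of \<open>dP = \<lambda>PB\<close>, \<open>df\<^sub>\<lambda> = P df\<close>, which exist globally as \<open>M\<close> is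
  simply connected, form the associated family. If \<open>f\<^sub>\<lambda>\<close> and \<open>f\<^sub>\<mu>\<close> are congruent, then \<open>(\<lambda> - \<mu>)B = 0\<close>; and \<open>B = 0\<close>
  makes \<open>\<Phi>\<close> constant and \<open>f'\<close> congruent to \<open>f\<close>.\<close>

section \<open>Calculus of smooth maps\<close>

text \<open>Flatness of \<lambda>B for every \<lambda> means that \<lambda> dB + \<lambda>^2 (B
  wedge B) vanishes for every \<lambda>, so both terms must vanish on their own. That Phi solves the
  equation for \<lambda> = 1 only kills their sum. The gain comes from symplectic geometry: an
  infinitesimally symplectic map that annihilates a Lagrangian plane has its image in the
  Omega-complement of that plane, which is the plane itself. Ellipticity supplies the spanning
  property behind the uniqueness of Phi. Uniqueness does double duty: it makes Phi independent of
  the chart, and it forces a congruence between two members of the family to act on the linear parts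
  P. The identity B_u B_v = 0 also settles local existence. Every Picard iterate is a primitive of a
  closed 1-form, so the Poincare lemma takes the place of a general Frobenius theorem. The immersion
  f_\<lambda> is carried along as a second component of the unknown, so \<open>P df\<close> needs no
  separate integration. Global existence is continuation of solution germs along paths, with simple
  connectedness excluding monodromy.\<close>

lemma Ck_on_has_derivative:
  assumes "Ck_on (Suc k) U f" "open U" "x \<in> U"
  shows "(f has_derivative frechet_derivative f (at x)) (at x)"
  using assms frechet_derivative_works by (auto simp: differentiable_on_eq_differentiable_at)

lemma Ck_on_cong:
  assumes "open U" "\<And>x. x \<in> U \<Longrightarrow> f x = g x" "Ck_on k U f"
  shows "Ck_on k U g"
  using assms
proof (induction k arbitrary: f g)
  case 0
  then show ?case by (auto cong: continuous_on_cong)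
next
  case (Suc k)
  have d: "(g has_derivative frechet_derivative f (at x)) (at x)" if "x \<in> U" for x
    using has_derivative_transform_within_open[OF Ck_on_has_derivative[OF Suc.prems(3,1) that] Suc.prems(1) that] Suc.prems(2)
    by auto
  then have "g differentiable_on U"
    using Suc.prems(1) by (auto simp: differentiable_on_eq_differentiable_at differentiable_def)
  moreover have "Ck_on k U (\<lambda>x. frechet_derivative g (at x) v)" for v
    using Suc.IH[OF Suc.prems(1), of "\<lambda>x. frechet_derivative f (at x) v"] Suc.prems(3) frechet_derivative_at[OF d]
    by auto
  ultimately show ?case by simp
qed

text \<open>The recursion refers to \<open>frechet_derivative\<close>, but the derivative
  \<open>at x\<close> is unique, so any explicit formula \<open>D\<close> may replace it. Most
  closure properties below go through this rule.\<close>

lemma Ck_on_SucI: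
  assumes "open U" "\<And>x. x \<in> U \<Longrightarrow> (f has_derivative D x) (at x)" "\<And>v. Ck_on k U (\<lambda>x. D x v)"
  shows "Ck_on (Suc k) U f"
proof -
  have "f differentiable_on U"
    using assms(1,2) by (auto simp: differentiable_on_eq_differentiable_at differentiable_def)
  moreover have "Ck_on k U (\<lambda>x. frechet_derivative f (at x) v)" for v
    using frechet_derivative_at[OF assms(2)] by (intro Ck_on_cong[OF assms(1) _ assms(3)[of v]]) simp
  ultimately show ?thesis by simp
qed

lemma Ck_on_Suc_imp: "Ck_on (Suc k) U f \<Longrightarrow> Ck_on k U f"
proof (induction k arbitrary: f)
  case 0
  then show ?case by (auto intro: differentiable_imp_continuous_on)
qed auto

lemma Ck_on_imp_continuous_on: "Ck_on k U f \<Longrightarrow> continuous_on U f"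
  by (cases k) (auto intro: differentiable_imp_continuous_on)

lemma Ck_on_subset: "Ck_on k U f \<Longrightarrow> V \<subseteq> U \<Longrightarrow> Ck_on k V f"
  by (induction k arbitrary: f) (auto intro: continuous_on_subset differentiable_on_subset)

lemma Ck_on_local:
  assumes "open U" "\<And>x. x \<in> U \<Longrightarrow> \<exists>V g. open V \<and> x \<in> V \<and> V \<subseteq> U \<and> Ck_on k V g \<and> (\<forall>y\<in>V. f y = g y)"
  shows "Ck_on k U f"
  using assms(2)
proof (induction k arbitrary: f)
  case 0
  have "isCont f x" if x: "x \<in> U" for x
  proof -
    obtain V g where V: "open V" "x \<in> V" "Ck_on 0 V g" "\<forall>y\<in>V. f y = g y" using 0[OF x] by blast
    then have "continuous_on V f" by (auto cong: continuous_on_cong)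
    then show ?thesis using V(1,2) by (simp add: continuous_on_eq_continuous_at)
  qed
  then show ?case using assms(1) by (simp add: continuous_on_eq_continuous_at)
next
  case (Suc k)
  have *: "\<exists>V. open V \<and> x \<in> V \<and> V \<subseteq> U \<and> Ck_on (Suc k) V f" if x: "x \<in> U" for x
  proof -
    obtain V g where V: "open V" "x \<in> V" "V \<subseteq> U" "Ck_on (Suc k) V g" "\<forall>y\<in>V. f y = g y" using Suc.prems[OF x] by blast
    have "Ck_on (Suc k) V f" by (rule Ck_on_cong[OF V(1) _ V(4)]) (use V(5) in simp)
    then show ?thesis using V by blast
  qed
  have "f differentiable at x" if "x \<in> U" for x
    using *[OF that] by (auto simp: differentiable_on_eq_differentiable_at)
  moreover have "Ck_on k U (\<lambda>x. frechet_derivative f (at x) v)" for v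
    by (rule Suc.IH) (use * in fastforce)
  ultimately show ?case using assms(1) by (simp add: differentiable_on_eq_differentiable_at)
qed

lemma Ck_on_const: "open U \<Longrightarrow> Ck_on k U (\<lambda>x. c)"
  by (induction k arbitrary: c) auto

lemma Ck_on_bounded_linear:
  assumes "bounded_linear L" "open U" "Ck_on k U f"
  shows "Ck_on k U (\<lambda>x. L (f x))"
  using assms(3)
proof (induction k arbitrary: f)
  case 0
  then show ?case using assms(1) by (auto intro: bounded_linear.continuous_on)
next
  case (Suc k)
  show ?case
    by (rule Ck_on_SucI[where D="\<lambda>x v. L (frechet_derivative f (at x) v)"])
      (use Suc assms in \<open>auto intro!: bounded_linear.has_derivative[OF assms(1)] Ck_on_has_derivative[OF Suc.prems]\<close>)
qed

lemma Ck_on_add: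
  assumes "open U" "Ck_on k U f" "Ck_on k U g"
  shows "Ck_on k U (\<lambda>x. f x + g x)"
  using assms(2,3)
proof (induction k arbitrary: f g)
  case 0
  then show ?case by (auto intro: continuous_intros)
next
  case (Suc k)
  show ?case
    by (rule Ck_on_SucI[where D="\<lambda>x v. frechet_derivative f (at x) v + frechet_derivative g (at x) v"])
      (use Suc assms in \<open>auto intro!: has_derivative_add Ck_on_has_derivative[OF Suc.prems(1)] Ck_on_has_derivative[OF Suc.prems(2)]\<close>)
qed

lemma Ck_on_bilinear:
  assumes "bounded_bilinear pr" "open U" "Ck_on k U f" "Ck_on k U g"
  shows "Ck_on k U (\<lambda>x. pr (f x) (g x))"
  using assms(3,4)
proof (induction k arbitrary: f g)
  case 0
  then show ?case by (auto intro: bounded_bilinear.continuous_on[OF assms(1)])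
next
  case (Suc k)
  show ?case
    by (rule Ck_on_SucI[where D="\<lambda>x v. pr (f x) (frechet_derivative g (at x) v) + pr (frechet_derivative f (at x) v) (g x)"])
      (use Suc assms in \<open>auto intro!: Ck_on_add bounded_bilinear.FDERIV[OF assms(1)]
         Ck_on_has_derivative[OF Suc.prems(1)] Ck_on_has_derivative[OF Suc.prems(2)] Suc.IH
         Ck_on_Suc_imp[OF Suc.prems(1)] Ck_on_Suc_imp[OF Suc.prems(2)]\<close>)
qed

lemma Ck_on_sum:
  assumes "open U" "\<And>i. i \<in> I \<Longrightarrow> Ck_on k U (f i)"
  shows "Ck_on k U (\<lambda>x. \<Sum>i\<in>I. f i x)"
  using assms(2) by (induction I rule: infinite_finite_induct) (auto simp: Ck_on_const Ck_on_add assms(1))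

lemma Ck_on_compose:
  fixes f :: "'a::euclidean_space \<Rightarrow> 'b::euclidean_space"
  assumes "open U" "open V" "f ` U \<subseteq> V" "Ck_on k U f" "Ck_on k V g"
  shows "Ck_on k U (\<lambda>x. g (f x))"
  using assms(4,5)
proof (induction k arbitrary: g)
  case 0
  then show ?case using assms(3) by (auto intro: continuous_on_compose2)
next
  case (Suc k)
  have df: "(f has_derivative frechet_derivative f (at x)) (at x)" if "x \<in> U" for x
    using Ck_on_has_derivative[OF Suc.prems(1) assms(1) that] .
  have dg: "(g has_derivative frechet_derivative g (at (f x))) (at (f x))" if "x \<in> U" for x
    using Ck_on_has_derivative[OF Suc.prems(2) assms(2)] assms(3) that by blast
  \<comment> \<open>The derivative of \<open>g\<close> in the moving direction \<open>Df v\<close>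
    is not a function of \<open>f x\<close> alone. Expanding that direction in a basis leaves
    scalars times derivatives of \<open>g\<close> in fixed directions, to which the induction
    hypothesis applies.\<close>
  have eq: "frechet_derivative g (at (f x)) (frechet_derivative f (at x) v)
      = (\<Sum>b\<in>Basis. (frechet_derivative f (at x) v \<bullet> b) *\<^sub>R frechet_derivative g (at (f x)) b)" if "x \<in> U" for x v
  proof -
    interpret linear "frechet_derivative g (at (f x))" using dg[OF that] has_derivative_linear by blast
    show ?thesis
      by (subst euclidean_representation[symmetric, of "frechet_derivative f (at x) v"]) (simp add: sum scaleR)
  qed
  have k: "Ck_on k U (\<lambda>x. \<Sum>b\<in>Basis. (frechet_derivative f (at x) v \<bullet> b) *\<^sub>R frechet_derivative g (at (f x)) b)" for v
    using Suc.prems Ck_on_Suc_imp[OF Suc.prems(1)]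
    by (intro Ck_on_sum Ck_on_bilinear[OF bounded_bilinear_scaleR] Suc.IH assms(1)
      Ck_on_bounded_linear[OF bounded_linear_inner_left]) auto
  show ?case
  proof (rule Ck_on_SucI[where D="\<lambda>x v. frechet_derivative g (at (f x)) (frechet_derivative f (at x) v)", OF assms(1)])
    show "((\<lambda>x. g (f x)) has_derivative (\<lambda>v. frechet_derivative g (at (f x)) (frechet_derivative f (at x) v))) (at x)"
      if "x \<in> U" for x
      using diff_chain_at[OF df[OF that] dg[OF that]] by (simp add: o_def)
    show "Ck_on k U (\<lambda>x. frechet_derivative g (at (f x)) (frechet_derivative f (at x) v))" for v
      by (rule Ck_on_cong[OF assms(1) _ k[of v]]) (simp add: eq)
  qed
qed

text \<open>The derivative is again built from \<open>inverse (f x)\<close> and the derivative of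
  \<open>f\<close>, so the induction on \<open>k\<close> closes for a fixed
  \<open>f\<close>.\<close>

lemma Ck_on_inverse:
  fixes f :: "'a::euclidean_space \<Rightarrow> real"
  assumes "open U" "\<And>x. x \<in> U \<Longrightarrow> f x \<noteq> 0" "Ck_on k U f"
  shows "Ck_on k U (\<lambda>x. inverse (f x))"
  using assms(3)
proof (induction k)
  case 0
  then show ?case using assms(2) by (auto intro: continuous_intros)
next
  case (Suc k)
  have k: "Ck_on k U (\<lambda>x. - (inverse (f x) * frechet_derivative f (at x) v * inverse (f x)))" for v
    by (intro Ck_on_bounded_linear[OF bounded_linear_minus[OF bounded_linear_ident]]
       Ck_on_bilinear[OF bounded_bilinear_mult] assms(1) Suc.IH Ck_on_Suc_imp[OF Suc.prems])
     (use Suc.prems in auto)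
  show ?case
    by (rule Ck_on_SucI[where D="\<lambda>x v. - (inverse (f x) * frechet_derivative f (at x) v * inverse (f x))", OF assms(1) _ k])
      (intro Deriv.has_derivative_inverse Ck_on_has_derivative[OF Suc.prems] assms)
qed

lemma Ck_on_sqrt:
  fixes f :: "'a::euclidean_space \<Rightarrow> real"
  assumes "open U" "\<And>x. x \<in> U \<Longrightarrow> f x > 0" "Ck_on k U f"
  shows "Ck_on k U (\<lambda>x. sqrt (f x))"
  using assms(3)
proof (induction k)
  case 0
  then show ?case by (auto intro: continuous_intros)
next
  case (Suc k)
  have k: "Ck_on k U (\<lambda>x. frechet_derivative f (at x) v * (inverse (sqrt (f x)) * (1 / 2)))" for v
    by (intro Ck_on_bilinear[OF bounded_bilinear_mult] assms(1) Suc.IH Ck_on_inverse Ck_on_const Ck_on_Suc_imp[OF Suc.prems])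
     (use Suc.prems assms(2) in \<open>auto simp: less_imp_neq[THEN not_sym]\<close>)
  show ?case
  proof (rule Ck_on_SucI[OF assms(1) _ k])
    fix x assume x: "x \<in> U"
    show "((\<lambda>x. sqrt (f x)) has_derivative (\<lambda>v. frechet_derivative f (at x) v * (inverse (sqrt (f x)) * (1 / 2)))) (at x)"
      by (rule has_derivative_eq_rhs[OF has_derivative_real_sqrt[OF assms(2)[OF x] Ck_on_has_derivative[OF Suc.prems assms(1) x]]]) simp
  qed
qed

section \<open>Closure properties of smooth maps\<close>

named_theorems smooth_intros

lemma smooth_on_const [smooth_intros]: "open U \<Longrightarrow> smooth_on U (\<lambda>x. c)"
  by (simp add: smooth_on_def Ck_on_const)

lemma smooth_on_bounded_linear:
  "bounded_linear L \<Longrightarrow> open U \<Longrightarrow> smooth_on U f \<Longrightarrow> smooth_on U (\<lambda>x. L (f x))"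
  by (simp add: smooth_on_def Ck_on_bounded_linear)

lemma smooth_on_add [smooth_intros]:
  "open U \<Longrightarrow> smooth_on U f \<Longrightarrow> smooth_on U g \<Longrightarrow> smooth_on U (\<lambda>x. f x + g x)"
  by (simp add: smooth_on_def Ck_on_add)

lemma smooth_on_sum [smooth_intros]:
  "open U \<Longrightarrow> (\<And>i. i \<in> I \<Longrightarrow> smooth_on U (f i)) \<Longrightarrow> smooth_on U (\<lambda>x. \<Sum>i\<in>I. f i x)"
  by (simp add: smooth_on_def Ck_on_sum)

lemma smooth_on_bilinear:
  "bounded_bilinear pr \<Longrightarrow> open U \<Longrightarrow> smooth_on U f \<Longrightarrow> smooth_on U g \<Longrightarrow> smooth_on U (\<lambda>x. pr (f x) (g x))"
  by (simp add: smooth_on_def Ck_on_bilinear)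

lemma smooth_on_compose:
  fixes f :: "'a::euclidean_space \<Rightarrow> 'b::euclidean_space"
  shows "open U \<Longrightarrow> open V \<Longrightarrow> f ` U \<subseteq> V \<Longrightarrow> smooth_on U f \<Longrightarrow> smooth_on V g \<Longrightarrow> smooth_on U (\<lambda>x. g (f x))"
  by (simp add: smooth_on_def Ck_on_compose)

lemma smooth_on_inverse [smooth_intros]:
  fixes f :: "'a::euclidean_space \<Rightarrow> real"
  shows "open U \<Longrightarrow> (\<And>x. x \<in> U \<Longrightarrow> f x \<noteq> 0) \<Longrightarrow> smooth_on U f \<Longrightarrow> smooth_on U (\<lambda>x. inverse (f x))"
  by (simp add: smooth_on_def Ck_on_inverse)

lemma smooth_on_sqrt [smooth_intros]:
  fixes f :: "'a::euclidean_space \<Rightarrow> real"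
  shows "open U \<Longrightarrow> (\<And>x. x \<in> U \<Longrightarrow> f x > 0) \<Longrightarrow> smooth_on U f \<Longrightarrow> smooth_on U (\<lambda>x. sqrt (f x))"
  by (simp add: smooth_on_def Ck_on_sqrt)

lemmas smooth_on_scaleR [smooth_intros] = smooth_on_bilinear[OF bounded_bilinear_scaleR]
lemmas smooth_on_mult [smooth_intros] = smooth_on_bilinear[OF bounded_bilinear_mult]
lemmas smooth_on_inner [smooth_intros] = smooth_on_bilinear[OF bounded_bilinear_inner]
lemmas smooth_on_minus [smooth_intros] = smooth_on_bounded_linear[OF bounded_linear_minus[OF bounded_linear_ident]]
lemmas smooth_on_fst [smooth_intros] = smooth_on_bounded_linear[OF bounded_linear_fst]
lemmas smooth_on_snd [smooth_intros] = smooth_on_bounded_linear[OF bounded_linear_snd]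
lemmas smooth_on_vec_nth [smooth_intros] = smooth_on_bounded_linear[OF bounded_linear_vec_nth]

lemma smooth_on_diff [smooth_intros]:
  "open U \<Longrightarrow> smooth_on U f \<Longrightarrow> smooth_on U g \<Longrightarrow> smooth_on U (\<lambda>x. f x - g x)"
  using smooth_on_add[OF _ _ smooth_on_minus, of U f g] by simp

lemma smooth_on_divide [smooth_intros]:
  fixes f :: "'a::euclidean_space \<Rightarrow> real"
  shows "open U \<Longrightarrow> (\<And>x. x \<in> U \<Longrightarrow> g x \<noteq> 0) \<Longrightarrow> smooth_on U f \<Longrightarrow> smooth_on U g \<Longrightarrow> smooth_on U (\<lambda>x. f x / g x)"
  unfolding divide_inverse by (intro smooth_intros) auto

lemma smooth_on_Pair [smooth_intros]:
  assumes "open U" "smooth_on U f" "smooth_on U g"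
  shows "smooth_on U (\<lambda>x. (f x, g x))"
proof -
  have "bounded_linear (\<lambda>x. (x, 0))" "bounded_linear (\<lambda>x. (0, x))"
    by (intro bounded_linear_Pair bounded_linear_ident bounded_linear_zero)+
  from smooth_on_add[OF assms(1) smooth_on_bounded_linear[OF this(1) assms(1,2)] smooth_on_bounded_linear[OF this(2) assms(1,3)]]
  show ?thesis by simp
qed

lemma smooth_on_vec_lambda [smooth_intros]:
  fixes f :: "'n::finite \<Rightarrow> 'a::euclidean_space \<Rightarrow> 'b::euclidean_space"
  assumes "open U" "\<And>i. smooth_on U (f i)"
  shows "smooth_on U (\<lambda>x. \<chi> i. f i x)"
proof -
  have "bounded_linear (\<lambda>y::'b. \<chi> k. if k = i then y else 0)" for i :: 'n
    unfolding linear_conv_bounded_linear[symmetric] by (rule linearI) (auto simp: vec_eq_iff)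
  from smooth_on_bounded_linear[OF this assms(1,2)]
  have "smooth_on U (\<lambda>x. \<Sum>i\<in>UNIV. (\<chi> k. if k = i then f i x else 0))"
    by (intro smooth_on_sum assms(1)) auto
  also have "(\<lambda>x. \<Sum>i\<in>UNIV. (\<chi> k. if k = i then f i x else 0)) = (\<lambda>x. \<chi> i. f i x)"
    by (auto simp: vec_eq_iff if_distrib cong: if_cong)
  finally show ?thesis .
qed

lemma bounded_bilinear_matrix_vector_mult: "bounded_bilinear ((*v) :: real^'n^'m \<Rightarrow> real^'n \<Rightarrow> real^'m)"
  by (rule bilinear_conv_bounded_bilinear[THEN iffD1])
     (auto simp: bilinear_def intro!: linearI simp: matrix_vector_mult_add_rdistrib matrix_vector_right_distrib
        scaleR_matrix_vector_assoc matrix_vector_mult_scaleR)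

lemma bounded_bilinear_matrix_mult: "bounded_bilinear ((**) :: real^'n^'m \<Rightarrow> real^'p^'n \<Rightarrow> real^'p^'m)"
  by (rule bilinear_conv_bounded_bilinear[THEN iffD1])
     (auto simp: bilinear_def vec_eq_iff matrix_matrix_mult_def sum.distrib algebra_simps sum_distrib_left intro!: linearI)

lemma bounded_linear_transpose: "bounded_linear (transpose :: real^'n^'m \<Rightarrow> real^'m^'n)"
  unfolding linear_conv_bounded_linear[symmetric]
  by (rule linearI) (auto simp: transpose_def vec_eq_iff)

lemmas smooth_on_matrix_vector_mult [smooth_intros] = smooth_on_bilinear[OF bounded_bilinear_matrix_vector_mult]
lemmas smooth_on_matrix_mult [smooth_intros] = smooth_on_bilinear[OF bounded_bilinear_matrix_mult]
lemmas smooth_on_transpose [smooth_intros] = smooth_on_bounded_linear[OF bounded_linear_transpose]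

lemma smooth_on_cong:
  "open U \<Longrightarrow> (\<And>x. x \<in> U \<Longrightarrow> f x = g x) \<Longrightarrow> smooth_on U f \<Longrightarrow> smooth_on U g"
  unfolding smooth_on_def using Ck_on_cong by blast

lemma smooth_on_subset: "smooth_on U f \<Longrightarrow> V \<subseteq> U \<Longrightarrow> smooth_on V f"
  unfolding smooth_on_def using Ck_on_subset by blast

lemma smooth_on_local:
  assumes "open U" "\<And>x. x \<in> U \<Longrightarrow> \<exists>V g. open V \<and> x \<in> V \<and> V \<subseteq> U \<and> smooth_on V g \<and> (\<forall>y\<in>V. f y = g y)"
  shows "smooth_on U f"
  unfolding smooth_on_def
  by (intro allI Ck_on_local[OF assms(1)]) (use assms(2) smooth_on_def in metis)

lemma smooth_on_imp_continuous_on: "smooth_on U f \<Longrightarrow> continuous_on U f"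
  unfolding smooth_on_def using Ck_on_imp_continuous_on by blast

lemma smooth_on_has_derivative:
  "smooth_on U f \<Longrightarrow> open U \<Longrightarrow> x \<in> U \<Longrightarrow> (f has_derivative frechet_derivative f (at x)) (at x)"
  unfolding smooth_on_def using Ck_on_has_derivative by blast

lemma smooth_on_frechet_derivative [smooth_intros]:
  "smooth_on U f \<Longrightarrow> smooth_on U (\<lambda>x. frechet_derivative f (at x) v)"
  unfolding smooth_on_def by (metis Ck_on.simps(2))

section \<open>Symmetry of second derivatives\<close>

text \<open>The mean value theorem along \<open>u\<close> and then along \<open>v\<close> turns the
  quotient into the mixed derivative at a point of a small parallelogram; continuity of that
  derivative gives the limit. The quotient is symmetric in \<open>u\<close> and \<open>v\<close>,
  hence so is its limit.\<close>

lemma second_difference_limit: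
  fixes f :: "'a::euclidean_space \<Rightarrow> real"
  assumes "open U" "x \<in> U" "smooth_on U f"
  shows "((\<lambda>s. (f (x + s *\<^sub>R u + s *\<^sub>R v) - f (x + s *\<^sub>R u) - f (x + s *\<^sub>R v) + f x) / s\<^sup>2) \<longlongrightarrow>
     frechet_derivative (\<lambda>y. frechet_derivative f (at y) u) (at x) v) (at_right 0)"
proof (rule tendstoI)
  fix e :: real assume e: "e > 0"
  let ?g = "\<lambda>y. frechet_derivative f (at y) u"
  let ?h = "\<lambda>y. frechet_derivative ?g (at y) v"
  have g: "smooth_on U ?g" and h: "smooth_on U ?h" using assms by (auto intro: smooth_intros)
  have "isCont ?h x" using smooth_on_imp_continuous_on[OF h] assms by (simp add: continuous_on_eq_continuous_at)
  then obtain d where d: "d > 0" "\<And>y. dist y x < d \<Longrightarrow> dist (?h y) (?h x) < e"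
    using e unfolding continuous_at_eps_delta by blast
  obtain r where r: "r > 0" "ball x r \<subseteq> U" using assms open_contains_ball by blast
  \<comment> \<open>Keeps the parallelogram of side parameter below \<open>m\<close> inside both the
    \<open>d\<close>-ball and the \<open>r\<close>-ball around \<open>x\<close>; the summand 1
    covers \<open>u = v = 0\<close>.\<close>
  define m where "m = min d r / (norm u + norm v + 1)"
  have m: "m > 0" unfolding m_def using d r by (auto intro!: divide_pos_pos add_nonneg_pos)
  have near: "x + a *\<^sub>R u + b *\<^sub>R v \<in> U \<and> dist (?h (x + a *\<^sub>R u + b *\<^sub>R v)) (?h x) < e"
    if "0 \<le> a" "a \<le> s" "0 \<le> b" "b \<le> s" "0 < s" "s < m" for a b s
  proof -
    have "norm (a *\<^sub>R u + b *\<^sub>R v) \<le> a * norm u + b * norm v"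
      using norm_triangle_ineq[of "a *\<^sub>R u" "b *\<^sub>R v"] that by simp
    also have "\<dots> \<le> s * norm u + s * norm v" using that by (intro add_mono mult_right_mono) auto
    also have "\<dots> < s * (norm u + norm v + 1)" using that by (simp add: algebra_simps)
    also have "\<dots> \<le> m * (norm u + norm v + 1)" using that by (intro mult_right_mono) auto
    also have "\<dots> = min d r" unfolding m_def using norm_ge_zero[of u] norm_ge_zero[of v] by (auto simp del: norm_ge_zero)
    finally have "dist (x + a *\<^sub>R u + b *\<^sub>R v) x < min d r" by (simp add: dist_norm add.assoc)
    then show ?thesis using d(2)[of "x + a *\<^sub>R u + b *\<^sub>R v"] r(2) by (auto simp: subset_iff dist_commute)
  qed
  have "dist ((f (x + s *\<^sub>R u + s *\<^sub>R v) - f (x + s *\<^sub>R u) - f (x + s *\<^sub>R v) + f x) / s\<^sup>2) (?h x) < e"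
    if s: "0 < s" "s < m" for s
  proof -
    define p where "p t = f (x + t *\<^sub>R u + s *\<^sub>R v) - f (x + t *\<^sub>R u)" for t
    have dp: "(p has_real_derivative ?g (x + t *\<^sub>R u + s *\<^sub>R v) - ?g (x + t *\<^sub>R u)) (at t)" if "0 \<le> t" "t \<le> s" for t
    proof -
      have d1: "((\<lambda>t. f (x + t *\<^sub>R u + b *\<^sub>R v)) has_derivative (\<lambda>k. frechet_derivative f (at (x + t *\<^sub>R u + b *\<^sub>R v)) (k *\<^sub>R u))) (at t)"
        if "0 \<le> b" "b \<le> s" for b
        by (rule has_derivative_compose[of "\<lambda>t. x + t *\<^sub>R u + b *\<^sub>R v" _ _ UNIV, simplified])
           (use near[of t s b] that \<open>0 \<le> t\<close> \<open>t \<le> s\<close> s in \<open>auto intro!: derivative_eq_intros smooth_on_has_derivative[OF assms(3,1)]\<close>)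
      have lin: "linear (frechet_derivative f (at (x + t *\<^sub>R u + b *\<^sub>R v)))" if "0 \<le> b" "b \<le> s" for b
        using near[of t s b] that \<open>0 \<le> t\<close> \<open>t \<le> s\<close> s smooth_on_has_derivative[OF assms(3,1)] has_derivative_linear by blast
      show ?thesis
        unfolding has_field_derivative_def p_def
        by (rule has_derivative_eq_rhs[OF has_derivative_diff[OF d1[of s] d1[of 0, simplified]]])
          (use lin[of s] lin[of 0] s in \<open>auto simp: linear_cmul algebra_simps\<close>)
    qed
    obtain a where a: "0 < a" "a < s" "p s - p 0 = (s - 0) * (?g (x + a *\<^sub>R u + s *\<^sub>R v) - ?g (x + a *\<^sub>R u))"
      using MVT2[of 0 s p "\<lambda>t. ?g (x + t *\<^sub>R u + s *\<^sub>R v) - ?g (x + t *\<^sub>R u)"] s dp by auto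
    have dq: "((\<lambda>t. ?g (x + a *\<^sub>R u + t *\<^sub>R v)) has_real_derivative ?h (x + a *\<^sub>R u + t *\<^sub>R v)) (at t)" if "0 \<le> t" "t \<le> s" for t
    proof -
      have in_U: "x + a *\<^sub>R u + t *\<^sub>R v \<in> U" using near[of a s t] that a s by auto
      have "((\<lambda>t. ?g (x + a *\<^sub>R u + t *\<^sub>R v)) has_derivative (\<lambda>k. frechet_derivative ?g (at (x + a *\<^sub>R u + t *\<^sub>R v)) (k *\<^sub>R v))) (at t)"
        by (rule has_derivative_compose[of "\<lambda>t. x + a *\<^sub>R u + t *\<^sub>R v" _ _ UNIV, simplified])
           (use in_U in \<open>auto intro!: derivative_eq_intros smooth_on_has_derivative[OF g assms(1)]\<close>)
      moreover have "linear (frechet_derivative ?g (at (x + a *\<^sub>R u + t *\<^sub>R v)))"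
        using smooth_on_has_derivative[OF g assms(1) in_U] has_derivative_linear by blast
      ultimately show ?thesis unfolding has_field_derivative_def by (simp add: linear_cmul mult.commute[of _ "?h _"])
    qed
    obtain b where b: "0 < b" "b < s" "?g (x + a *\<^sub>R u + s *\<^sub>R v) - ?g (x + a *\<^sub>R u + 0 *\<^sub>R v) = (s - 0) * ?h (x + a *\<^sub>R u + b *\<^sub>R v)"
      using MVT2[of 0 s "\<lambda>t. ?g (x + a *\<^sub>R u + t *\<^sub>R v)" "\<lambda>t. ?h (x + a *\<^sub>R u + t *\<^sub>R v)"] s dq by auto
    have "f (x + s *\<^sub>R u + s *\<^sub>R v) - f (x + s *\<^sub>R u) - f (x + s *\<^sub>R v) + f x = s\<^sup>2 * ?h (x + a *\<^sub>R u + b *\<^sub>R v)"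
      using a(3) b(3) by (simp add: p_def power2_eq_square)
    then show ?thesis using near[of a s b] a b s by simp
  qed
  then show "eventually (\<lambda>s. dist ((f (x + s *\<^sub>R u + s *\<^sub>R v) - f (x + s *\<^sub>R u) - f (x + s *\<^sub>R v) + f x) / s\<^sup>2) (?h x) < e) (at_right 0)"
    using m unfolding eventually_at_right_field by auto
qed

lemma frechet_derivative_inner_left:
  "f differentiable at y \<Longrightarrow> frechet_derivative (\<lambda>z. f z \<bullet> b) (at y) u = frechet_derivative f (at y) u \<bullet> b"
  using frechet_derivative_at[OF has_derivative_inner_left[OF frechet_derivative_works[THEN iffD1]], of f y b]
  by (simp add: fun_eq_iff)

lemma second_derivative_symmetric:
  fixes f :: "'a::euclidean_space \<Rightarrow> 'b::euclidean_space"
  assumes U: "open U" "x \<in> U" and f: "smooth_on U f"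
  shows "frechet_derivative (\<lambda>y. frechet_derivative f (at y) u) (at x) v
       = frechet_derivative (\<lambda>y. frechet_derivative f (at y) v) (at x) u"
proof (rule euclidean_eqI)
  fix b :: 'b
  let ?f = "\<lambda>y. f y \<bullet> b"
  have sm: "smooth_on U ?f" using assms by (auto intro: smooth_intros)
  have *: "frechet_derivative (\<lambda>y. frechet_derivative f (at y) u) (at x) v \<bullet> b
     = frechet_derivative (\<lambda>y. frechet_derivative ?f (at y) u) (at x) v" for u v
  proof -
    have fd: "f differentiable at y" if "y \<in> U" for y
      using smooth_on_has_derivative[OF f U(1) that] differentiableI by blast
    have gd: "(\<lambda>y. frechet_derivative f (at y) u) differentiable at x"
      using smooth_on_has_derivative[OF smooth_on_frechet_derivative[OF f] U] differentiableI by blast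
    have "frechet_derivative (\<lambda>y. frechet_derivative f (at y) u \<bullet> b) (at x) v
        = frechet_derivative (\<lambda>y. frechet_derivative ?f (at y) u) (at x) v"
      by (subst frechet_derivative_transform_within_open[of _ x U "\<lambda>y. frechet_derivative ?f (at y) u"])
         (use U gd in \<open>auto intro: differentiable_inner simp: frechet_derivative_inner_left[OF fd]\<close>)
    then show ?thesis using frechet_derivative_inner_left[OF gd] by simp
  qed
  have "frechet_derivative (\<lambda>y. frechet_derivative ?f (at y) u) (at x) v
      = frechet_derivative (\<lambda>y. frechet_derivative ?f (at y) v) (at x) u"
  proof (rule tendsto_unique)
    show "((\<lambda>s. (?f (x + s *\<^sub>R u + s *\<^sub>R v) - ?f (x + s *\<^sub>R u) - ?f (x + s *\<^sub>R v) + ?f x) / s\<^sup>2) \<longlongrightarrow>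
       frechet_derivative (\<lambda>y. frechet_derivative ?f (at y) u) (at x) v) (at_right 0)"
      by (rule second_difference_limit[OF U sm])
    show "((\<lambda>s. (?f (x + s *\<^sub>R u + s *\<^sub>R v) - ?f (x + s *\<^sub>R u) - ?f (x + s *\<^sub>R v) + ?f x) / s\<^sup>2) \<longlongrightarrow>
       frechet_derivative (\<lambda>y. frechet_derivative ?f (at y) v) (at x) u) (at_right 0)"
      using second_difference_limit[OF U sm, of v u] by (simp add: add_ac diff_diff_eq)
  qed simp
  then show "frechet_derivative (\<lambda>y. frechet_derivative f (at y) u) (at x) v \<bullet> b
    = frechet_derivative (\<lambda>y. frechet_derivative f (at y) v) (at x) u \<bullet> b"
    by (simp add: *)
qed

section \<open>Linear systems with nilpotent closed coefficients\<close>

text \<open>The Poincare lemma for 1-forms: \<open>p x\<close> integrates \<open>w\<close> along the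
  segment from \<open>z\<close> to \<open>x\<close> and is differentiated under the integral
  sign.\<close>

lemma closed_form_has_primitive:
  fixes w :: "'a::euclidean_space \<Rightarrow> 'a \<Rightarrow> 'b::euclidean_space"
  assumes S: "open S" "convex S" "z \<in> S"
    and lin: "\<And>x. x \<in> S \<Longrightarrow> linear (w x)"
    and sm: "\<And>v. smooth_on S (\<lambda>x. w x v)"
    and closed: "\<And>x u v. x \<in> S \<Longrightarrow>
      frechet_derivative (\<lambda>y. w y u) (at x) v = frechet_derivative (\<lambda>y. w y v) (at x) u"
  obtains p where "p z = 0" "\<And>x. x \<in> S \<Longrightarrow> (p has_derivative w x) (at x)"
proof -
  define D where "D u y v = frechet_derivative (\<lambda>x. w x u) (at y) v" for u y v
  have wd: "((\<lambda>x. w x u) has_derivative D u y) (at y)" if "y \<in> S" for u y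
    unfolding D_def using smooth_on_has_derivative[OF sm S(1) that, of u] by (simp add: eta_contract_eq)
  have linD: "linear (D u y)" if "y \<in> S" for u y using wd[OF that] has_derivative_linear by blast
  have Dc: "continuous_on S (\<lambda>y. D u y v)" for u v
    unfolding D_def by (intro smooth_on_imp_continuous_on smooth_intros sm)
  have wc: "continuous_on S (\<lambda>y. w y v)" for v
    by (intro smooth_on_imp_continuous_on sm)
  have mem: "z + t *\<^sub>R (x - z) \<in> S" if "x \<in> S" "t \<in> cbox 0 1" for x and t :: real
    using convexD[OF S(2) S(3) that(1), of "1 - t" t] that(2) by (simp add: algebra_simps)
  \<comment> \<open>The integrand is \<open>w\<close> at the moving point applied to
    \<open>x - z\<close>, written in coordinates because only derivatives of \<open>w\<close> with a
    fixed argument are at hand.\<close>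
  define F where "F x t = (\<Sum>b\<in>Basis. ((x - z) \<bullet> b) *\<^sub>R w (z + t *\<^sub>R (x - z)) b)" for x and t :: real
  define G where "G x t v = (\<Sum>b\<in>Basis. ((x - z) \<bullet> b) *\<^sub>R D b (z + t *\<^sub>R (x - z)) (t *\<^sub>R v)
      + (v \<bullet> b) *\<^sub>R w (z + t *\<^sub>R (x - z)) b)" for x and t :: real and v
  have FG: "((\<lambda>x. F x t) has_derivative G x t) (at x)" if "x \<in> S" "t \<in> cbox 0 1" for x t
  proof -
    have "((\<lambda>x. w (z + t *\<^sub>R (x - z)) b) has_derivative (\<lambda>v. D b (z + t *\<^sub>R (x - z)) (t *\<^sub>R v))) (at x)" for b
      by (rule has_derivative_compose[of "\<lambda>x. z + t *\<^sub>R (x - z)" "\<lambda>v. t *\<^sub>R v" x UNIV])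
        (auto intro!: derivative_eq_intros wd mem that)
    then show ?thesis unfolding F_def G_def
      by (intro has_derivative_sum has_derivative_scaleR[of _ "\<lambda>v. v \<bullet> _"]) (auto intro!: derivative_eq_intros)
  qed
  have Gb: "bounded_linear (G x t)" if "x \<in> S" "t \<in> cbox 0 1" for x t
    using FG[OF that] has_derivative_bounded_linear by blast
  \<comment> \<open>Closedness exchanges the two arguments of the derivative of \<open>w\<close>. In
    the new form \<open>G x t v\<close> is the \<open>t\<close>-derivative of
    \<open>t *\<^sub>R w (z + t *\<^sub>R (x - z)) v\<close>, so its integral over the unit interval
    is \<open>w x v\<close>.\<close>
  have G_eq: "G x t v = D v (z + t *\<^sub>R (x - z)) (t *\<^sub>R (x - z)) + w (z + t *\<^sub>R (x - z)) v"
    if "x \<in> S" "t \<in> cbox 0 1" for x t v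
  proof -
    let ?y = "z + t *\<^sub>R (x - z)"
    interpret w: linear "w ?y" by (rule lin[OF mem[OF that]])
    have D: "linear (D u ?y)" for u by (rule linD[OF mem[OF that]])
    have "(\<Sum>b\<in>Basis. ((x - z) \<bullet> b) *\<^sub>R D b ?y (t *\<^sub>R v)) = t *\<^sub>R (\<Sum>b\<in>Basis. ((x - z) \<bullet> b) *\<^sub>R D v ?y b)"
      unfolding scaleR_sum_right
    proof (rule sum.cong)
      fix b :: 'a
      have "D b ?y v = D v ?y b" unfolding D_def by (rule closed[OF mem[OF that]])
      then show "((x - z) \<bullet> b) *\<^sub>R D b ?y (t *\<^sub>R v) = t *\<^sub>R ((x - z) \<bullet> b) *\<^sub>R D v ?y b"
        by (simp add: linear_cmul[OF D])
    qed simp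
    also have "(\<Sum>b\<in>Basis. ((x - z) \<bullet> b) *\<^sub>R D v ?y b) = D v ?y (\<Sum>b\<in>Basis. ((x - z) \<bullet> b) *\<^sub>R b)"
      by (simp add: linear_sum[OF D] linear_cmul[OF D])
    finally have 1: "(\<Sum>b\<in>Basis. ((x - z) \<bullet> b) *\<^sub>R D b ?y (t *\<^sub>R v)) = D v ?y (t *\<^sub>R (x - z))"
      by (simp add: euclidean_representation linear_cmul[OF D])
    have "(\<Sum>b\<in>Basis. (v \<bullet> b) *\<^sub>R w ?y b) = w ?y (\<Sum>b\<in>Basis. (v \<bullet> b) *\<^sub>R b)"
      by (simp add: w.sum w.scaleR)
    then show ?thesis unfolding G_def sum.distrib 1 by (simp add: euclidean_representation)
  qed
  define p where "p x = integral (cbox 0 1) (F x)" for x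
  have cont: "continuous_on (S \<times> cbox 0 1) (\<lambda>(x, t). F x t)"
    unfolding F_def split_beta
    by (intro continuous_intros continuous_on_compose2[OF wc]) (auto intro!: mem)
  have contG: "continuous_on (S \<times> cbox 0 1) (\<lambda>(x, t). G x t v)" for v
  proof -
    have "continuous_on (S \<times> cbox 0 1) (\<lambda>(x, t). \<Sum>b\<in>Basis. ((x - z) \<bullet> b) *\<^sub>R t *\<^sub>R D b (z + t *\<^sub>R (x - z)) v
      + (v \<bullet> b) *\<^sub>R w (z + t *\<^sub>R (x - z)) b)"
      unfolding split_beta
      by (intro continuous_intros continuous_on_compose2[OF wc] continuous_on_compose2[OF Dc]) (auto intro!: mem)
    moreover have "(case xt of (x, t) \<Rightarrow> \<Sum>b\<in>Basis. ((x - z) \<bullet> b) *\<^sub>R t *\<^sub>R D b (z + t *\<^sub>R (x - z)) v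
      + (v \<bullet> b) *\<^sub>R w (z + t *\<^sub>R (x - z)) b) = (case xt of (x, t) \<Rightarrow> G x t v)" if "xt \<in> S \<times> cbox 0 1" for xt
      using that unfolding G_def by (auto intro!: sum.cong simp: linear_cmul[OF linD[OF mem]])
    ultimately show ?thesis by (subst continuous_on_cong[OF refl]) auto
  qed
  have F_int: "F x integrable_on cbox 0 1" if "x \<in> S" for x
  proof -
    have "continuous_on (cbox 0 1) (\<lambda>t. case (x, t) of (x, t) \<Rightarrow> F x t)"
      by (rule continuous_on_compose2[OF cont]) (use that in \<open>auto intro!: continuous_intros\<close>)
    then show ?thesis by (intro integrable_continuous) simp
  qed
  have contB: "continuous_on (S \<times> cbox 0 1) (\<lambda>(x, t). Blinfun (G x t))"
  proof (rule continuous_on_blinfun_componentwise)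
    fix i :: 'a
    have "continuous_on (S \<times> cbox 0 1) (\<lambda>xt. blinfun_apply (case xt of (x, t) \<Rightarrow> Blinfun (G x t)) i)
      = continuous_on (S \<times> cbox 0 1) (\<lambda>(x, t). G x t i)"
      by (rule continuous_on_cong) (auto simp: bounded_linear_Blinfun_apply[OF Gb])
    then show "continuous_on (S \<times> cbox 0 1) (\<lambda>xt. blinfun_apply (case xt of (x, t) \<Rightarrow> Blinfun (G x t)) i)"
      using contG by simp
  qed
  have pd: "(p has_derivative integral (cbox 0 1) (\<lambda>t. Blinfun (G x t))) (at x)" if "x \<in> S" for x
  proof -
    have "((\<lambda>x. integral (cbox 0 1) (F x)) has_derivative integral (cbox 0 1) (\<lambda>t. Blinfun (G x t))) (at x within S)"
    proof (rule leibniz_rule[OF _ F_int contB that S(2)])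
      show "((\<lambda>x. F x t) has_derivative blinfun_apply (Blinfun (G x t))) (at x within S)"
        if "x \<in> S" "t \<in> cbox 0 1" for x t
        using FG[OF that] by (simp add: bounded_linear_Blinfun_apply[OF Gb[OF that]] has_derivative_at_withinI)
    qed
    then show ?thesis using at_within_open[OF that S(1)] by (simp add: p_def[abs_def])
  qed
  have G_int: "blinfun_apply (integral (cbox 0 1) (\<lambda>t. Blinfun (G x t))) v = w x v" if x: "x \<in> S" for x v
  proof -
    have "(\<lambda>t. Blinfun (G x t)) integrable_on cbox 0 1"
    proof -
      have "continuous_on (cbox 0 1) (\<lambda>t. case (x, t) of (x, t) \<Rightarrow> Blinfun (G x t))"
        by (rule continuous_on_compose2[OF contB]) (use that in \<open>auto intro!: continuous_intros\<close>)
      then show ?thesis by (intro integrable_continuous) simp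
    qed
    then have "blinfun_apply (integral (cbox 0 1) (\<lambda>t. Blinfun (G x t))) v
        = integral (cbox 0 1) (\<lambda>t. blinfun_apply (Blinfun (G x t)) v)"
      using blinfun_apply_integral by blast
    also have "\<dots> = integral {0..1} (\<lambda>t. G x t v)"
      by (simp, rule integral_cong) (auto simp: bounded_linear_Blinfun_apply[OF Gb] that)
    also have "((\<lambda>t. G x t v) has_integral 1 *\<^sub>R w (z + 1 *\<^sub>R (x - z)) v - 0 *\<^sub>R w (z + 0 *\<^sub>R (x - z)) v) {0..1}"
    proof (rule fundamental_theorem_of_calculus)
      fix t :: real assume t: "t \<in> {0..1}"
      then have m: "z + t *\<^sub>R (x - z) \<in> S" using mem[OF x] by simp
      have "((\<lambda>t. w (z + t *\<^sub>R (x - z)) v) has_derivative (\<lambda>k. D v (z + t *\<^sub>R (x - z)) (k *\<^sub>R (x - z)))) (at t)"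
        by (rule has_derivative_compose[of "\<lambda>t. z + t *\<^sub>R (x - z)" "\<lambda>k. k *\<^sub>R (x - z)" t UNIV])
          (auto intro!: derivative_eq_intros wd m)
      then have "((\<lambda>t. t *\<^sub>R w (z + t *\<^sub>R (x - z)) v) has_derivative (\<lambda>k. k *\<^sub>R G x t v)) (at t)"
        by (rule has_derivative_eq_rhs[OF has_derivative_scaleR[OF has_derivative_ident]])
          (use t in \<open>simp add: G_eq[OF x] linear_cmul[OF linD[OF m]] scaleR_add_right mult.commute fun_eq_iff add.commute\<close>)
      then show "((\<lambda>t. t *\<^sub>R w (z + t *\<^sub>R (x - z)) v) has_vector_derivative G x t v) (at t within {0..1})"
        unfolding has_vector_derivative_def by (rule has_derivative_at_withinI)
    qed simp
    then have "integral {0..1} (\<lambda>t. G x t v) = w x v" by (simp add: integral_unique)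
    finally show ?thesis .
  qed
  show ?thesis
  proof (rule that[of p])
    show "p z = 0" by (simp add: p_def F_def[abs_def])
    show "(p has_derivative w x) (at x)" if "x \<in> S" for x
      using pd[OF that] G_int[OF that] by (metis (no_types, lifting) ext)
  qed
qed

section \<open>Uniqueness for linear total differential equations\<close>

text \<open>Gronwall's argument on the segment from \<open>a\<close> to \<open>x\<close>: the weight
  \<open>exp (- L * t)\<close> absorbs the growth of the squared norm (hence the 2 in
  \<open>L\<close>), so \<open>g\<close> starts at 0 and cannot increase.\<close>

lemma zero_of_linear_growth:
  fixes Y :: "'a::real_normed_vector \<Rightarrow> 'b::real_inner"
  assumes "convex S" "\<And>x. x \<in> S \<Longrightarrow> (Y has_derivative Y' x) (at x)"
    and K: "\<And>x v. x \<in> S \<Longrightarrow> norm (Y' x v) \<le> K * norm v * norm (Y x)"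
    and a: "a \<in> S" "Y a = 0" and x: "x \<in> S"
  shows "Y x = 0"
proof -
  define L where "L = 2 * K * norm (x - a)"
  define c where "c t = a + t *\<^sub>R (x - a)" for t
  define g where "g t = exp (- L * t) * (Y (c t) \<bullet> Y (c t))" for t
  have c: "c t \<in> S" if "0 \<le> t" "t \<le> 1" for t
    using convexD[OF assms(1) a(1) x, of "1 - t" t] that by (simp add: c_def algebra_simps)
  have "g 1 \<le> g 0"
  proof (rule DERIV_nonpos_imp_nonincreasing[of 0 1 g])
    fix t :: real assume t: "0 \<le> t" "t \<le> 1"
    have dY: "((\<lambda>t. Y (c t)) has_derivative (\<lambda>k. Y' (c t) (k *\<^sub>R (x - a)))) (at t)"
      by (rule has_derivative_compose[of c "\<lambda>k. k *\<^sub>R (x - a)" t UNIV])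
        (auto intro!: derivative_eq_intros assms(2) c t simp: c_def[abs_def, symmetric], auto simp: c_def[abs_def] intro!: derivative_eq_intros)
    interpret linear "Y' (c t)" using assms(2)[OF c[OF t]] has_derivative_linear by blast
    have "((\<lambda>t. Y (c t) \<bullet> Y (c t)) has_derivative (\<lambda>k. k * (2 * (Y (c t) \<bullet> Y' (c t) (x - a))))) (at t)"
      by (rule has_derivative_eq_rhs[OF has_derivative_inner[OF dY dY]]) (simp add: scaleR inner_commute fun_eq_iff)
    then have "((\<lambda>t. Y (c t) \<bullet> Y (c t)) has_real_derivative 2 * (Y (c t) \<bullet> Y' (c t) (x - a))) (at t)"
      unfolding has_field_derivative_def by (rule has_derivative_eq_rhs) (simp add: fun_eq_iff)
    then have "(g has_real_derivative exp (- L * t) * (2 * (Y (c t) \<bullet> Y' (c t) (x - a)) - L * (Y (c t) \<bullet> Y (c t)))) (at t)"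
      unfolding g_def by (auto intro!: derivative_eq_intros simp: algebra_simps)
    moreover have "2 * (Y (c t) \<bullet> Y' (c t) (x - a)) \<le> L * (Y (c t) \<bullet> Y (c t))"
    proof -
      have "Y (c t) \<bullet> Y' (c t) (x - a) \<le> norm (Y (c t)) * norm (Y' (c t) (x - a))" by (rule norm_cauchy_schwarz)
      also have "\<dots> \<le> norm (Y (c t)) * (K * norm (x - a) * norm (Y (c t)))"
        by (intro mult_left_mono K c t) auto
      finally show ?thesis by (simp add: L_def dot_square_norm power2_eq_square mult_ac)
    qed
    ultimately show "\<exists>y. (g has_real_derivative y) (at t) \<and> y \<le> 0"
      by (auto intro!: exI mult_nonneg_nonpos)
  qed simp
  then have "Y (c 1) \<bullet> Y (c 1) \<le> 0" by (simp add: g_def c_def a mult_le_0_iff)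
  then have "Y x \<bullet> Y x \<le> 0" by (simp add: c_def)
  then show ?thesis by (metis inner_gt_zero_iff not_le)
qed

text \<open>The coefficients of the equation \<open>dP v = T x v P\<close> for an unknown
  \<open>P\<close> on \<open>S\<close>; the equation itself appears as a hypothesis of the
  lemmas.\<close>

locale linear_system =
  fixes S :: "'a::euclidean_space set" and T :: "'a \<Rightarrow> 'a \<Rightarrow> 'b::euclidean_space \<Rightarrow> 'b"
  assumes S: "open S"
    and lin_v: "\<And>x y. x \<in> S \<Longrightarrow> linear (\<lambda>v. T x v y)"
    and lin_y: "\<And>x v. x \<in> S \<Longrightarrow> linear (T x v)"
    and sm: "\<And>v y. smooth_on S (\<lambda>x. T x v y)"
begin

lemma T_sum: "x \<in> S \<Longrightarrow> T x v y = (\<Sum>b\<in>Basis. (y \<bullet> b) *\<^sub>R T x v b)"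
  using linear_sum[OF lin_y, of x v "\<lambda>b. (y \<bullet> b) *\<^sub>R b" Basis] linear_cmul[OF lin_y, of x v]
  by (simp add: euclidean_representation)

lemma Ck_on_T: "Ck_on k S P \<Longrightarrow> Ck_on k S (\<lambda>x. T x v (P x))"
  by (rule Ck_on_cong[OF S, of "\<lambda>x. \<Sum>b\<in>Basis. (P x \<bullet> b) *\<^sub>R T x v b"])
    (use sm in \<open>auto simp: T_sum[of _ v "P _"] smooth_on_def intro!: Ck_on_sum S
       Ck_on_bilinear[OF bounded_bilinear_scaleR] Ck_on_bounded_linear[OF bounded_linear_inner_left]\<close>)

text \<open>Bootstrapping: if \<open>P\<close> is k times continuously differentiable, so is the
  right-hand side, which is the derivative of \<open>P\<close>.\<close>

lemma solution_smooth:
  assumes "\<And>x. x \<in> S \<Longrightarrow> (P has_derivative (\<lambda>v. T x v (P x))) (at x)"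
  shows "smooth_on S P"
proof -
  have "Ck_on k S P" for k
  proof (induction k)
    case 0
    then show ?case using assms S has_derivative_continuous by (fastforce simp: continuous_on_eq_continuous_at)
  next
    case (Suc k)
    show ?case by (rule Ck_on_SucI[OF S assms Ck_on_T[OF Suc]])
  qed
  then show ?thesis by (simp add: smooth_on_def)
qed

lemma frechet_derivative_T:
  assumes "smooth_on S P" "x \<in> S"
  shows "frechet_derivative (\<lambda>x. T x v (P x)) (at x) u =
    (\<Sum>b\<in>Basis. (P x \<bullet> b) *\<^sub>R frechet_derivative (\<lambda>x. T x v b) (at x) u) + T x v (frechet_derivative P (at x) u)"
proof -
  have "((\<lambda>x. \<Sum>b\<in>Basis. (P x \<bullet> b) *\<^sub>R T x v b) has_derivative (\<lambda>u. \<Sum>b\<in>Basis. (P x \<bullet> b) *\<^sub>R frechet_derivative (\<lambda>x. T x v b) (at x) u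
     + (frechet_derivative P (at x) u \<bullet> b) *\<^sub>R T x v b)) (at x)"
    by (intro has_derivative_sum has_derivative_scaleR has_derivative_inner_left smooth_on_has_derivative[OF assms(1) S assms(2)]
       smooth_on_has_derivative[OF sm S assms(2)])
  then have "((\<lambda>x. T x v (P x)) has_derivative (\<lambda>u. \<Sum>b\<in>Basis. (P x \<bullet> b) *\<^sub>R frechet_derivative (\<lambda>x. T x v b) (at x) u
     + (frechet_derivative P (at x) u \<bullet> b) *\<^sub>R T x v b)) (at x)"
    by (rule has_derivative_transform_within_open[OF _ S assms(2)]) (rule T_sum[symmetric])
  from fun_cong[OF frechet_derivative_at[OF this], of u] show ?thesis
    by (simp add: sum.distrib T_sum[OF assms(2), of v "frechet_derivative P (at x) u"])
qed

lemma bounded_on_compact: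
  assumes "compact C" "C \<subseteq> S"
  obtains K where "K \<ge> 0" "\<And>x v y. x \<in> C \<Longrightarrow> norm (T x v y) \<le> K * norm v * norm y"
proof -
  have "\<exists>k\<ge>0. \<forall>x\<in>C. norm (T x i b) \<le> k" for i b
  proof -
    have "continuous_on C (\<lambda>x. T x i b)"
      using smooth_on_imp_continuous_on[OF sm] assms(2) by (rule continuous_on_subset)
    then have "bounded ((\<lambda>x. T x i b) ` C)" using assms(1) compact_continuous_image compact_imp_bounded by blast
    then obtain k where "k > 0" "\<And>x. x \<in> C \<Longrightarrow> norm (T x i b) \<le> k" unfolding bounded_pos by auto
    then show ?thesis by (intro exI[of _ k]) auto
  qed
  then obtain k where k: "\<And>i b. k i b \<ge> 0" "\<And>i b x. x \<in> C \<Longrightarrow> norm (T x i b) \<le> k i b" by metis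
  show ?thesis
  proof (rule that[of "\<Sum>b\<in>Basis. \<Sum>i\<in>Basis. k i b"])
    show "0 \<le> (\<Sum>b\<in>Basis. \<Sum>i\<in>Basis. k i b)" by (intro sum_nonneg k)
    fix x v y assume x: "x \<in> C"
    then have xS: "x \<in> S" using assms(2) by blast
    have Tv: "T x v b = (\<Sum>i\<in>Basis. (v \<bullet> i) *\<^sub>R T x i b)" for b
      using linear_sum[OF lin_v[OF xS, of b], of "\<lambda>i. (v \<bullet> i) *\<^sub>R i" Basis] linear_cmul[OF lin_v[OF xS, of b]]
      by (simp add: euclidean_representation)
    have "T x v y = (\<Sum>b\<in>Basis. \<Sum>i\<in>Basis. (y \<bullet> b) *\<^sub>R (v \<bullet> i) *\<^sub>R T x i b)"
      unfolding T_sum[OF xS, of v y] scaleR_sum_right[symmetric] Tv[symmetric] ..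
    also have "norm \<dots> \<le> (\<Sum>b\<in>Basis. \<Sum>i\<in>Basis. norm ((y \<bullet> b) *\<^sub>R (v \<bullet> i) *\<^sub>R T x i b))"
      by (intro order_trans[OF norm_sum] sum_mono norm_sum)
    also have "\<dots> \<le> (\<Sum>b\<in>Basis. \<Sum>i\<in>Basis. norm y * (norm v * k i b))"
      unfolding norm_scaleR
      by (intro sum_mono mult_mono Basis_le_norm k x mult_nonneg_nonneg) auto
    also have "\<dots> = (\<Sum>b\<in>Basis. \<Sum>i\<in>Basis. k i b) * norm v * norm y"
      by (simp add: sum_distrib_right sum_distrib_left mult_ac)
    finally show "norm (T x v y) \<le> (\<Sum>b\<in>Basis. \<Sum>i\<in>Basis. k i b) * norm v * norm y" .
  qed
qed

text \<open>The compact set \<open>C\<close> bounds the coefficients, while the equation is known on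
  the convex part \<open>W\<close>. In the applications these are a closed ball and the open ball
  with the same centre and radius.\<close>

lemma solution_zero:
  assumes "compact C" "C \<subseteq> S" "convex W" "W \<subseteq> C"
    and "\<And>x. x \<in> W \<Longrightarrow> (Y has_derivative (\<lambda>v. T x v (Y x))) (at x)"
    and "a \<in> W" "Y a = 0" "x \<in> W"
  shows "Y x = 0"
proof -
  obtain K where "\<And>x v y. x \<in> C \<Longrightarrow> norm (T x v y) \<le> K * norm v * norm y"
    using bounded_on_compact[OF assms(1,2)] by metis
  then show ?thesis
    using zero_of_linear_growth[OF assms(3,5) _ assms(6-8), of K] assms(4) by blast
qed

lemma solution_unique:
  assumes C: "compact C" "C \<subseteq> S" "convex W" "W \<subseteq> C"
    and P: "\<And>x. x \<in> W \<Longrightarrow> (P has_derivative (\<lambda>v. T x v (P x))) (at x)"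
    and Q: "\<And>x. x \<in> W \<Longrightarrow> (Q has_derivative (\<lambda>v. T x v (Q x))) (at x)"
    and "a \<in> W" "P a = Q a" "x \<in> W"
  shows "P x = Q x"
proof -
  have "P x - Q x = 0"
  proof (rule solution_zero[OF C _ assms(7) _ assms(9), of "\<lambda>x. P x - Q x"])
    fix y assume y: "y \<in> W"
    then have "y \<in> S" using C by blast
    then show "((\<lambda>x. P x - Q x) has_derivative (\<lambda>v. T y v (P y - Q y))) (at y)"
      using has_derivative_diff[OF P[OF y] Q[OF y]] by (simp add: linear_diff[OF lin_y])
  qed (use assms(8) in simp)
  then show ?thesis by simp
qed

lemma restrict: "V \<subseteq> S \<Longrightarrow> open V \<Longrightarrow> linear_system V T"
  by (intro linear_system.intro) (blast intro: lin_v lin_y smooth_on_subset[OF sm])+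

end

section \<open>Local existence by Picard iteration\<close>

text \<open>Integrability of \<open>dP v = T x v P\<close> only asks that the antisymmetrized
  derivative of \<open>T\<close> and the commutator of its values cancel; here each vanishes
  separately.\<close>

locale nilpotent_flat_system = linear_system S T
  for S :: "'a::euclidean_space set" and T :: "'a \<Rightarrow> 'a \<Rightarrow> 'b::euclidean_space \<Rightarrow> 'b" +
  assumes closed: "\<And>x u v y. x \<in> S \<Longrightarrow>
      frechet_derivative (\<lambda>x. T x u y) (at x) v = frechet_derivative (\<lambda>x. T x v y) (at x) u"
    and nil: "\<And>x u v y. x \<in> S \<Longrightarrow> T x u (T x v y) = 0"
begin

text \<open>One Picard step. The derivative of \<open>T x v (P x)\<close> along \<open>u\<close> has
  two terms: one is symmetric by \<open>closed\<close>, the other is 0 by the hypothesis on the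
  derivative of \<open>P\<close>. So the form has a primitive \<open>Q\<close>, and
  \<open>nil\<close> gives \<open>Q\<close> the same property, which lets the step be
  repeated.\<close>

lemma iterated_primitive:
  assumes "convex S" "z \<in> S" "smooth_on S P"
    and "\<And>x u v. x \<in> S \<Longrightarrow> T x u (frechet_derivative P (at x) v) = 0"
  obtains Q where "Q z = 0" "smooth_on S Q" "\<And>x. x \<in> S \<Longrightarrow> (Q has_derivative (\<lambda>v. T x v (P x))) (at x)"
    "\<And>x u v. x \<in> S \<Longrightarrow> T x u (frechet_derivative Q (at x) v) = 0"
proof -
  have Ck: "Ck_on k S (\<lambda>x. T x v (P x))" for k v using Ck_on_T assms(3) by (simp add: smooth_on_def)
  obtain Q where Q: "Q z = 0" "\<And>x. x \<in> S \<Longrightarrow> (Q has_derivative (\<lambda>v. T x v (P x))) (at x)"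
  proof (rule closed_form_has_primitive[OF S assms(1,2), of "\<lambda>x v. T x v (P x)"])
    show "smooth_on S (\<lambda>x. T x v (P x))" for v using Ck by (simp add: smooth_on_def)
    show "frechet_derivative (\<lambda>y. T y u (P y)) (at x) v = frechet_derivative (\<lambda>y. T y v (P y)) (at x) u"
      if "x \<in> S" for x u v
      by (simp add: frechet_derivative_T[OF assms(3) that] assms(4)[OF that] closed[OF that, of u _ v])
  qed (use lin_v in auto)
  have "smooth_on S Q"
    unfolding smooth_on_def by (intro allI, rule Ck_on_Suc_imp, rule Ck_on_SucI[OF S Q(2) Ck])
  moreover have "T x u (frechet_derivative Q (at x) v) = 0" if "x \<in> S" for x u v
    using frechet_derivative_at[OF Q(2)[OF that], symmetric] nil[OF that] by simp
  ultimately show ?thesis using that Q by blast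
qed

text \<open>The solution is the sum of the iterates. \<open>nil\<close> concerns products at one
  point only, so the series need not terminate; on a ball with \<open>K * r\<close> at most 1/2 each
  iterate is at most half as large as the previous bound, and the series converges
  geometrically.\<close>

lemma local_solution:
  assumes S_ball: "S = ball z r" "r > 0"
    and bound: "\<And>x v y. x \<in> S \<Longrightarrow> norm (T x v y) \<le> K * norm v * norm y" and K: "K \<ge> 0" "K * r \<le> 1 / 2"
  obtains P where "P z = y0" "smooth_on S P" "\<And>x. x \<in> S \<Longrightarrow> (P has_derivative (\<lambda>v. T x v (P x))) (at x)"
proof -
  have cz: "convex S" "z \<in> S" using S_ball by auto
  \<comment> \<open>The invariant carried through the recursive choice. Its last clause records that
    the sequence starts with the constant \<open>y0\<close>.\<close>
  define good where "good n P \<longleftrightarrow> smooth_on S P \<and> (\<forall>x\<in>S. \<forall>u v. T x u (frechet_derivative P (at x) v) = 0) \<and>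
      (\<forall>x\<in>S. norm (P x) \<le> norm y0 * (1 / 2) ^ n) \<and> (n = 0 \<longrightarrow> P = (\<lambda>x. y0))" for n :: nat and P
  have "\<exists>\<Phi>. \<forall>n. good n (\<Phi> n) \<and> (\<Phi> (Suc n) z = 0 \<and> (\<forall>x\<in>S. (\<Phi> (Suc n) has_derivative (\<lambda>v. T x v (\<Phi> n x))) (at x)))"
  proof (rule dependent_nat_choice)
    have "good 0 (\<lambda>x. y0)"
      unfolding good_def using S lin_y linear_0 by (auto intro: smooth_intros)
    then show "\<exists>P. good 0 P" by (rule exI[of "good 0" "\<lambda>x. y0"])
  next
    fix P n assume P: "good n P"
    obtain Q where Q: "Q z = 0" "smooth_on S Q" "\<And>x. x \<in> S \<Longrightarrow> (Q has_derivative (\<lambda>v. T x v (P x))) (at x)"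
      "\<And>x u v. x \<in> S \<Longrightarrow> T x u (frechet_derivative Q (at x) v) = 0"
    proof (rule iterated_primitive[OF cz])
      show "smooth_on S P" "\<And>x u v. x \<in> S \<Longrightarrow> T x u (frechet_derivative P (at x) v) = 0"
        using P unfolding good_def by auto
    qed blast
    have "norm (Q x) \<le> norm y0 * (1 / 2) ^ Suc n" if x: "x \<in> S" for x
    proof -
      have "norm (Q x - Q z) \<le> (K * (norm y0 * (1 / 2) ^ n)) * norm (x - z)"
      proof (rule differentiable_bound[OF cz(1) _ _ x cz(2)])
        show "(Q has_derivative (\<lambda>v. T y v (P y))) (at y within S)" if "y \<in> S" for y
          using Q(3)[OF that] has_derivative_at_withinI by blast
        show "onorm (\<lambda>v. T y v (P y)) \<le> K * (norm y0 * (1 / 2) ^ n)" if "y \<in> S" for y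
        proof (rule onorm_le)
          fix v
          have "norm (T y v (P y)) \<le> K * norm v * norm (P y)" by (rule bound[OF that])
          also have "\<dots> \<le> K * norm v * (norm y0 * (1 / 2) ^ n)"
            using P that K unfolding good_def by (intro mult_left_mono) auto
          finally show "norm (T y v (P y)) \<le> K * (norm y0 * (1 / 2) ^ n) * norm v" by (simp add: mult_ac)
        qed
      qed
      also have "\<dots> \<le> (K * (norm y0 * (1 / 2) ^ n)) * r"
        using x S_ball K by (intro mult_left_mono) (auto simp: dist_norm norm_minus_commute)
      also have "\<dots> = (norm y0 * (1 / 2) ^ n) * (K * r)" by simp
      also have "\<dots> \<le> (norm y0 * (1 / 2) ^ n) * (1 / 2)" using K by (intro mult_left_mono) auto
      finally show ?thesis using Q(1) by simp
    qed
    then show "\<exists>Q. good (Suc n) Q \<and> (Q z = 0 \<and> (\<forall>x\<in>S. (Q has_derivative (\<lambda>v. T x v (P x))) (at x)))"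
      using Q unfolding good_def by blast
  qed
  then obtain \<Phi> where \<Phi>: "\<And>n. good n (\<Phi> n)" "\<And>n. \<Phi> (Suc n) z = 0"
      "\<And>n x. x \<in> S \<Longrightarrow> (\<Phi> (Suc n) has_derivative (\<lambda>v. T x v (\<Phi> n x))) (at x)"
    by blast
  have \<Phi>0: "\<Phi> 0 = (\<lambda>x. y0)" and bd: "\<And>n x. x \<in> S \<Longrightarrow> norm (\<Phi> n x) \<le> norm y0 * (1 / 2) ^ n"
    using \<Phi>(1) unfolding good_def by auto
  define P where "P x = (\<Sum>n. \<Phi> n x)" for x
  have geo: "summable (\<lambda>n. norm y0 * (1 / 2 :: real) ^ n)" by (intro summable_mult summable_geometric) simp
  have summ: "summable (\<lambda>n. \<Phi> n x)" if "x \<in> S" for x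
    by (rule summable_comparison_test'[OF geo, of 0]) (use bd[OF that] in auto)
  have tail: "norm (P x - (\<Sum>i<m. \<Phi> i x)) \<le> 2 * norm y0 * (1 / 2) ^ m" if "x \<in> S" for x m
  proof -
    have "P x - (\<Sum>i<m. \<Phi> i x) = (\<Sum>i. \<Phi> (i + m) x)"
      using suminf_minus_initial_segment[OF summ[OF that]] by (simp add: P_def)
    also have "norm \<dots> \<le> (\<Sum>i. norm y0 * (1 / 2) ^ m * (1 / 2) ^ i)"
    proof (rule norm_suminf_le)
      show "norm (\<Phi> (i + m) x) \<le> norm y0 * (1 / 2) ^ m * (1 / 2) ^ i" for i
        using bd[OF that, of "i + m"] by (simp add: power_add mult_ac)
      show "summable (\<lambda>i. norm y0 * (1 / 2) ^ m * (1 / 2 :: real) ^ i)"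
        by (intro summable_mult summable_geometric) simp
    qed
    also have "\<dots> = norm y0 * (1 / 2) ^ m * 2"
      by (subst suminf_mult) (auto simp: suminf_geometric intro!: summable_geometric)
    finally show ?thesis by (simp add: mult_ac)
  qed
  have Pz: "P z = y0"
  proof -
    have "P z = (\<Sum>n\<in>{0}. \<Phi> n z)" unfolding P_def
      by (rule suminf_finite) (use \<Phi>(2) in \<open>auto simp: gr0_conv_Suc\<close>)
    then show ?thesis by (simp add: \<Phi>0)
  qed
  have Pd: "(P has_derivative (\<lambda>v. T x v (P x))) (at x)" if x: "x \<in> S" for x
  proof -
    \<comment> \<open>Iterate 0 is constant, so its derivative is 0 and the other derivatives are
      shifted by one: the first \<open>Suc m\<close> of them add up to \<open>T\<close> applied to
      the first \<open>m\<close> iterates. Hence the bound \<open>Suc N\<close> below.\<close>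
    define f' where "f' n x v = (case n of 0 \<Rightarrow> 0 | Suc m \<Rightarrow> T x v (\<Phi> m x))" for n x v
    have "\<exists>g. \<forall>x\<in>S. (\<lambda>n. \<Phi> n x) sums g x \<and> (g has_derivative (\<lambda>v. T x v (P x))) (at x within S)"
    proof (rule has_derivative_series[OF cz(1) _ _ cz(2), where f' = f'])
      show "(\<Phi> n has_derivative f' n x) (at x within S)" if "x \<in> S" for n x
        using \<Phi>(3)[OF that] by (cases n) (auto simp: f'_def[abs_def] \<Phi>0 intro: has_derivative_at_withinI)
      show "(\<lambda>n. \<Phi> n z) sums P z" unfolding P_def by (rule summable_sums[OF summ[OF cz(2)]])
      fix e :: real assume e: "e > 0"
      have "(\<lambda>m. K * (2 * norm y0 * (1 / 2) ^ m)) \<longlonglongrightarrow> K * (2 * norm y0 * 0)"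
        by (intro tendsto_intros LIMSEQ_power_zero) simp
      then have "eventually (\<lambda>m. K * (2 * norm y0 * (1 / 2) ^ m) < e) sequentially"
        using e by (intro order_tendstoD) auto
      then obtain N where N: "\<And>m. m \<ge> N \<Longrightarrow> K * (2 * norm y0 * (1 / 2) ^ m) < e"
        unfolding eventually_sequentially by blast
      have "norm ((\<Sum>i<n. f' i x v) - T x v (P x)) \<le> e * norm v" if n: "n \<ge> Suc N" and x: "x \<in> S" for n x v
      proof -
        obtain m where m: "n = Suc m" "m \<ge> N" using n by (cases n) auto
        interpret linear "T x v" by (rule lin_y[OF x])
        have "norm ((\<Sum>i<n. f' i x v) - T x v (P x)) = norm (T x v (P x - (\<Sum>i<m. \<Phi> i x)))"
          unfolding m sum.lessThan_Suc_shift by (simp add: f'_def diff sum norm_minus_commute)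
        also have "\<dots> \<le> K * norm v * norm (P x - (\<Sum>i<m. \<Phi> i x))" by (rule bound[OF x])
        also have "\<dots> \<le> K * norm v * (2 * norm y0 * (1 / 2) ^ m)"
          by (intro mult_left_mono tail x) (use K in auto)
        also have "\<dots> = (K * (2 * norm y0 * (1 / 2) ^ m)) * norm v" by simp
        also have "\<dots> \<le> e * norm v" using N[OF m(2)] by (intro mult_right_mono) auto
        finally show ?thesis .
      qed
      then show "\<forall>\<^sub>F n in sequentially. \<forall>x\<in>S. \<forall>v. norm ((\<Sum>i<n. f' i x v) - T x v (P x)) \<le> e * norm v"
        unfolding eventually_sequentially by blast
    qed
    then obtain g where g: "\<And>x. x \<in> S \<Longrightarrow> (\<lambda>n. \<Phi> n x) sums g x"
      "\<And>x. x \<in> S \<Longrightarrow> (g has_derivative (\<lambda>v. T x v (P x))) (at x within S)" by blast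
    have "g y = P y" if "y \<in> S" for y using g(1)[OF that] sums_unique P_def by metis
    then show ?thesis
      using has_derivative_transform_within_open[OF _ S x, of g _ _ P] g(2)[OF x] at_within_open[OF x S] by auto
  qed
  show ?thesis using that Pz solution_smooth[OF Pd] Pd by blast
qed

lemma ex_local_solution:
  assumes "z \<in> S"
  obtains r where "r > 0" "cball z r \<subseteq> S"
    "\<forall>y0. \<exists>P. P z = y0 \<and> smooth_on (ball z r) P \<and> (\<forall>x\<in>ball z r. (P has_derivative (\<lambda>v. T x v (P x))) (at x))"
proof -
  obtain r0 where r0: "r0 > 0" "cball z r0 \<subseteq> S" using S assms open_contains_cball by blast
  obtain K where K: "K \<ge> 0" "\<And>x v y. x \<in> cball z r0 \<Longrightarrow> norm (T x v y) \<le> K * norm v * norm y"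
    using bounded_on_compact[OF compact_cball r0(2)] by metis
  \<comment> \<open>Small enough for \<open>K * r\<close> to be at most 1/2; \<open>K + 1\<close>
    keeps the denominator positive when \<open>K\<close> is 0.\<close>
  define r where "r = min r0 (1 / (2 * (K + 1)))"
  have r: "r > 0" "r \<le> r0" using r0 K by (auto simp: r_def)
  have "K * r \<le> K * (1 / (2 * (K + 1)))" using K by (intro mult_left_mono) (auto simp: r_def)
  also have "\<dots> \<le> 1 / 2" using K by (simp add: field_simps)
  finally have Kr: "K * r \<le> 1 / 2" .
  have sub: "cball z r \<subseteq> cball z r0" "ball z r \<subseteq> cball z r0" using r by auto
  interpret B: linear_system "ball z r" T by (rule restrict) (use sub r0 in auto)
  interpret B: nilpotent_flat_system "ball z r" T
    by unfold_locales (use closed nil sub r0 in \<open>auto simp: subset_iff\<close>)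
  show ?thesis
  proof (rule that[OF r(1)])
    show "cball z r \<subseteq> S" using sub r0 by blast
    show "\<forall>y0. \<exists>P. P z = y0 \<and> smooth_on (ball z r) P \<and> (\<forall>x\<in>ball z r. (P has_derivative (\<lambda>v. T x v (P x))) (at x))"
    proof
    fix y0
    obtain P where "P z = y0" "smooth_on (ball z r) P" "\<And>x. x \<in> ball z r \<Longrightarrow> (P has_derivative (\<lambda>v. T x v (P x))) (at x)"
      by (rule B.local_solution[OF refl r(1) _ K(1) Kr, of y0]) (use K(2) sub in blast)+
    then show "\<exists>P. P z = y0 \<and> smooth_on (ball z r) P \<and> (\<forall>x\<in>ball z r. (P has_derivative (\<lambda>v. T x v (P x))) (at x))"
      by blast
    qed
  qed
qed

end

section \<open>Gluing local solutions on a simply connected space\<close>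

text \<open>A structure of local solutions behaves like the sheets of a covering of \<open>M\<close> with fibre \<open>X\<close>:
  through every point of \<open>M\<close> and every value in \<open>X\<close> there is exactly one germ.\<close>

locale local_solutions =
  fixes M :: "'m::topological_space set" and X :: "'x set" and L :: "('m set \<times> ('m \<Rightarrow> 'x)) set"
  assumes L_open: "(U, p) \<in> L \<Longrightarrow> open U"
    and L_subset: "(U, p) \<in> L \<Longrightarrow> U \<subseteq> M"
    and L_values: "(U, p) \<in> L \<Longrightarrow> q \<in> U \<Longrightarrow> p q \<in> X"
    and L_agree: "(U, p) \<in> L \<Longrightarrow> (V, r) \<in> L \<Longrightarrow> q \<in> U \<inter> V \<Longrightarrow> p q = r q \<Longrightarrow> \<forall>\<^sub>F q' in nhds q. p q' = r q'"
    and L_disagree: "(U, p) \<in> L \<Longrightarrow> (V, r) \<in> L \<Longrightarrow> q \<in> U \<inter> V \<Longrightarrow> p q \<noteq> r q \<Longrightarrow> \<forall>\<^sub>F q' in nhds q. p q' \<noteq> r q'"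
    and L_exists: "q \<in> M \<Longrightarrow> \<exists>U. path_connected U \<and> q \<in> U \<and>
        (\<forall>q'\<in>U. \<forall>x\<in>X. \<exists>p. (U, p) \<in> L \<and> p q' = x)"
begin

text \<open>The fibre \<open>X\<close> has no topology; agreement with a sheet near each point takes
  over the role of continuity of a lift. The value at \<open>s\<close> is demanded separately
  because \<open>at s\<close> leaves \<open>s\<close> out.\<close>

definition lifts :: "('s::topological_space \<Rightarrow> 'm) \<Rightarrow> 's set \<Rightarrow> ('s \<Rightarrow> 'x) \<Rightarrow> bool" where
  "lifts h S P \<longleftrightarrow> (\<forall>s\<in>S. \<exists>(U, p)\<in>L. h s \<in> U \<and> P s = p (h s) \<and> (\<forall>\<^sub>F s' in at s within S. P s' = p (h s')))"

lemma liftsE: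
  assumes "lifts h S P" "s \<in> S"
  obtains U p where "(U, p) \<in> L" "h s \<in> U" "P s = p (h s)" "\<forall>\<^sub>F s' in at s within S. P s' = p (h s')"
  using assms unfolding lifts_def by fast

lemma lifts_subset: "lifts h S P \<Longrightarrow> S' \<subseteq> S \<Longrightarrow> lifts h S' P"
  unfolding lifts_def by (rule ballI, drule bspec, blast) (auto elim!: filter_leD[OF at_le, rotated] intro!: bexI)

lemma lifts_cong:
  assumes "lifts h S P" "\<And>s. s \<in> S \<Longrightarrow> h s = h' s"
  shows "lifts h' S P"
  unfolding lifts_def
proof
  fix s assume s: "s \<in> S"
  obtain U p where p: "(U, p) \<in> L" "h s \<in> U" "P s = p (h s)" "\<forall>\<^sub>F s' in at s within S. P s' = p (h s')"
    using liftsE[OF assms(1) s] .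
  have "\<forall>\<^sub>F s' in at s within S. s' \<in> S" by (simp add: eventually_at_filter)
  with p(4) have "\<forall>\<^sub>F s' in at s within S. P s' = p (h' s')" by eventually_elim (simp add: assms(2))
  then show "\<exists>(U, p)\<in>L. h' s \<in> U \<and> P s = p (h' s) \<and> (\<forall>\<^sub>F s' in at s within S. P s' = p (h' s'))"
    using p s assms(2) by (intro bexI[of _ "(U, p)"]) auto
qed

lemma lifts_values: "lifts h S P \<Longrightarrow> s \<in> S \<Longrightarrow> P s \<in> X"
  by (erule liftsE, assumption) (auto dest: L_values)

lemma eventually_pullback:
  assumes "continuous_on S h" "s \<in> S" "\<forall>\<^sub>F q in nhds (h s). Q q"
  shows "\<forall>\<^sub>F s' in at s within S. Q (h s')"
  using assms(1,2) eventually_compose_filterlim[OF assms(3)] unfolding continuous_on_def by blast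

lemma lifts_sheet:
  assumes "(U, p) \<in> L" "continuous_on S h" "h ` S \<subseteq> U"
  shows "lifts h S (\<lambda>s. p (h s))"
  using assms unfolding lifts_def by fastforce

lemma lifts_compose:
  assumes "lifts h S P" "continuous_on S' k" "k ` S' \<subseteq> S"
  shows "lifts (h \<circ> k) S' (P \<circ> k)"
  unfolding lifts_def
proof
  fix s assume s: "s \<in> S'"
  then have ks: "k s \<in> S" using assms(3) by blast
  obtain U p where p: "(U, p) \<in> L" "h (k s) \<in> U" "P (k s) = p (h (k s))"
    "\<forall>\<^sub>F s' in at (k s) within S. P s' = p (h s')"
    using liftsE[OF assms(1) ks] .
  obtain N where N: "open N" "k s \<in> N" "\<And>y. y \<in> N \<Longrightarrow> y \<noteq> k s \<Longrightarrow> y \<in> S \<Longrightarrow> P y = p (h y)"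
    using p(4) unfolding eventually_at_topological by blast
  have "\<forall>\<^sub>F s' in at s within S'. k s' \<in> N"
    using assms(2) s N(1,2) unfolding continuous_on_def by (auto dest: topological_tendstoD)
  moreover have "\<forall>\<^sub>F s' in at s within S'. s' \<in> S'" by (simp add: eventually_at_filter)
  ultimately have "\<forall>\<^sub>F s' in at s within S'. (P \<circ> k) s' = p ((h \<circ> k) s')"
  proof eventually_elim
    case (elim s')
    then have "k s' \<in> S" using assms(3) by blast
    \<comment> \<open>\<open>k\<close> may return to \<open>k s\<close> at parameters other than
      \<open>s\<close>, where the punctured neighbourhood of \<open>k s\<close> says nothing; the
      value at the point itself covers this.\<close>
    then show ?case using N(3)[OF elim(1)] p(3) by (cases "k s' = k s") auto
  qed
  then show "\<exists>(U, p)\<in>L. (h \<circ> k) s \<in> U \<and> (P \<circ> k) s = p ((h \<circ> k) s) \<and>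
      (\<forall>\<^sub>F s' in at s within S'. (P \<circ> k) s' = p ((h \<circ> k) s'))"
    using p by (intro bexI[of _ "(U, p)"]) auto
qed

text \<open>By \<open>L_agree\<close> and \<open>L_disagree\<close> both equality and inequality of
  two lifts persist nearby, so the truth value of \<open>P s = P' s\<close> is locally constant on a
  connected set.\<close>

lemma lifts_unique:
  assumes "connected S" "continuous_on S h" "lifts h S P" "lifts h S P'" "s0 \<in> S" "P s0 = P' s0" "s \<in> S"
  shows "P s = P' s"
proof -
  have "(P s = P' s) = (P s0 = P' s0)"
  proof (rule connected_local_const[OF assms(1,7,5), of "\<lambda>s. P s = P' s"], rule ballI)
    fix a assume a: "a \<in> S"
    obtain U p where p: "(U, p) \<in> L" "h a \<in> U" "P a = p (h a)" "\<forall>\<^sub>F s' in at a within S. P s' = p (h s')"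
      using liftsE[OF assms(3) a] .
    obtain V r where r: "(V, r) \<in> L" "h a \<in> V" "P' a = r (h a)" "\<forall>\<^sub>F s' in at a within S. P' s' = r (h s')"
      using liftsE[OF assms(4) a] .
    have "\<forall>\<^sub>F q in nhds (h a). (p q = r q) = (p (h a) = r (h a))"
      using L_agree[OF p(1) r(1), of "h a"] L_disagree[OF p(1) r(1), of "h a"] p(2) r(2)
      by (cases "p (h a) = r (h a)") auto
    from eventually_pullback[OF assms(2) a this] p(4) r(4)
    show "\<forall>\<^sub>F b in at a within S. (P a = P' a) = (P b = P' b)"
      by eventually_elim (auto simp: p(3) r(3))
  qed
  then show ?thesis using assms(6) by simp
qed

text \<open>Agreement at the single point \<open>y\<close> spreads over the connected overlap by
  \<open>lifts_unique\<close>. Closedness of the pieces lets a point outside one of them ignore that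
  piece.\<close>

lemma lifts_union:
  assumes "closed S1" "closed S2" "connected (S1 \<inter> S2)" "continuous_on (S1 \<union> S2) h"
    and P1: "lifts h S1 P1" and P2: "lifts h S2 P2" and y: "y \<in> S1 \<inter> S2" "P1 y = P2 y"
  shows "lifts h (S1 \<union> S2) (\<lambda>s. if s \<in> S1 then P1 s else P2 s)" (is "lifts h _ ?P")
proof -
  have eq: "P1 s = P2 s" if "s \<in> S1 \<inter> S2" for s
    by (rule lifts_unique[OF assms(3) _ lifts_subset[OF P1] lifts_subset[OF P2] y that])
      (use assms(4) in \<open>auto intro: continuous_on_subset\<close>)
  have out: "\<forall>\<^sub>F s' in at s within T. Q s'" if "closed T" "s \<notin> T" for s T and Q :: "'a \<Rightarrow> bool"
    unfolding eventually_at_topological using that by (intro exI[of _ "- T"]) auto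
  show ?thesis unfolding lifts_def
  proof
    fix s assume s: "s \<in> S1 \<union> S2"
    have 1: "\<exists>U p. (U, p) \<in> L \<and> h s \<in> U \<and> P1 s = p (h s) \<and> (\<forall>\<^sub>F s' in at s within S1. P1 s' = p (h s'))"
      if "s \<in> S1" using liftsE[OF P1 that] by metis
    have 2: "\<exists>U p. (U, p) \<in> L \<and> h s \<in> U \<and> P2 s = p (h s) \<and> (\<forall>\<^sub>F s' in at s within S2. P2 s' = p (h s'))"
      if "s \<in> S2" using liftsE[OF P2 that] by metis
    have "\<exists>U p. (U, p) \<in> L \<and> h s \<in> U \<and> ?P s = p (h s) \<and>
        (\<forall>\<^sub>F s' in at s within S1. P1 s' = p (h s')) \<and> (\<forall>\<^sub>F s' in at s within S2. P2 s' = p (h s'))"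
    proof (cases "s \<in> S1"; cases "s \<in> S2")
      assume in12: "s \<in> S1" "s \<in> S2"
      obtain U p where p: "(U, p) \<in> L" "h s \<in> U" "P1 s = p (h s)" "\<forall>\<^sub>F s' in at s within S1. P1 s' = p (h s')"
        using 1[OF in12(1)] by blast
      obtain V r where r: "(V, r) \<in> L" "h s \<in> V" "P2 s = r (h s)" "\<forall>\<^sub>F s' in at s within S2. P2 s' = r (h s')"
        using 2[OF in12(2)] by blast
      have "\<forall>\<^sub>F q in nhds (h s). p q = r q"
        using L_agree[OF p(1) r(1), of "h s"] p(2,3) r(2,3) eq[of s] in12 by auto
      moreover have "continuous_on S2 h" using assms(4) by (auto intro: continuous_on_subset)
      ultimately have "\<forall>\<^sub>F s' in at s within S2. p (h s') = r (h s')"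
        using eventually_pullback[OF _ in12(2)] by blast
      with r(4) have "\<forall>\<^sub>F s' in at s within S2. P2 s' = p (h s')" by eventually_elim simp
      then show ?thesis using p in12 by auto
    next
      assume "s \<in> S1" "s \<notin> S2"
      then show ?thesis using 1 out[OF assms(2)] by simp
    next
      assume "s \<notin> S1" "s \<in> S2"
      then show ?thesis using 2 out[OF assms(1)] by simp
    qed (use s in auto)
    then obtain U p where p: "(U, p) \<in> L" "h s \<in> U" "?P s = p (h s)"
        "\<forall>\<^sub>F s' in at s within S1. P1 s' = p (h s')" "\<forall>\<^sub>F s' in at s within S2. P2 s' = p (h s')" by blast
    have in1: "\<forall>\<^sub>F s' in at s within T. s' \<in> T" for T by (simp add: eventually_at_filter)
    have "\<forall>\<^sub>F s' in at s within S1. ?P s' = p (h s')" using p(4) in1 by eventually_elim simp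
    moreover have "\<forall>\<^sub>F s' in at s within S2. ?P s' = p (h s')" using p(5) in1 by eventually_elim (use eq in auto)
    ultimately have "\<forall>\<^sub>F s' in at s within (S1 \<union> S2). ?P s' = p (h s')"
      by (simp add: at_within_union eventually_sup)
    then show "\<exists>(U, p)\<in>L. h s \<in> U \<and> ?P s = p (h s) \<and> (\<forall>\<^sub>F s' in at s within (S1 \<union> S2). ?P s' = p (h s'))"
      using p by (intro bexI[of _ "(U, p)"]) auto
  qed
qed

section \<open>Lifting over intervals and squares\<close>

text \<open>Every base point and every starting value are allowed, so that a lift over one piece can
  be continued into an adjacent one from whatever value it has reached.\<close>

definition liftable :: "('s::topological_space \<Rightarrow> 'm) \<Rightarrow> 's set \<Rightarrow> bool" where
  "liftable h S \<longleftrightarrow> (\<forall>s\<in>S. \<forall>x\<in>X. \<exists>P. lifts h S P \<and> P s = x)"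

lemma liftable_union:
  assumes "closed S1" "closed S2" "connected (S1 \<inter> S2)" "S1 \<inter> S2 \<noteq> {}" "continuous_on (S1 \<union> S2) h"
    and "liftable h S1" "liftable h S2"
  shows "liftable h (S1 \<union> S2)"
proof -
  have *: "\<exists>P. lifts h (T1 \<union> T2) P \<and> P s = x"
    if T: "closed T1" "closed T2" "connected (T1 \<inter> T2)" "T1 \<inter> T2 \<noteq> {}" "continuous_on (T1 \<union> T2) h"
      "liftable h T1" "liftable h T2" and s: "s \<in> T1" "x \<in> X" for T1 T2 s x
  proof -
    obtain P1 where P1: "lifts h T1 P1" "P1 s = x" using T(6) s unfolding liftable_def by blast
    obtain y where y: "y \<in> T1 \<inter> T2" using T(4) by blast
    obtain P2 where P2: "lifts h T2 P2" "P2 y = P1 y"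
      using T(7) y lifts_values[OF P1(1)] unfolding liftable_def by blast
    show ?thesis
      using lifts_union[OF T(1,2,3,5) P1(1) P2(1) y] P1(2) P2(2) s
      by (intro exI[of _ "\<lambda>s. if s \<in> T1 then P1 s else P2 s"]) auto
  qed
  show ?thesis unfolding liftable_def
  proof (intro ballI)
    fix s x assume "s \<in> S1 \<union> S2" and x: "x \<in> X"
    then consider "s \<in> S1" | "s \<in> S2" by blast
    then show "\<exists>P. lifts h (S1 \<union> S2) P \<and> P s = x"
    proof cases
      case 1
      show ?thesis by (rule *[OF assms 1 x])
    next
      case 2
      show ?thesis
        using *[of S2 S1, OF assms(2,1) _ _ _ assms(7,6) 2 x] assms(3,4,5) by (simp add: Int_commute Un_commute)
    qed
  qed
qed

lemma liftable_small:
  assumes "continuous_on K h" "h ` K \<subseteq> M" "k \<in> K"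
  obtains N where "open N" "k \<in> N" "\<And>S. S \<subseteq> N \<inter> K \<Longrightarrow> liftable h S"
proof -
  have "h k \<in> M" using assms by blast
  then obtain U where U: "h k \<in> U" "\<forall>q'\<in>U. \<forall>x\<in>X. \<exists>p. (U, p) \<in> L \<and> p q' = x"
    using L_exists[OF \<open>h k \<in> M\<close>] by blast
  show ?thesis
  \<comment> \<open>That \<open>U\<close> is open is known only through a sheet over it, and without
    values there is no sheet.\<close>
  proof (cases "X = {}")
    case True
    then have "liftable h S" for S unfolding liftable_def by blast
    then show ?thesis using that[of UNIV] by simp
  next
    case False
    then have "open U" using U L_open by blast
    then obtain N where N: "open N" "N \<inter> K = h -` U \<inter> K"
      using assms(1) unfolding continuous_on_open_invariant by (metis)
    show ?thesis
    proof (rule that[of N])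
      show "k \<in> N" using N U(1) assms(3) by blast
      fix S assume S: "S \<subseteq> N \<inter> K"
      then have hS: "h ` S \<subseteq> U" using N by blast
      have c: "continuous_on S h" using S assms(1) by (auto intro: continuous_on_subset)
      show "liftable h S" unfolding liftable_def
      proof (intro ballI)
        fix s x assume "s \<in> S" "x \<in> X"
        then obtain p where "(U, p) \<in> L" "p (h s) = x" using U(2) hS by blast
        then show "\<exists>P. lifts h S P \<and> P s = x" using lifts_sheet[OF _ c hS] by blast
      qed
    qed (use N in auto)
  qed
qed

text \<open>\<open>Bolzano\<close> packages compactness: a property of subintervals that survives
  concatenation and holds for all short intervals around each point holds for the whole
  interval.\<close>

lemma liftable_interval:
  fixes h :: "real \<Rightarrow> 'm"
  assumes h: "continuous_on {0..1} h" "h ` {0..1} \<subseteq> M"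
  shows "liftable h {0..1}"
proof -
  have "0 \<le> (0::real) \<and> (1::real) \<le> 1 \<longrightarrow> liftable h {0..1::real}"
  proof (rule Bolzano[of 0 1 "\<lambda>a b. 0 \<le> a \<and> b \<le> 1 \<longrightarrow> liftable h {a..b}"])
    fix a b c :: real
    assume "0 \<le> a \<and> b \<le> 1 \<longrightarrow> liftable h {a..b}" "0 \<le> b \<and> c \<le> 1 \<longrightarrow> liftable h {b..c}" and le: "a \<le> b" "b \<le> c"
    moreover have "{a..c} = {a..b} \<union> {b..c}" "{a..b} \<inter> {b..c} = {b}" using le by auto
    ultimately show "0 \<le> a \<and> c \<le> 1 \<longrightarrow> liftable h {a..c}"
      by (auto intro!: liftable_union continuous_on_subset[OF h(1)])
  next
    fix x :: real assume x: "0 \<le> x" "x \<le> 1"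
    then obtain N where N: "open N" "x \<in> N" "\<And>S. S \<subseteq> N \<inter> {0..1} \<Longrightarrow> liftable h S"
      using liftable_small[OF h, of x] by auto
    obtain d where d: "d > 0" "\<And>y. dist y x < d \<Longrightarrow> y \<in> N" using N(1,2) unfolding open_dist by blast
    then show "\<exists>d>0. \<forall>a b. a \<le> x \<and> x \<le> b \<and> b - a < d \<longrightarrow> 0 \<le> a \<and> b \<le> 1 \<longrightarrow> liftable h {a..b}"
      by (intro exI[of _ d]) (auto intro!: N(3) d(2) simp: dist_real_def)
  qed simp
  then show ?thesis by simp
qed

text \<open>\<open>Bolzano\<close> in each coordinate. In the vertical subdivision the width
  \<open>d\<close> is quantified inside the property, so it may shrink whenever two rectangles are
  stacked. This yields a strip of full height around each \<open>x\<close>, and the strips are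
  joined along vertical segments.\<close>

lemma liftable_square:
  fixes h :: "real \<times> real \<Rightarrow> 'm"
  assumes h: "continuous_on ({0..1} \<times> {0..1}) h" "h ` ({0..1} \<times> {0..1}) \<subseteq> M"
  shows "liftable h ({0..1} \<times> {0..1})"
proof -
  have strip: "\<exists>d>0. \<forall>a b. a \<le> x \<and> x \<le> b \<and> b - a < d \<longrightarrow> 0 \<le> a \<and> b \<le> 1 \<longrightarrow> liftable h ({a..b} \<times> {0..1})"
    if x: "0 \<le> x" "x \<le> 1" for x
  proof -
    have "0 \<le> (0::real) \<and> (1::real) \<le> 1 \<longrightarrow>
      (\<exists>d>0. \<forall>a b. a \<le> x \<and> x \<le> b \<and> b - a < d \<longrightarrow> 0 \<le> a \<and> b \<le> 1 \<longrightarrow> liftable h ({a..b} \<times> {0..1}))"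
    proof (rule Bolzano[of 0 1 "\<lambda>s t. 0 \<le> s \<and> t \<le> 1 \<longrightarrow>
        (\<exists>d>0. \<forall>a b. a \<le> x \<and> x \<le> b \<and> b - a < d \<longrightarrow> 0 \<le> a \<and> b \<le> 1 \<longrightarrow> liftable h ({a..b} \<times> {s..t}))"])
      fix r s t :: real
      assume 1: "0 \<le> r \<and> s \<le> 1 \<longrightarrow> (\<exists>d>0. \<forall>a b. a \<le> x \<and> x \<le> b \<and> b - a < d \<longrightarrow> 0 \<le> a \<and> b \<le> 1 \<longrightarrow> liftable h ({a..b} \<times> {r..s}))"
        and 2: "0 \<le> s \<and> t \<le> 1 \<longrightarrow> (\<exists>d>0. \<forall>a b. a \<le> x \<and> x \<le> b \<and> b - a < d \<longrightarrow> 0 \<le> a \<and> b \<le> 1 \<longrightarrow> liftable h ({a..b} \<times> {s..t}))"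
        and le: "r \<le> s" "s \<le> t"
      show "0 \<le> r \<and> t \<le> 1 \<longrightarrow> (\<exists>d>0. \<forall>a b. a \<le> x \<and> x \<le> b \<and> b - a < d \<longrightarrow> 0 \<le> a \<and> b \<le> 1 \<longrightarrow> liftable h ({a..b} \<times> {r..t}))"
      proof
        assume rt: "0 \<le> r \<and> t \<le> 1"
        obtain d1 where d1: "d1 > 0" "\<And>a b. a \<le> x \<Longrightarrow> x \<le> b \<Longrightarrow> b - a < d1 \<Longrightarrow> 0 \<le> a \<Longrightarrow> b \<le> 1 \<Longrightarrow> liftable h ({a..b} \<times> {r..s})"
          using 1 rt le by auto
        obtain d2 where d2: "d2 > 0" "\<And>a b. a \<le> x \<Longrightarrow> x \<le> b \<Longrightarrow> b - a < d2 \<Longrightarrow> 0 \<le> a \<Longrightarrow> b \<le> 1 \<Longrightarrow> liftable h ({a..b} \<times> {s..t})"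
          using 2 rt le by auto
        have "liftable h ({a..b} \<times> {r..t})"
          if ab: "a \<le> x" "x \<le> b" "b - a < min d1 d2" "0 \<le> a" "b \<le> 1" for a b
        proof -
          have u: "{a..b} \<times> {r..t} = {a..b} \<times> {r..s} \<union> {a..b} \<times> {s..t}" using le by auto
          have i: "({a..b} \<times> {r..s}) \<inter> ({a..b} \<times> {s..t}) = {a..b} \<times> {s}" using le by auto
          show ?thesis unfolding u
            by (rule liftable_union, unfold i)
              (use ab d1 d2 rt le in \<open>auto intro!: closed_Times connected_Times continuous_on_subset[OF h(1)]\<close>)
        qed
        then show "\<exists>d>0. \<forall>a b. a \<le> x \<and> x \<le> b \<and> b - a < d \<longrightarrow> 0 \<le> a \<and> b \<le> 1 \<longrightarrow> liftable h ({a..b} \<times> {r..t})"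
          using d1(1) d2(1) by (intro exI[of _ "min d1 d2"]) auto
      qed
    next
      fix y :: real assume y: "0 \<le> y" "y \<le> 1"
      then obtain N where N: "open N" "(x, y) \<in> N" "\<And>S. S \<subseteq> N \<inter> ({0..1} \<times> {0..1}) \<Longrightarrow> liftable h S"
        using liftable_small[OF h, of "(x, y)"] x by auto
      obtain A B where AB: "open A" "open B" "(x, y) \<in> A \<times> B" "A \<times> B \<subseteq> N"
        using N(1,2) by (rule open_prod_elim)
      obtain d where d: "d > 0" "\<And>z. dist z x < d \<Longrightarrow> z \<in> A" using AB(1,3) unfolding open_dist by blast
      obtain e where e: "e > 0" "\<And>z. dist z y < e \<Longrightarrow> z \<in> B" using AB(2,3) unfolding open_dist by blast
      have "liftable h ({a..b} \<times> {s..t})"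
        if "s \<le> y" "y \<le> t" "t - s < e" "0 \<le> s" "t \<le> 1" "a \<le> x" "x \<le> b" "b - a < d" "0 \<le> a" "b \<le> 1" for a b s t
      proof (rule N(3), rule subsetI)
        fix z assume "z \<in> {a..b} \<times> {s..t}"
        then obtain z1 z2 where z: "z = (z1, z2)" "a \<le> z1" "z1 \<le> b" "s \<le> z2" "z2 \<le> t" by auto
        have "z1 \<in> A" "z2 \<in> B" using that z by (auto intro!: d(2) e(2) simp: dist_real_def)
        then show "z \<in> N \<inter> ({0..1} \<times> {0..1})" using AB(4) that z by auto
      qed
      then show "\<exists>e>0. \<forall>s t. s \<le> y \<and> y \<le> t \<and> t - s < e \<longrightarrow> 0 \<le> s \<and> t \<le> 1 \<longrightarrow>
        (\<exists>d>0. \<forall>a b. a \<le> x \<and> x \<le> b \<and> b - a < d \<longrightarrow> 0 \<le> a \<and> b \<le> 1 \<longrightarrow> liftable h ({a..b} \<times> {s..t}))"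
        using d(1) e(1) by (intro exI[of _ e] conjI allI impI exI[of _ d]) auto
    qed simp
    then show ?thesis by simp
  qed
  have "0 \<le> (0::real) \<and> (1::real) \<le> 1 \<longrightarrow> liftable h ({0..1} \<times> {0..1})"
  proof (rule Bolzano[of 0 1 "\<lambda>a b. 0 \<le> a \<and> b \<le> 1 \<longrightarrow> liftable h ({a..b} \<times> {0..1})"])
    fix a b c :: real
    assume 1: "0 \<le> a \<and> b \<le> 1 \<longrightarrow> liftable h ({a..b} \<times> {0..1})" "0 \<le> b \<and> c \<le> 1 \<longrightarrow> liftable h ({b..c} \<times> {0..1})"
      and le: "a \<le> b" "b \<le> c"
    show "0 \<le> a \<and> c \<le> 1 \<longrightarrow> liftable h ({a..c} \<times> {0..1})"
    proof
      assume ac: "0 \<le> a \<and> c \<le> 1"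
      have u: "{a..c} \<times> {0..1::real} = {a..b} \<times> {0..1} \<union> {b..c} \<times> {0..1}" using le by auto
      have i: "({a..b} \<times> {0..1::real}) \<inter> ({b..c} \<times> {0..1}) = {b} \<times> {0..1}" using le by auto
      show "liftable h ({a..c} \<times> {0..1})" unfolding u
        by (rule liftable_union, unfold i)
          (use 1 ac le in \<open>auto intro!: closed_Times connected_Times continuous_on_subset[OF h(1)]\<close>)
    qed
  qed (use strip in auto)
  then show ?thesis by simp
qed

section \<open>Monodromy and continuation along paths\<close>

text \<open>Lift a homotopy from \<open>g\<close> to a constant loop over the square. The edge at 0
  lifts \<open>g\<close>, and the edge at 1 has a constant lift. The two remaining edges lie over
  the same path, because the homotopy runs through loops; their lifts agree at parameter 1, hence at
  parameter 0, which compares the ends of the lift of \<open>g\<close>.\<close>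

lemma closed_lift_of_loop:
  assumes "simply_connected M" "path g" "path_image g \<subseteq> M" "pathfinish g = pathstart g" "lifts g {0..1} P"
  shows "P 1 = P 0"
proof -
  let ?c = "\<lambda>t::real. pathstart g"
  have "pathstart g \<in> M" using assms(2,3) pathstart_in_path_image by blast
  then have "homotopic_loops M g ?c"
    using assms(1-4) unfolding simply_connected_def
    by (simp add: pathstart_def pathfinish_def path_def path_image_def image_subset_iff)
  then obtain h where h: "continuous_on ({0..1::real} \<times> {0..1::real}) h" "h ` ({0..1} \<times> {0..1}) \<subseteq> M"
      "\<And>x. x \<in> {0..1} \<Longrightarrow> h (0, x) = g x" "\<And>x. x \<in> {0..1} \<Longrightarrow> h (1, x) = pathstart g"
      "\<And>t. t \<in> {0..1} \<Longrightarrow> h (t, 1) = h (t, 0)"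
    unfolding homotopic_loops by (auto simp: pathstart_def pathfinish_def image_subset_iff Pi_iff)
  have "P 0 \<in> X" using lifts_values[OF assms(5), of 0] by simp
  then obtain H where H: "lifts h ({0..1} \<times> {0..1}) H" "H (0, 0) = P 0"
    using liftable_square[OF h(1,2)] unfolding liftable_def by force
  have edge: "lifts (h \<circ> k) {0..1::real} (H \<circ> k)" "continuous_on {0..1} (h \<circ> k)"
    if "continuous_on {0..1::real} k" "k ` {0..1} \<subseteq> {0..1} \<times> {0..1}" for k
    using lifts_compose[OF H(1) that] continuous_on_compose[OF that(1) continuous_on_subset[OF h(1) that(2)]] by auto
  have "(H \<circ> (\<lambda>x. (0, x))) 1 = P 1"
  proof (rule lifts_unique[of "{0..1}" g _ P 0])
    show "lifts g {0..1} (H \<circ> (\<lambda>x. (0, x)))"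
      by (rule lifts_cong[OF edge(1)]) (auto intro!: continuous_intros simp: h(3))
  qed (use assms H in \<open>auto simp: path_def\<close>)
  moreover have const: "(H \<circ> (\<lambda>x. (1, x))) 1 = H (1, 0)"
  proof (rule lifts_unique[of "{0..1}" ?c "H \<circ> (\<lambda>x. (1, x))" "\<lambda>x. H (1, 0)" 0 1])
    show l: "lifts ?c {0..1} (H \<circ> (\<lambda>x. (1, x)))"
      by (rule lifts_cong[OF edge(1)]) (auto intro!: continuous_intros simp: h(4))
    have "(0::real) \<in> {0..1}" by simp
    then obtain U p where "(U, p) \<in> L" "pathstart g \<in> U" "(H \<circ> (\<lambda>x. (1, x))) 0 = p (pathstart g)"
      by (rule liftsE[OF l])
    then show "lifts ?c {0..1} (\<lambda>x. H (1, 0))"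
      unfolding lifts_def by (intro ballI bexI[of _ "(U, p)"]) auto
  qed auto
  moreover have "(H \<circ> (\<lambda>t. (t, 1))) 0 = (H \<circ> (\<lambda>t. (t, 0))) 0"
  proof (rule lifts_unique[of "{0..1}" "h \<circ> (\<lambda>t. (t, 0))" "H \<circ> (\<lambda>t. (t, 1))" "H \<circ> (\<lambda>t. (t, 0))" 1 0])
    show "lifts (h \<circ> (\<lambda>t. (t, 0))) {0..1} (H \<circ> (\<lambda>t. (t, 1)))"
      by (rule lifts_cong[OF edge(1)]) (auto intro!: continuous_intros simp: h(5))
    show "lifts (h \<circ> (\<lambda>t. (t, 0))) {0..1} (H \<circ> (\<lambda>t. (t, 0)))"
      by (rule edge(1)) (auto intro!: continuous_intros)
    show "continuous_on {0..1} (h \<circ> (\<lambda>t. (t, 0)))"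
      by (rule edge(2)) (auto intro!: continuous_intros)
    show "(H \<circ> (\<lambda>t. (t, 1))) 1 = (H \<circ> (\<lambda>t. (t, 0))) 1"
      using const by simp
  qed auto
  ultimately show ?thesis using H(2) by simp
qed

lemma path_lift:
  assumes "path g" "path_image g \<subseteq> M" "x \<in> X"
  obtains Q where "lifts g {0..1} Q" "Q 0 = x"
  using liftable_interval[of g] assms unfolding liftable_def path_def path_image_def by force

text \<open>Run along \<open>g1\<close> and back along \<open>g2\<close>: the lift of this loop
  closes up, its first half is \<open>Q1\<close> and its second half, reversed, is
  \<open>Q2\<close>.\<close>

lemma path_lift_end_unique:
  assumes "simply_connected M"
    and 1: "path g1" "path_image g1 \<subseteq> M" "lifts g1 {0..1} Q1"
    and 2: "path g2" "path_image g2 \<subseteq> M" "lifts g2 {0..1} Q2"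
    and eq: "pathstart g1 = pathstart g2" "pathfinish g1 = pathfinish g2" "Q1 0 = Q2 0"
  shows "Q1 1 = Q2 1"
proof -
  let ?l = "g1 +++ reversepath g2"
  have l: "path ?l" "path_image ?l \<subseteq> M" "pathfinish ?l = pathstart ?l"
    using 1 2 eq by (auto simp: path_image_join)
  have "Q1 0 \<in> X" using lifts_values[OF 1(3), of 0] by simp
  then obtain H where H: "lifts ?l {0..1} H" "H 0 = Q1 0" using path_lift[OF l(1,2)] by blast
  have H1: "H 1 = H 0" by (rule closed_lift_of_loop[OF assms(1) l H(1)])
  have "(H \<circ> (\<lambda>t. t / 2)) 1 = Q1 1"
  proof (rule lifts_unique[of "{0..1}" g1 "H \<circ> (\<lambda>t. t / 2)" Q1 0 1])
    show "lifts g1 {0..1} (H \<circ> (\<lambda>t. t / 2))"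
      by (rule lifts_cong[OF lifts_compose[OF H(1)]]) (auto intro!: continuous_intros simp: joinpaths_def)
  qed (use 1 H in \<open>auto simp: path_def\<close>)
  moreover have "(H \<circ> (\<lambda>t. 1 - t / 2)) 1 = Q2 1"
  proof (rule lifts_unique[of "{0..1}" g2 "H \<circ> (\<lambda>t. 1 - t / 2)" Q2 0 1])
    show "lifts g2 {0..1} (H \<circ> (\<lambda>t. 1 - t / 2))"
    proof (rule lifts_cong[OF lifts_compose[OF H(1)]])
      fix t :: real assume "t \<in> {0..1}"
      then show "(?l \<circ> (\<lambda>t. 1 - t / 2)) t = g2 t"
        \<comment> \<open>At \<open>t = 1\<close> the parameter is 1/2, where
          \<open>joinpaths\<close> still evaluates \<open>g1\<close>; the common endpoint of the
          paths makes the values agree.\<close>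
        using eq(2) by (cases "t = 1") (auto simp: joinpaths_def reversepath_def pathfinish_def)
    qed (auto intro!: continuous_intros)
  qed (use 2 H H1 eq in \<open>auto simp: path_def\<close>)
  ultimately show ?thesis by simp
qed

lemma path_lift_extend:
  assumes g: "path g" "lifts g {0..1} Q" and k: "path k" "path_image k \<subseteq> U" "pathfinish g = pathstart k"
    and p: "(U, p) \<in> L" "p (pathfinish g) = Q 1"
  obtains Q' where "lifts (g +++ k) {0..1} Q'" "Q' 0 = Q 0" "Q' 1 = p (pathfinish k)"
proof -
  let ?l = "g +++ k"
  have cont: "continuous_on ({0..1 / 2} \<union> {1 / 2..1}) ?l"
    using path_join_imp[OF g(1) k(1,3)] by (auto simp: path_def elim: continuous_on_subset)
  have u: "{0..1 / 2} \<union> {1 / 2..1} = {0..1::real}" and i: "{0..1 / 2} \<inter> {1 / 2..1} = {1 / 2 :: real}" by auto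
  have 1: "lifts ?l {0..1 / 2} (Q \<circ> (\<lambda>t. 2 * t))"
    by (rule lifts_cong[OF lifts_compose[OF g(2)]]) (auto intro!: continuous_intros simp: joinpaths_def)
  have "?l t \<in> U" if "t \<in> {1 / 2..1}" for t
  proof (cases "t = 1 / 2")
    case True
    have "?l t = k 0" unfolding True using k(3) by (simp add: joinpaths_def pathfinish_def pathstart_def)
    then show ?thesis using k(2) by (auto simp: path_image_def)
  qed (use that k(2) in \<open>auto simp: joinpaths_def path_image_def\<close>)
  then have 2: "lifts ?l {1 / 2..1} (\<lambda>s. p (?l s))"
    by (intro lifts_sheet[OF p(1)]) (auto intro: continuous_on_subset[OF cont])
  have "lifts ?l ({0..1 / 2} \<union> {1 / 2..1}) (\<lambda>s. if s \<in> {0..1 / 2} then (Q \<circ> (\<lambda>t. 2 * t)) s else p (?l s))"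
    by (rule lifts_union[OF _ _ _ cont 1 2, of "1 / 2"]) (use p(2) in \<open>auto simp: i joinpaths_def pathfinish_def\<close>)
  then show ?thesis unfolding u by (rule that) (auto simp: joinpaths_def pathfinish_def)
qed

text \<open>\<open>P q\<close> is the end value of the lift along any path from \<open>q0\<close> to
  \<open>q\<close>. Around \<open>q\<close> it follows a single sheet, since a path to
  \<open>q\<close> can be prolonged inside the path-connected \<open>U\<close> along that
  sheet.\<close>

theorem global_solution:
  assumes M: "simply_connected M" and q0: "q0 \<in> M" and x0: "x0 \<in> X"
  obtains P where "P q0 = x0" "\<forall>q\<in>M. \<exists>(U, p)\<in>L. q \<in> U \<and> (\<forall>\<^sub>F q' in nhds q. P q' = p q')"
proof -
  define R where "R q x \<longleftrightarrow> (\<exists>g Q. path g \<and> path_image g \<subseteq> M \<and> pathstart g = q0 \<and> pathfinish g = q \<and>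
      lifts g {0..1} Q \<and> Q 0 = x0 \<and> Q 1 = x)" for q x
  \<comment> \<open>\<open>simply_connected\<close> makes any two loops freely homotopic. For the
    constant loops at \<open>q0\<close> and \<open>q\<close>, the track of one parameter under the
    homotopy is a path between the points.\<close>
  have ex_path: "\<exists>g. path g \<and> path_image g \<subseteq> M \<and> pathstart g = q0 \<and> pathfinish g = q" if "q \<in> M" for q
  proof -
    have "homotopic_loops M (\<lambda>t. q0) (\<lambda>t. q)"
      using M[unfolded simply_connected_def, rule_format, of "\<lambda>t. q0" "\<lambda>t. q"] q0 that
      by (simp add: path_def path_image_def pathstart_def pathfinish_def)
    then obtain h where h: "continuous_on ({0..1::real} \<times> {0..1::real}) h" "h ` ({0..1} \<times> {0..1}) \<subseteq> M"
      "\<And>x. x \<in> {0..1} \<Longrightarrow> h (0, x) = q0" "\<And>x. x \<in> {0..1} \<Longrightarrow> h (1, x) = q"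
      unfolding homotopic_loops by (auto simp: image_subset_iff Pi_iff)
    have "path (\<lambda>t. h (t, 0))"
      unfolding path_def by (rule continuous_on_compose2[OF h(1)]) (auto intro!: continuous_intros)
    then show ?thesis using h
      by (intro exI[of _ "\<lambda>t. h (t, 0)"]) (auto simp: path_image_def pathstart_def pathfinish_def)
  qed
  have R_ex: "\<exists>x. R q x" if "q \<in> M" for q
    using ex_path[OF that] path_lift[OF _ _ x0] unfolding R_def by metis
  have R_unique: "x = y" if "R q x" "R q y" for q x y
    using that path_lift_end_unique[OF M] unfolding R_def by metis
  define P where "P q = (THE x. R q x)" for q
  have RP: "R q (P q)" if "q \<in> M" for q
    unfolding P_def using R_ex[OF that] R_unique by (metis the_equality)
  have P_eq: "P q = x" if "R q x" for q x
    unfolding P_def using that R_unique by blast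
  show ?thesis
  proof (rule that[of P, OF _ ballI])
    have c: "path (\<lambda>t::real. q0)" "path_image (\<lambda>t::real. q0) \<subseteq> M" using q0 by (auto simp: path_def path_image_def)
    obtain Q where Q: "lifts (\<lambda>t::real. q0) {0..1} Q" "Q 0 = x0" by (rule path_lift[OF c x0])
    have "(0::real) \<in> {0..1}" by simp
    with Q(1) obtain U p where p: "(U, p) \<in> L" "q0 \<in> U" "Q 0 = p q0" by (rule liftsE)
    have "Q 1 = x0"
      using lifts_unique[OF _ _ Q(1) lifts_sheet[OF p(1)], of 0 1] p(2,3) Q(2) by (simp add: image_subset_iff)
    then have "R q0 x0"
      unfolding R_def using Q q0
      by (intro exI[of _ "\<lambda>t. q0"] exI[of _ Q]) (auto simp: path_def path_image_def pathstart_def pathfinish_def)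
    then show "P q0 = x0" by (rule P_eq)
    fix q assume q: "q \<in> M"
    obtain U where U: "path_connected U" "q \<in> U" "\<forall>q'\<in>U. \<forall>x\<in>X. \<exists>p. (U, p) \<in> L \<and> p q' = x"
      using L_exists[OF q] by blast
    obtain g Q where g: "path g" "path_image g \<subseteq> M" "pathstart g = q0" "pathfinish g = q"
      "lifts g {0..1} Q" "Q 0 = x0" "Q 1 = P q"
      using RP[OF q] unfolding R_def by blast
    have "P q \<in> X" using lifts_values[OF g(5), of 1] g(7) by simp
    then obtain p where p: "(U, p) \<in> L" "p q = P q" using U by blast
    have "P q' = p q'" if q': "q' \<in> U" for q'
    proof (rule P_eq)
      obtain k where k: "path k" "path_image k \<subseteq> U" "pathstart k = q" "pathfinish k = q'"
        using U(1,2) q' unfolding path_connected_def by blast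
      obtain Q' where Q': "lifts (g +++ k) {0..1} Q'" "Q' 0 = Q 0" "Q' 1 = p (pathfinish k)"
        by (rule path_lift_extend[OF g(1,5) k(1,2) _ p(1)]) (use g k p in auto)
      have "path (g +++ k)" "path_image (g +++ k) \<subseteq> M"
        using g k L_subset[OF p(1)] by (auto simp: path_image_join)
      then show "R q' (p q')" unfolding R_def using Q' g k
        by (intro exI[of _ "g +++ k"] exI[of _ Q']) auto
    qed
    then have "\<forall>\<^sub>F q' in nhds q. P q' = p q'"
      using L_open[OF p(1)] U(2) unfolding eventually_nhds by blast
    then show "\<exists>(U, p)\<in>L. q \<in> U \<and> (\<forall>\<^sub>F q' in nhds q. P q' = p q')"
      using p(1) U(2) by (intro bexI[of _ "(U, p)"]) auto
  qed
qed

end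

section \<open>Symplectic linear algebra\<close>

interpretation mmult: bounded_bilinear "(**) :: real^'n^'m \<Rightarrow> real^'p^'n \<Rightarrow> real^'p^'m"
  by (rule bounded_bilinear_matrix_mult)

interpretation mvec: bounded_bilinear "(*v) :: real^'n^'m \<Rightarrow> real^'n \<Rightarrow> real^'m"
  by (rule bounded_bilinear_matrix_vector_mult)

lemma vector_4:
  "(vector [w, x, y, z] :: 'a::zero^4) $ 1 = w" "(vector [w, x, y, z] :: 'a::zero^4) $ 2 = x"
  "(vector [w, x, y, z] :: 'a::zero^4) $ 3 = y" "(vector [w, x, y, z] :: 'a::zero^4) $ 4 = z"
  unfolding vector_def by simp_all

lemma matrix_vector_mult_4: "((A :: real^4^4) *v x) $ i = A $ i $ 1 * x $ 1 + A $ i $ 2 * x $ 2 + A $ i $ 3 * x $ 3 + A $ i $ 4 * x $ 4"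
  by (simp add: matrix_vector_mult_def sum_4)

lemma J4_mult: "J4 *v x = vector [x $ 3, x $ 4, - x $ 1, - x $ 2]"
  by (simp add: vec_eq_iff forall_4 matrix_vector_mult_4 J4_def vector_4)

lemma Omega_eq: "Omega X Y = X $ 1 * Y $ 3 + X $ 2 * Y $ 4 - X $ 3 * Y $ 1 - X $ 4 * Y $ 2"
  by (simp add: Omega_def J4_mult inner_vec_def sum_4 vector_4)

lemma bounded_bilinear_Omega: "bounded_bilinear Omega"
  unfolding Omega_def
  by (rule bounded_bilinear.comp[OF bounded_bilinear_inner bounded_linear_ident])
    (rule mvec.bounded_linear_right)

interpretation Omega: bounded_bilinear Omega
  by (rule bounded_bilinear_Omega)

lemmas smooth_on_Omega [smooth_intros] = smooth_on_bilinear[OF bounded_bilinear_Omega]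

lemma Omega_commute: "Omega X Y = - Omega Y X"
  by (simp add: Omega_eq)

lemma Omega_self [simp]: "Omega X X = 0"
  by (simp add: Omega_eq)

lemma J4_J4: "J4 ** J4 = - mat 1"
  by (simp add: vec_eq_iff forall_4 matrix_matrix_mult_def sum_4 J4_def vector_4 mat_def)

text \<open>The inverse of a symplectic matrix. The formula is linear in the entries, so smoothness
  is immediate.\<close>

definition symp_inv :: "real^4^4 \<Rightarrow> real^4^4" where
  "symp_inv X = - (J4 ** transpose X ** J4)"

lemma matrix_mult_minus_left: "(- A) ** B = - (A ** B)" for A :: "real^'n^'m"
  by (simp add: vec_eq_iff matrix_matrix_mult_def sum_negf)

lemma Sp4_iff: "X \<in> Sp4 \<longleftrightarrow> transpose X ** J4 ** X = J4"
proof
  assume X: "transpose X ** J4 ** X = J4"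
  then have "symp_inv X ** X = - (J4 ** J4)"
    by (simp add: symp_inv_def matrix_mult_minus_left matrix_mul_assoc[symmetric])
  then have "symp_inv X ** X = mat 1" by (simp add: J4_J4)
  then have "invertible X" by (metis invertible_def matrix_left_right_inverse)
  with X show "X \<in> Sp4" by (simp add: Sp4_def)
qed (simp add: Sp4_def)

lemma symp_inv_left: "X \<in> Sp4 \<Longrightarrow> symp_inv X ** X = mat 1"
  by (simp add: Sp4_iff symp_inv_def matrix_mult_minus_left matrix_mul_assoc[symmetric] J4_J4)

lemma symp_inv_right: "X \<in> Sp4 \<Longrightarrow> X ** symp_inv X = mat 1"
  using symp_inv_left matrix_left_right_inverse by blast

lemma matrix_inv_Sp4: "X \<in> Sp4 \<Longrightarrow> matrix_inv X = symp_inv X"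
  unfolding matrix_inv_def
  by (rule some_equality) (auto simp: symp_inv_left symp_inv_right, metis matrix_mul_assoc matrix_mul_lid matrix_mul_rid symp_inv_left)

lemma smooth_on_symp_inv [smooth_intros]:
  "open U \<Longrightarrow> smooth_on U f \<Longrightarrow> smooth_on U (\<lambda>x. symp_inv (f x))"
  unfolding symp_inv_def by (intro smooth_intros)

lemma Omega_transpose: "Omega (X *v a) (X *v b) = a \<bullet> ((transpose X ** J4 ** X) *v b)"
  unfolding Omega_def matrix_vector_mul_assoc[symmetric] transpose_matrix_vector
  by (subst (2) inner_commute, subst dot_lmul_matrix) (rule inner_commute)

lemma Omega_Sp4: "X \<in> Sp4 \<Longrightarrow> Omega (X *v a) (X *v b) = Omega a b"
  by (simp only: Omega_transpose Sp4_iff) (simp add: Omega_def)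

lemma Sp4I_Omega:
  assumes "\<And>a b. Omega (X *v a) (X *v b) = Omega a b"
  shows "X \<in> Sp4"
proof -
  have "(transpose X ** J4 ** X) *v b = J4 *v b" for b
    using assms[of _ b] by (metis Omega_transpose Omega_def vector_eq_ldot)
  then show ?thesis by (simp add: Sp4_iff matrix_eq)
qed

lemma Sp4_mult: "X \<in> Sp4 \<Longrightarrow> Y \<in> Sp4 \<Longrightarrow> X ** Y \<in> Sp4"
  by (rule Sp4I_Omega) (simp add: matrix_vector_mul_assoc[symmetric] Omega_Sp4)

lemma Sp4_mat_1: "mat 1 \<in> Sp4"
  by (rule Sp4I_Omega) simp

lemma Sp4_symp_inv: "X \<in> Sp4 \<Longrightarrow> symp_inv X \<in> Sp4"
proof (rule Sp4I_Omega)
  fix a b assume X: "X \<in> Sp4"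
  have "Omega (symp_inv X *v a) (symp_inv X *v b) = Omega (X *v (symp_inv X *v a)) (X *v (symp_inv X *v b))"
    by (simp add: Omega_Sp4[OF X])
  then show "Omega (symp_inv X *v a) (symp_inv X *v b) = Omega a b"
    by (simp add: matrix_vector_mul_assoc symp_inv_right[OF X])
qed

lemma symp_inv_mult: "X \<in> Sp4 \<Longrightarrow> symp_inv X *v (X *v y) = y" "X \<in> Sp4 \<Longrightarrow> X *v (symp_inv X *v y) = y"
  by (simp_all add: matrix_vector_mul_assoc symp_inv_left symp_inv_right)

lemma symp_inv_cancel: "X \<in> Sp4 \<Longrightarrow> symp_inv X ** (X ** Y) = Y" "X \<in> Sp4 \<Longrightarrow> X ** (symp_inv X ** Y) = Y"
  by (simp_all add: matrix_mul_assoc symp_inv_left symp_inv_right)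

text \<open>Coordinates in a symplectic frame are Omega-pairings with the dual columns. Entries 3
  and 4 pair with the first two columns; this expresses gamma through tangent vectors.\<close>

lemma symp_inv_nth:
  "(symp_inv X *v y) $ 1 = - Omega (column 3 X) y" "(symp_inv X *v y) $ 2 = - Omega (column 4 X) y"
  "(symp_inv X *v y) $ 3 = Omega (column 1 X) y" "(symp_inv X *v y) $ 4 = Omega (column 2 X) y"
proof -
  have "symp_inv X *v y = - (J4 *v (transpose X *v (J4 *v y)))"
    by (simp add: symp_inv_def matrix_vector_mul_assoc matrix_mul_assoc)
      (simp add: vec_eq_iff matrix_vector_mult_def sum_negf)
  moreover have "(transpose X *v (J4 *v y)) $ i = Omega (column i X) y" for i
    by (simp add: Omega_def matrix_vector_mult_def transpose_def column_def inner_vec_def)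
  ultimately show
    "(symp_inv X *v y) $ 1 = - Omega (column 3 X) y" "(symp_inv X *v y) $ 2 = - Omega (column 4 X) y"
    "(symp_inv X *v y) $ 3 = Omega (column 1 X) y" "(symp_inv X *v y) $ 4 = Omega (column 2 X) y"
    by (simp_all add: J4_mult vector_4)
qed

lemma matrix_vector_columns: "(X :: real^4^4) *v c = c $ 1 *\<^sub>R column 1 X + c $ 2 *\<^sub>R column 2 X + c $ 3 *\<^sub>R column 3 X + c $ 4 *\<^sub>R column 4 X"
  by (simp add: vec_eq_iff matrix_vector_mult_4 column_def mult.commute)

lemma Sp4_expand:
  assumes "X \<in> Sp4"
  shows "y = - Omega (column 3 X) y *\<^sub>R column 1 X - Omega (column 4 X) y *\<^sub>R column 2 X
      + Omega (column 1 X) y *\<^sub>R column 3 X + Omega (column 2 X) y *\<^sub>R column 4 X"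
  using symp_inv_mult(2)[OF assms, of y] unfolding matrix_vector_columns[of X] symp_inv_nth by simp

lemma Sp4_columns:
  assumes "Omega (column 1 X) (column 2 X) = 0" "Omega (column 1 X) (column 3 X) = 1" "Omega (column 1 X) (column 4 X) = 0"
    "Omega (column 2 X) (column 3 X) = 0" "Omega (column 2 X) (column 4 X) = 1" "Omega (column 3 X) (column 4 X) = 0"
  shows "X \<in> Sp4"
proof (rule Sp4I_Omega)
  fix a b
  show "Omega (X *v a) (X *v b) = Omega a b"
    unfolding matrix_vector_columns Omega.add_left Omega.add_right Omega.scaleR_left Omega.scaleR_right
    using assms Omega_commute[of "column 2 X" "column 1 X"] Omega_commute[of "column 3 X" "column 1 X"] Omega_commute[of "column 4 X" "column 1 X"]
      Omega_commute[of "column 3 X" "column 2 X"] Omega_commute[of "column 4 X" "column 2 X"] Omega_commute[of "column 4 X" "column 3 X"]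
    by (simp add: Omega_eq[of a b])
qed

section \<open>Completing a Lagrangian pair to a symplectic basis\<close>

definition of_columns :: "real^4 \<Rightarrow> real^4 \<Rightarrow> real^4 \<Rightarrow> real^4 \<Rightarrow> real^4^4" where
  "of_columns X1 X2 X3 X4 = (\<chi> i j. if j = 1 then X1 $ i else if j = 2 then X2 $ i else if j = 3 then X3 $ i else X4 $ i)"

lemma column_of_columns [simp]:
  "column 1 (of_columns X1 X2 X3 X4) = X1" "column 2 (of_columns X1 X2 X3 X4) = X2"
  "column 3 (of_columns X1 X2 X3 X4) = X3" "column 4 (of_columns X1 X2 X3 X4) = X4"
  by (simp_all add: of_columns_def column_def vec_eq_iff)

lemma smooth_on_of_columns [smooth_intros]:
  assumes "open U" "smooth_on U X1" "smooth_on U X2" "smooth_on U X3" "smooth_on U X4"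
  shows "smooth_on U (\<lambda>x. of_columns (X1 x) (X2 x) (X3 x) (X4 x))"
  unfolding of_columns_def
proof (intro smooth_on_vec_lambda assms(1))
  fix i j :: 4
  show "smooth_on U (\<lambda>x. if j = 1 then X1 x $ i else if j = 2 then X2 x $ i else if j = 3 then X3 x $ i else X4 x $ i)"
    by (cases "j = 1"; cases "j = 2"; cases "j = 3") (auto intro: smooth_intros assms)
qed

text \<open>\<open>Y1\<close>, \<open>Y2\<close> are first normalized to be dual to the Lagrangian pair \<open>X1\<close>, \<open>X2\<close>; then a multiple of
  \<open>X1\<close> is added to the last vector to make the complement Lagrangian.\<close>

definition dual_det :: "real^4 \<Rightarrow> real^4 \<Rightarrow> real^4 \<Rightarrow> real^4 \<Rightarrow> real" where
  "dual_det X1 X2 Y1 Y2 = Omega X1 Y1 * Omega X2 Y2 - Omega X1 Y2 * Omega X2 Y1"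

definition dual1 :: "real^4 \<Rightarrow> real^4 \<Rightarrow> real^4 \<Rightarrow> real^4 \<Rightarrow> real^4" where
  "dual1 X1 X2 Y1 Y2 = (Omega X2 Y2 / dual_det X1 X2 Y1 Y2) *\<^sub>R Y1 - (Omega X2 Y1 / dual_det X1 X2 Y1 Y2) *\<^sub>R Y2"

definition dual2 :: "real^4 \<Rightarrow> real^4 \<Rightarrow> real^4 \<Rightarrow> real^4 \<Rightarrow> real^4" where
  "dual2 X1 X2 Y1 Y2 = (Omega X1 Y1 / dual_det X1 X2 Y1 Y2) *\<^sub>R Y2 - (Omega X1 Y2 / dual_det X1 X2 Y1 Y2) *\<^sub>R Y1"

definition completion :: "real^4 \<Rightarrow> real^4 \<Rightarrow> real^4 \<Rightarrow> real^4 \<Rightarrow> real^4^4" where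
  "completion X1 X2 Y1 Y2 = of_columns X1 X2 (dual1 X1 X2 Y1 Y2)
     (dual2 X1 X2 Y1 Y2 + Omega (dual1 X1 X2 Y1 Y2) (dual2 X1 X2 Y1 Y2) *\<^sub>R X1)"

lemma completion_Sp4:
  assumes "Omega X1 X2 = 0" "dual_det X1 X2 Y1 Y2 \<noteq> 0"
  shows "completion X1 X2 Y1 Y2 \<in> Sp4"
proof -
  let ?D = "dual_det X1 X2 Y1 Y2"
  have a: "Omega X1 (dual1 X1 X2 Y1 Y2) = 1" "Omega X2 (dual1 X1 X2 Y1 Y2) = 0"
    "Omega X1 (dual2 X1 X2 Y1 Y2) = 0" "Omega X2 (dual2 X1 X2 Y1 Y2) = 1"
    using assms(2) unfolding dual1_def dual2_def Omega.diff_right Omega.scaleR_right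
    by (simp_all add: diff_divide_distrib[symmetric]) (simp_all add: dual_det_def mult.commute)
  then show ?thesis unfolding completion_def
    using assms(1) Omega_commute[of X2 X1] Omega_commute[of "dual1 X1 X2 Y1 Y2" X1]
    by (intro Sp4_columns) (simp_all add: Omega.add_right Omega.scaleR_right)
qed

lemma smooth_on_completion [smooth_intros]:
  assumes "open U" "smooth_on U X1" "smooth_on U X2" "smooth_on U Y1" "smooth_on U Y2"
    "\<And>x. x \<in> U \<Longrightarrow> dual_det (X1 x) (X2 x) (Y1 x) (Y2 x) \<noteq> 0"
  shows "smooth_on U (\<lambda>x. completion (X1 x) (X2 x) (Y1 x) (Y2 x))"
  using assms(6) unfolding completion_def dual1_def dual2_def dual_det_def
  by (intro smooth_intros assms(1-5)) auto

section \<open>Directional derivatives\<close>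

definition dird :: "'a::euclidean_space \<Rightarrow> ('a \<Rightarrow> 'b::real_normed_vector) \<Rightarrow> 'a \<Rightarrow> 'b" where
  "dird v f x = frechet_derivative f (at x) v"

lemma smooth_on_dird [smooth_intros]: "smooth_on U f \<Longrightarrow> smooth_on U (dird v f)"
  using smooth_on_frechet_derivative[of U f v] by (simp add: dird_def[abs_def])

lemma has_derivative_dird:
  "smooth_on U f \<Longrightarrow> open U \<Longrightarrow> x \<in> U \<Longrightarrow> (f has_derivative (\<lambda>v. dird v f x)) (at x)"
  using smooth_on_has_derivative by (simp add: dird_def eta_contract_eq)

lemma dird_eqI: "(f has_derivative f') (at x) \<Longrightarrow> dird v f x = f' v"
  unfolding dird_def using frechet_derivative_at by metis

lemma dird_const [simp]: "dird v (\<lambda>x. c) = (\<lambda>x. 0)"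
  by (rule ext) (simp add: dird_def)

lemma linear_dird: "smooth_on U f \<Longrightarrow> open U \<Longrightarrow> x \<in> U \<Longrightarrow> linear (\<lambda>v. dird v f x)"
  using has_derivative_dird has_derivative_linear by blast

lemma dird_commute:
  fixes f :: "'a::euclidean_space \<Rightarrow> 'b::euclidean_space"
  shows "smooth_on U f \<Longrightarrow> open U \<Longrightarrow> x \<in> U \<Longrightarrow> dird v (dird u f) x = dird u (dird v f) x"
  unfolding dird_def[abs_def] by (rule second_derivative_symmetric)

lemma dird_cong:
  assumes "open U" "x \<in> U" "smooth_on U f" "\<And>y. y \<in> U \<Longrightarrow> f y = g y"
  shows "dird v f x = dird v g x"
  unfolding dird_def
  by (subst frechet_derivative_transform_within_open[of f x U g])
    (use assms smooth_on_has_derivative differentiableI in blast)+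

lemma dird_bilinear:
  assumes "bounded_bilinear pr" "smooth_on U f" "smooth_on U g" "open U" "x \<in> U"
  shows "dird v (\<lambda>x. pr (f x) (g x)) x = pr (f x) (dird v g x) + pr (dird v f x) (g x)"
  by (rule dird_eqI[OF bounded_bilinear.FDERIV[OF assms(1) has_derivative_dird has_derivative_dird]])
    (use assms in auto)

lemma dird_bounded_linear:
  assumes "bounded_linear l" "smooth_on U f" "open U" "x \<in> U"
  shows "dird v (\<lambda>x. l (f x)) x = l (dird v f x)"
  by (rule dird_eqI[OF bounded_linear.has_derivative[OF assms(1) has_derivative_dird]])
    (use assms in auto)

lemma dird_Pair:
  assumes "smooth_on U f" "smooth_on U g" "open U" "x \<in> U"
  shows "dird v (\<lambda>x. (f x, g x)) x = (dird v f x, dird v g x)"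
  by (rule dird_eqI[OF has_derivative_Pair[OF has_derivative_dird has_derivative_dird]])
    (use assms in auto)

section \<open>Lagrangian immersions of open subsets of the plane\<close>

abbreviation "e\<^sub>1 \<equiv> axis 1 1 :: real^2"
abbreviation "e\<^sub>2 \<equiv> axis 2 1 :: real^2"

lemma vec2_eq: "(v :: real^2) = v $ 1 *\<^sub>R e\<^sub>1 + v $ 2 *\<^sub>R e\<^sub>2"
  by (simp add: vec_eq_iff forall_2 axis_def)

lemma linear_vec2: "linear l \<Longrightarrow> l (v :: real^2) = v $ 1 *\<^sub>R l e\<^sub>1 + v $ 2 *\<^sub>R l e\<^sub>2"
  by (subst vec2_eq[of v]) (simp add: linear_add linear_cmul)

locale lagrangian_patch =
  fixes U :: "(real^2) set" and a :: "real^2 \<Rightarrow> real^4"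
  assumes U: "open U" and smooth: "smooth_on U a"
    and lagrangian: "\<And>x u v. x \<in> U \<Longrightarrow> Omega (dird u a x) (dird v a x) = 0"
begin

definition cubic :: "real^2 \<Rightarrow> real^2 \<Rightarrow> real^2 \<Rightarrow> real^2 \<Rightarrow> real" where
  "cubic x u v w = Omega (dird w a x) (dird v (dird u a) x)"

lemma smooth_on_cubic [smooth_intros]: "smooth_on U (\<lambda>x. cubic x u v w)"
  unfolding cubic_def by (intro smooth_intros U) (auto intro: smooth smooth_on_dird)

lemma cubic_swap12: "x \<in> U \<Longrightarrow> cubic x u v w = cubic x v u w"
  unfolding cubic_def using dird_commute[OF smooth U, of x v u] by simp

text \<open>The Lagrangian condition for \<open>u\<close> and \<open>w\<close>, differentiated along
  \<open>v\<close>.\<close>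

lemma cubic_swap13:
  assumes x: "x \<in> U"
  shows "cubic x u v w = cubic x w v u"
proof -
  have "dird v (\<lambda>x. Omega (dird u a x) (dird w a x)) x = dird v (\<lambda>x. 0) x"
    by (rule dird_cong[OF U x]) (auto intro!: smooth_on_Omega U smooth smooth_on_dird simp: lagrangian)
  then have "Omega (dird u a x) (dird v (dird w a) x) + Omega (dird v (dird u a) x) (dird w a x) = 0"
    by (subst (asm) dird_bilinear[OF bounded_bilinear_Omega smooth_on_dird[OF smooth] smooth_on_dird[OF smooth] U x]) simp
  then show ?thesis unfolding cubic_def using Omega_commute[of "dird w a x"] by simp
qed

lemma cubic_swap23: "x \<in> U \<Longrightarrow> cubic x u v w = cubic x u w v"
  using cubic_swap12 cubic_swap13 by metis

lemma linear_cubic: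
  assumes "x \<in> U"
  shows "linear (\<lambda>u. cubic x u v w)" "linear (\<lambda>v. cubic x u v w)" "linear (\<lambda>w. cubic x u v w)"
proof -
  show 3: "linear (\<lambda>w. cubic x u v w)" for u v
    unfolding cubic_def
    by (auto intro!: linearI simp: linear_add[OF linear_dird[OF smooth U assms]] linear_cmul[OF linear_dird[OF smooth U assms]]
      Omega.add_left Omega.scaleR_left)
  show "linear (\<lambda>u. cubic x u v w)" using 3[of w v] cubic_swap13[OF assms] by simp
  show "linear (\<lambda>v. cubic x u v w)" using 3[of u w] cubic_swap23[OF assms] by simp
qed

lemma dird_cubic:
  assumes x: "x \<in> U"
  shows "dird z (\<lambda>x. cubic x u v w) x =
    Omega (dird w a x) (dird z (dird v (dird u a)) x) + Omega (dird z (dird w a) x) (dird v (dird u a) x)"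
  unfolding cubic_def
  by (rule dird_bilinear[OF bounded_bilinear_Omega]) (use U x in \<open>auto intro!: smooth_on_dird smooth\<close>)

text \<open>Differentiating the cubic form, the third derivatives of \<open>a\<close> cancel in the antisymmetrization.\<close>

lemma dird_cubic_antisym:
  assumes x: "x \<in> U"
  shows "dird z (\<lambda>x. cubic x u v w) x - dird u (\<lambda>x. cubic x z v w) x =
    Omega (dird z (dird w a) x) (dird v (dird u a) x) - Omega (dird u (dird w a) x) (dird v (dird z a) x)"
proof -
  have "dird z (dird v (dird u a)) x = dird u (dird v (dird z a)) x"
  proof -
    have "dird z (dird v (dird u a)) x = dird z (dird u (dird v a)) x"
      by (rule dird_cong[OF U x]) (auto intro!: smooth_on_dird smooth dird_commute[OF smooth U])
    also have "\<dots> = dird u (dird z (dird v a)) x"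
      by (rule dird_commute[OF smooth_on_dird[OF smooth] U x])
    also have "\<dots> = dird u (dird v (dird z a)) x"
      by (rule dird_cong[OF U x]) (auto intro!: smooth_on_dird smooth dird_commute[OF smooth U])
    finally show ?thesis .
  qed
  then show ?thesis by (simp add: dird_cubic[OF x])
qed

end

locale elliptic_patch = lagrangian_patch +
  assumes hessian_pos: "\<And>x v. x \<in> U \<Longrightarrow> v \<noteq> 0 \<Longrightarrow> (cubic x e\<^sub>1 e\<^sub>2 v)\<^sup>2 - cubic x e\<^sub>1 e\<^sub>1 v * cubic x e\<^sub>2 e\<^sub>2 v > 0"
begin

definition frame :: "real^2 \<Rightarrow> real^4^4" where
  "frame x = completion (dird e\<^sub>1 a x) (dird e\<^sub>2 a x) (dird e\<^sub>1 (dird e\<^sub>1 a) x) (dird e\<^sub>2 (dird e\<^sub>1 a) x)"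

text \<open>By the symmetries of \<open>cubic\<close> this determinant is minus the expression in
  \<open>hessian_pos\<close> at \<open>e\<^sub>1\<close>.\<close>

lemma dual_det_nz:
  assumes "x \<in> U"
  shows "dual_det (dird e\<^sub>1 a x) (dird e\<^sub>2 a x) (dird e\<^sub>1 (dird e\<^sub>1 a) x) (dird e\<^sub>2 (dird e\<^sub>1 a) x) \<noteq> 0"
proof -
  have "e\<^sub>1 \<noteq> 0" by simp
  have "cubic x e\<^sub>1 e\<^sub>2 e\<^sub>1 = cubic x e\<^sub>1 e\<^sub>1 e\<^sub>2" "cubic x e\<^sub>2 e\<^sub>2 e\<^sub>1 = cubic x e\<^sub>1 e\<^sub>2 e\<^sub>2"
    by (rule cubic_swap23[OF assms], rule cubic_swap13[OF assms])
  with hessian_pos[OF assms \<open>e\<^sub>1 \<noteq> 0\<close>] have "cubic x e\<^sub>1 e\<^sub>1 e\<^sub>1 * cubic x e\<^sub>1 e\<^sub>2 e\<^sub>2 - cubic x e\<^sub>1 e\<^sub>2 e\<^sub>1 * cubic x e\<^sub>1 e\<^sub>1 e\<^sub>2 < 0"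
    by (simp add: power2_eq_square)
  then show ?thesis by (simp add: dual_det_def cubic_def)
qed

lemma frame_Sp4: "x \<in> U \<Longrightarrow> frame x \<in> Sp4"
  unfolding frame_def by (rule completion_Sp4[OF lagrangian dual_det_nz])

lemma smooth_on_frame [smooth_intros]: "smooth_on U frame"
  unfolding frame_def[abs_def]
  by (rule smooth_on_completion[OF U]) (auto intro!: smooth_on_dird smooth simp: dual_det_nz)

lemma columns_frame: "column 1 (frame x) = dird e\<^sub>1 a x" "column 2 (frame x) = dird e\<^sub>2 a x"
  unfolding frame_def completion_def by simp_all

text \<open>The columns of \<open>frame\<close> are combinations of first and second derivatives, so
  \<open>Z\<close> annihilates a basis. This is the source of all uniqueness statements about linear
  maps between 2-jets.\<close>

lemma zero_on_2jets:
  assumes "x \<in> U" "\<And>u. Z *v dird u a x = 0" "\<And>u v. Z *v dird v (dird u a) x = 0"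
  shows "Z = (0 :: real^4^4)"
proof -
  have "Z *v (frame x *v c) = 0" for c
    unfolding matrix_vector_columns[of "frame x"]
    unfolding frame_def completion_def dual1_def dual2_def column_of_columns
    by (simp add: matrix_vector_right_distrib matrix_vector_mult_diff_distrib matrix_vector_mult_scaleR assms(2,3))
  from this[of "symp_inv (frame x) *v _"] have "Z *v y = 0" for y
    by (simp add: symp_inv_mult(2)[OF frame_Sp4[OF assms(1)]])
  then show ?thesis by (simp add: matrix_eq)
qed

text \<open>A Lagrangian plane is its own Omega-complement: the coefficients of \<open>y\<close>
  along the last two columns of \<open>frame\<close> are its pairings with the tangent
  vectors.\<close>

lemma tangent_if_orthogonal:
  assumes "x \<in> U" "\<And>u. Omega (dird u a x) y = 0"
  obtains c d where "y = c *\<^sub>R dird e\<^sub>1 a x + d *\<^sub>R dird e\<^sub>2 a x"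
proof (rule that)
  show "y = (- Omega (column 3 (frame x)) y) *\<^sub>R dird e\<^sub>1 a x + (- Omega (column 4 (frame x)) y) *\<^sub>R dird e\<^sub>2 a x"
    using Sp4_expand[OF frame_Sp4[OF assms(1)], of y] assms(2) by (simp add: columns_frame)
qed

end

section \<open>Two patches with the same cubic form\<close>

locale applicable_patch = a: elliptic_patch U a + b: lagrangian_patch U b for U a b +
  assumes same_cubic: "\<And>x u v w. x \<in> U \<Longrightarrow> b.cubic x u v w = a.cubic x u v w"
begin

sublocale b: elliptic_patch U b
  by unfold_locales (use a.hessian_pos same_cubic in auto)

text \<open>The defect \<open>T\<close> is symmetric within each pair of arguments. Comparing
  \<open>dird_cubic_antisym\<close> for both immersions adds the exchange of the two middle
  arguments, so \<open>T\<close> is totally symmetric. But skewness of Omega makes it change sign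
  when the pairs are exchanged, hence it is 0.\<close>

lemma same_gram:
  assumes x: "x \<in> U"
  shows "Omega (dird v (dird u b) x) (dird z (dird w b) x) = Omega (dird v (dird u a) x) (dird z (dird w a) x)"
proof -
  define T where "T u v w z = Omega (dird v (dird u b) x) (dird z (dird w b) x) - Omega (dird v (dird u a) x) (dird z (dird w a) x)" for u v w z
  have s: "T u v w z = T v u w z" "T u v w z = T u v z w" for u v w z
    unfolding T_def using dird_commute[OF a.smooth a.U x] dird_commute[OF b.smooth b.U x] by metis+
  have anti: "T u v w z = - T w z u v" for u v w z
    unfolding T_def by (subst Omega_commute, subst (2) Omega_commute) simp
  have ex: "T w z u v = T w u z v" for u v w z
  proof -
    have "dird z (\<lambda>x. b.cubic x u v w) x = dird z (\<lambda>x. a.cubic x u v w) x" for z u v w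
      by (rule dird_cong[OF a.U x b.smooth_on_cubic]) (rule same_cubic)
    then show ?thesis
      using a.dird_cubic_antisym[OF x, of z u v w] b.dird_cubic_antisym[OF x, of z u v w] by (simp add: T_def)
  qed
  have "T w z u v = T u v w z" by (metis ex s)
  then have "T u v w z = 0" using anti[of u v w z] by simp
  then show ?thesis by (simp add: T_def)
qed

lemma same_gram1:
  assumes "x \<in> U"
  shows "Omega (dird w b x) (dird v (dird u b) x) = Omega (dird w a x) (dird v (dird u a) x)"
    "Omega (dird v (dird u b) x) (dird w b x) = Omega (dird v (dird u a) x) (dird w a x)"
  using same_cubic[OF assms, of u v w] Omega_commute[of _ "dird w a x"] Omega_commute[of _ "dird w b x"]
  by (auto simp: a.cubic_def b.cubic_def)

text \<open>Taking the quotient of two symplectic frames makes smoothness and membership in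
  \<open>Sp4\<close> evident. The frames depend on the chosen coordinates; that \<open>Phi\<close>
  carries all first and second derivatives is shown in \<open>Phi_dird\<close> and
  \<open>Phi_dird2\<close>.\<close>

definition Phi :: "real^2 \<Rightarrow> real^4^4" where
  "Phi x = b.frame x ** symp_inv (a.frame x)"

lemma Phi_Sp4: "x \<in> U \<Longrightarrow> Phi x \<in> Sp4"
  unfolding Phi_def by (intro Sp4_mult Sp4_symp_inv a.frame_Sp4 b.frame_Sp4)

lemma smooth_on_Phi [smooth_intros]: "smooth_on U Phi"
  unfolding Phi_def[abs_def]
  by (intro smooth_on_matrix_mult smooth_on_symp_inv a.U a.smooth_on_frame b.smooth_on_frame)

lemma Phi_frame: "x \<in> U \<Longrightarrow> Phi x *v column i (a.frame x) = column i (b.frame x)"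
  by (simp add: Phi_def matrix_vector_mult_basis[symmetric] matrix_vector_mul_assoc matrix_mul_assoc[symmetric]
      symp_inv_left[OF a.frame_Sp4])

text \<open>A vector is determined by its pairings with a symplectic frame, so equality can be
  tested by Omega-products.\<close>

lemma Phi_eqI:
  assumes x: "x \<in> U" and "\<And>i. Omega (column i (b.frame x)) y' = Omega (column i (a.frame x)) y"
  shows "Phi x *v y = y'"
proof -
  have "Omega (column i (b.frame x)) (Phi x *v y) = Omega (column i (b.frame x)) y'" for i
    using Omega_Sp4[OF Phi_Sp4[OF x], of "column i (a.frame x)" y] assms(2)[of i] by (simp add: Phi_frame[OF x])
  then show ?thesis
    using Sp4_expand[OF b.frame_Sp4[OF x], of "Phi x *v y"] Sp4_expand[OF b.frame_Sp4[OF x], of y'] by simp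
qed

text \<open>The coefficients used by \<open>completion\<close> are formed from Omega-products of its
  arguments, and these are the same for \<open>a\<close> and \<open>b\<close>.\<close>

lemma frame_Omega_eq:
  assumes x: "x \<in> U"
    and "\<And>u. Omega (dird u b x) y' = Omega (dird u a x) y"
    and "\<And>u v. Omega (dird v (dird u b) x) y' = Omega (dird v (dird u a) x) y"
  shows "Omega (column i (b.frame x)) y' = Omega (column i (a.frame x)) y"
proof -
  have dd: "dual_det (dird e\<^sub>1 b x) (dird e\<^sub>2 b x) (dird e\<^sub>1 (dird e\<^sub>1 b) x) (dird e\<^sub>2 (dird e\<^sub>1 b) x)
     = dual_det (dird e\<^sub>1 a x) (dird e\<^sub>2 a x) (dird e\<^sub>1 (dird e\<^sub>1 a) x) (dird e\<^sub>2 (dird e\<^sub>1 a) x)"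
    by (simp add: dual_det_def same_gram1[OF x])
  have "i = 1 \<or> i = 2 \<or> i = 3 \<or> i = 4" by (rule exhaust_4)
  then show ?thesis
    unfolding a.frame_def b.frame_def completion_def
    by (elim disjE) (simp_all add: dual1_def dual2_def dd same_gram[OF x] same_gram1[OF x] assms(2,3)
      Omega.add_left Omega.diff_left Omega.scaleR_left Omega.diff_right Omega.scaleR_right)
qed

lemma Phi_dird: "x \<in> U \<Longrightarrow> Phi x *v dird u a x = dird u b x"
  by (intro Phi_eqI frame_Omega_eq) (simp_all add: a.lagrangian b.lagrangian same_gram1)

lemma Phi_dird2: "x \<in> U \<Longrightarrow> Phi x *v dird v (dird u a) x = dird v (dird u b) x"
  by (intro Phi_eqI frame_Omega_eq) (simp_all add: same_gram1 same_gram)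

text \<open>Differentiate \<open>Phi_dird\<close> along \<open>v\<close>: the term with the second
  derivative already accounts for the right-hand side by \<open>Phi_dird2\<close>.\<close>

lemma dird_Phi_dird:
  assumes x: "x \<in> U"
  shows "dird v Phi x *v dird u a x = 0"
proof -
  have "dird v (\<lambda>x. Phi x *v dird u a x) x = dird v (dird u b) x"
    by (rule dird_cong[OF a.U x])
      (auto intro!: smooth_on_matrix_vector_mult a.U smooth_on_Phi smooth_on_dird a.smooth Phi_dird)
  then show ?thesis
    by (subst (asm) dird_bilinear[OF bounded_bilinear_matrix_vector_mult smooth_on_Phi smooth_on_dird[OF a.smooth] a.U x])
      (simp add: Phi_dird2[OF x])
qed

text \<open>The conditions involve only first derivatives of the immersions and of \<Psi>, so they
  transform well under changes of coordinates. Differentiating the first and inserting the second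
  shows that \<Psi> carries the second derivatives as well.\<close>

lemma Phi_unique:
  assumes "open V" "V \<subseteq> U" "smooth_on V \<Psi>" "x \<in> V"
    and "\<And>x u. x \<in> V \<Longrightarrow> \<Psi> x *v dird u a x = dird u b x"
    and "\<And>u v. dird v \<Psi> x *v dird u a x = 0"
  shows "\<Psi> x = Phi x"
proof -
  have x: "x \<in> U" using assms by blast
  have sm: "smooth_on V (dird u a)" "smooth_on V (dird u b)" for u
    using assms(2) a.smooth b.smooth by (auto intro: smooth_on_dird smooth_on_subset)
  have "dird v (\<lambda>x. \<Psi> x *v dird u a x) x = dird v (dird u b) x" for u v
    by (rule dird_cong[OF assms(1,4)])
      (use assms in \<open>auto intro!: smooth_on_matrix_vector_mult sm\<close>)
  then have "\<Psi> x *v dird v (dird u a) x = dird v (dird u b) x" for u v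
    by (subst (asm) dird_bilinear[OF bounded_bilinear_matrix_vector_mult assms(3) sm(1) assms(1,4)]) (simp add: assms(6))
  then have "\<Psi> x - Phi x = 0"
    by (intro a.zero_on_2jets[OF x])
      (simp_all add: matrix_vector_mult_diff_rdistrib Phi_dird[OF x] Phi_dird2[OF x] assms(4,5))
  then show ?thesis by simp
qed

section \<open>The nilpotent closed form and its linear system\<close>

definition B :: "real^2 \<Rightarrow> real^2 \<Rightarrow> real^4^4" where
  "B x v = symp_inv (Phi x) ** dird v Phi x"

lemma dird_Phi: "x \<in> U \<Longrightarrow> dird v Phi x = Phi x ** B x v"
  by (simp add: B_def symp_inv_cancel Phi_Sp4)

lemma smooth_on_B [smooth_intros]: "smooth_on U (\<lambda>x. B x v)"
  unfolding B_def by (intro smooth_on_matrix_mult smooth_on_symp_inv a.U smooth_on_Phi smooth_on_dird)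

lemma linear_B: "x \<in> U \<Longrightarrow> linear (B x)"
  unfolding B_def[abs_def]
  by (auto intro!: linearI simp: linear_add[OF linear_dird[OF smooth_on_Phi a.U]] linear_cmul[OF linear_dird[OF smooth_on_Phi a.U]]
    mmult.add_right mmult.scaleR_right)

lemma B_dird: "x \<in> U \<Longrightarrow> B x v *v dird u a x = 0"
  by (simp add: B_def matrix_vector_mul_assoc[symmetric] dird_Phi_dird)

lemma B_skew:
  assumes x: "x \<in> U"
  shows "Omega (B x v *v p) q + Omega p (B x v *v q) = 0"
proof -
  have sm: "smooth_on U (\<lambda>x. Phi x *v p)" for p
    by (intro smooth_on_matrix_vector_mult a.U smooth_on_Phi smooth_on_const)
  have d: "dird v (\<lambda>x. Phi x *v p) x = Phi x *v (B x v *v p)" for p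
    by (subst dird_bilinear[OF bounded_bilinear_matrix_vector_mult smooth_on_Phi smooth_on_const[OF a.U] a.U x])
      (simp add: dird_Phi[OF x] matrix_vector_mul_assoc)
  have "dird v (\<lambda>x. Omega (Phi x *v p) (Phi x *v q)) x = dird v (\<lambda>x. Omega p q) x"
    by (rule dird_cong[OF a.U x smooth_on_Omega[OF a.U sm sm]]) (simp add: Omega_Sp4 Phi_Sp4)
  then show ?thesis
    by (subst (asm) dird_bilinear[OF bounded_bilinear_Omega sm sm a.U x]) (simp add: d Omega_Sp4[OF Phi_Sp4[OF x]] add.commute)
qed

text \<open>By \<open>B_skew\<close>, pairing a value of \<open>B x v\<close> with a tangent vector
  moves \<open>B\<close> onto the tangent vector, where it is 0. So the values are orthogonal to the
  Lagrangian tangent plane, hence lie in it, and \<open>B x u\<close> annihilates them.\<close>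

lemma B_B:
  assumes x: "x \<in> U"
  shows "B x u ** B x v = 0"
proof -
  have "Omega (dird w a x) (B x v *v y) = 0" for w y
    using B_skew[OF x, of v "dird w a x" y] by (simp add: B_dird[OF x] Omega.zero_left)
  then have "B x u *v (B x v *v y) = 0" for y
    using a.tangent_if_orthogonal[OF x, of "B x v *v y"] B_dird[OF x]
    by (metis matrix_vector_right_distrib matrix_vector_mult_scaleR scaleR_zero_right add.right_neutral)
  then show ?thesis by (simp add: matrix_eq matrix_vector_mul_assoc[symmetric])
qed

text \<open>Second derivatives of \<open>Phi\<close> commute. Written through
  \<open>dird_Phi\<close> they contain a quadratic term in \<open>B\<close>, which is 0 by
  \<open>B_B\<close>; the invertible factor \<open>Phi x\<close> then cancels.\<close>

lemma dird_B_commute: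
  assumes x: "x \<in> U"
  shows "dird u (\<lambda>x. B x v) x = dird v (\<lambda>x. B x u) x"
proof -
  have "Phi x ** dird u (\<lambda>x. B x v) x = dird u (dird v Phi) x" for u v
  proof -
    have "dird u (dird v Phi) x = dird u (\<lambda>x. Phi x ** B x v) x"
      by (rule dird_cong[OF a.U x smooth_on_dird[OF smooth_on_Phi]]) (rule dird_Phi)
    also have "\<dots> = Phi x ** dird u (\<lambda>x. B x v) x + dird u Phi x ** B x v"
      by (rule dird_bilinear[OF bounded_bilinear_matrix_mult smooth_on_Phi smooth_on_B a.U x])
    also have "dird u Phi x ** B x v = 0"
      by (simp add: dird_Phi[OF x] matrix_mul_assoc[symmetric] B_B[OF x])
    finally show ?thesis by simp
  qed
  then have "Phi x ** dird u (\<lambda>x. B x v) x = Phi x ** dird v (\<lambda>x. B x u) x"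
    using dird_commute[OF smooth_on_Phi a.U x] by metis
  then show ?thesis using symp_inv_cancel(1)[OF Phi_Sp4[OF x]] by metis
qed

text \<open>The unknown is a pair: the linear part and the immersion it produces. The parameter
  \<open>l\<close> enters only the equation of the linear part.\<close>

definition T :: "real \<Rightarrow> real^2 \<Rightarrow> real^2 \<Rightarrow> (real^4^4) \<times> (real^4) \<Rightarrow> (real^4^4) \<times> (real^4)" where
  "T l x v p = (l *\<^sub>R (fst p ** B x v), fst p *v dird v a x)"

sublocale T: nilpotent_flat_system U "T l" for l
proof unfold_locales
  show "open U" by (rule a.U)
  have sm: "smooth_on U (\<lambda>x. l *\<^sub>R (P ** B x v))" "smooth_on U (\<lambda>x. P *v dird v a x)" for P v
    by (intro smooth_on_scaleR smooth_on_matrix_mult smooth_on_matrix_vector_mult smooth_on_const smooth_on_B smooth_on_dird a.smooth a.U)+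
  show "smooth_on U (\<lambda>x. T l x v y)" for v y
    unfolding T_def by (intro smooth_on_Pair sm a.U)
  fix x assume x: "x \<in> U"
  note lin = linear_dird[OF a.smooth a.U x] linear_B[OF x]
  show "T l x (u + v) y = T l x u y + T l x v y" "T l x (r *\<^sub>R v) y = r *\<^sub>R T l x v y" for u v y r
    by (auto simp: T_def lin[THEN linear_add] lin[THEN linear_cmul] mmult.add_right mvec.add_right
      mmult.scaleR_right mvec.scaleR_right scaleR_add_right)
  show "T l x v (y + y') = T l x v y + T l x v y'" "T l x v (r *\<^sub>R y) = r *\<^sub>R T l x v y" for v y y' r
    by (auto simp: T_def mmult.add_left mvec.add_left
      mmult.scaleR_left mvec.scaleR_left scaleR_add_right)
  \<comment> \<open>The first component contains \<open>B x v ** B x u\<close>, the second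
    \<open>B x v\<close> applied to a tangent vector.\<close>
  show "T l x u (T l x v y) = 0" for u v y
    by (simp add: T_def mmult.scaleR_left mvec.scaleR_left matrix_mul_assoc[symmetric]
      B_B[OF x] matrix_vector_mul_assoc[symmetric] B_dird[OF x] zero_prod_def)
  have 1: "dird v (\<lambda>x. l *\<^sub>R (P ** B x u)) x = l *\<^sub>R (P ** dird v (\<lambda>x. B x u) x)" for P u v
    by (rule dird_bounded_linear[OF _ smooth_on_B a.U x])
      (intro bounded_linear_scaleR_right[THEN bounded_linear_compose] mmult.bounded_linear_right)
  have 2: "dird v (\<lambda>x. P *v dird u a x) x = P *v dird v (dird u a) x" for P u v
    by (rule dird_bounded_linear[OF _ smooth_on_dird[OF a.smooth] a.U x]) (rule mvec.bounded_linear_right)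
  show "frechet_derivative (\<lambda>x. T l x u y) (at x) v = frechet_derivative (\<lambda>x. T l x v y) (at x) u" for u v y
    unfolding dird_def[symmetric] T_def dird_Pair[OF sm a.U x] 1 2
    using dird_B_commute[OF x] dird_commute[OF a.smooth a.U x] by simp
qed

text \<open>The defect \<open>transpose P ** J4 ** P - J4\<close> solves the homogeneous linear
  system \<open>G\<close>, because \<open>J4\<close> itself is annihilated:
  \<open>transpose B ** J4 + J4 ** B = 0\<close> is the matrix form of \<open>B_skew\<close>.
  Vanishing at \<open>y\<close>, it vanishes on the ball.\<close>

lemma Sp4_solution:
  assumes ball: "cball z r \<subseteq> U"
    and P: "\<And>x. x \<in> ball z r \<Longrightarrow> (P has_derivative (\<lambda>v. l *\<^sub>R (P x ** B x v))) (at x)"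
    and y: "y \<in> ball z r" "P y \<in> Sp4" and x: "x \<in> ball z r"
  shows "P x \<in> Sp4"
proof -
  define G :: "real^2 \<Rightarrow> real^2 \<Rightarrow> real^4^4 \<Rightarrow> real^4^4" where
    "G x v Y = l *\<^sub>R (transpose (B x v) ** Y + Y ** B x v)" for x v Y
  interpret G: linear_system U G
  proof
    show "open U" by (rule a.U)
    show "smooth_on U (\<lambda>x. G x v y)" for v y
      unfolding G_def by (intro smooth_intros a.U)
    have tr: "transpose (A + B) = transpose A + transpose B" "transpose (r *\<^sub>R A) = r *\<^sub>R transpose A" for A B :: "real^4^4" and r
      by (simp_all add: transpose_def vec_eq_iff)
    fix x assume x: "x \<in> U"
    show "G x (u + v) y = G x u y + G x v y" "G x (r *\<^sub>R v) y = r *\<^sub>R G x v y" for u v y r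
      using linear_B[OF x]
      by (auto simp: G_def linear_add linear_cmul mmult.add_right mmult.add_left tr
        mmult.scaleR_right mmult.scaleR_left algebra_simps)
    show "G x v (y + y') = G x v y + G x v y'" "G x v (r *\<^sub>R y) = r *\<^sub>R G x v y" for v y y' r
      by (auto simp: G_def mmult.add_right mmult.add_left
        mmult.scaleR_right mmult.scaleR_left algebra_simps)
  qed
  have "transpose (P x) ** J4 ** P x - J4 = 0"
  proof (rule G.solution_zero[OF compact_cball ball convex_ball ball_subset_cball _ y(1) _ x])
    show "transpose (P y) ** J4 ** P y - J4 = 0" using y(2) by (simp add: Sp4_iff)
    fix x assume x: "x \<in> ball z r"
    then have xU: "x \<in> U" using ball ball_subset_cball by blast
    have BJ: "transpose (B x v) ** J4 + J4 ** B x v = 0" for v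
    proof -
      have "p \<bullet> ((transpose (B x v) ** J4 + J4 ** B x v) *v q) = 0" for p q
      proof -
        have "Omega (B x v *v p) q = p \<bullet> ((transpose (B x v) ** J4) *v q)"
          unfolding Omega_def matrix_vector_mul_assoc[symmetric] transpose_matrix_vector
          by (subst (2) inner_commute, subst dot_lmul_matrix) (rule inner_commute)
        then show ?thesis using B_skew[OF xU, of v p q]
          by (simp add: Omega_def matrix_vector_mult_add_rdistrib inner_add_right matrix_vector_mul_assoc)
      qed
      then show ?thesis by (metis inner_eq_zero_iff matrix_eq matrix_vector_mult_0)
    qed
    have tr: "((\<lambda>x. transpose (P x)) has_derivative (\<lambda>v. transpose (l *\<^sub>R (P x ** B x v)))) (at x)"
      by (rule bounded_linear.has_derivative[OF bounded_linear_transpose P[OF x]])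
    have "((\<lambda>x. transpose (P x) ** J4) has_derivative (\<lambda>v. transpose (l *\<^sub>R (P x ** B x v)) ** J4)) (at x)"
      by (rule bounded_linear.has_derivative[OF mmult.bounded_linear_left tr])
    from has_derivative_diff[OF mmult.FDERIV[OF this P[OF x]] has_derivative_const[of J4]]
    show "((\<lambda>x. transpose (P x) ** J4 ** P x - J4) has_derivative (\<lambda>v. G x v (transpose (P x) ** J4 ** P x - J4))) (at x)"
    proof (rule has_derivative_eq_rhs, intro ext)
      fix v
      have t: "transpose (l *\<^sub>R (P x ** B x v)) = l *\<^sub>R (transpose (B x v) ** transpose (P x))"
        by (simp add: matrix_transpose_mul[symmetric]) (simp add: transpose_def vec_eq_iff)
      have "G x v (transpose (P x) ** J4 ** P x - J4) = G x v (transpose (P x) ** J4 ** P x)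
          - l *\<^sub>R (transpose (B x v) ** J4 + J4 ** B x v)"
        by (simp add: G_def mmult.diff_right mmult.diff_left algebra_simps)
      then show "transpose (P x) ** J4 ** l *\<^sub>R (P x ** B x v) + transpose (l *\<^sub>R (P x ** B x v)) ** J4 ** P x - 0
        = G x v (transpose (P x) ** J4 ** P x - J4)"
        by (simp add: BJ t G_def mmult.scaleR_right mmult.scaleR_left matrix_mul_assoc scaleR_add_right)
    qed
  qed
  then show ?thesis by (simp add: Sp4_iff)
qed

end

section \<open>Symmetric cubic forms in two variables\<close>

definition det2 :: "real^2 \<Rightarrow> real^2 \<Rightarrow> real" where
  "det2 v w = v $ 1 * w $ 2 - v $ 2 * w $ 1"

lemma det2_combination: "det2 (a *\<^sub>R v + b *\<^sub>R w) (c *\<^sub>R v + d *\<^sub>R w) = (a * d - b * c) * det2 v w"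
  by (simp add: det2_def algebra_simps)

lemma det2_linear:
  assumes "linear l"
  shows "det2 (l v) (l w) = det (matrix l) * det2 v w"
  unfolding linear_vec2[OF assms, of v] linear_vec2[OF assms, of w] det2_combination
  by (simp add: det2_def det_2 matrix_def algebra_simps)

lemma det2_basis:
  assumes "det2 e1 e2 \<noteq> 0"
  obtains a b where "v = a *\<^sub>R e1 + b *\<^sub>R e2"
proof
  show "v = (det2 v e2 / det2 e1 e2) *\<^sub>R e1 + (det2 e1 v / det2 e1 e2) *\<^sub>R e2"
    using assms by (simp add: vec_eq_iff forall_2 field_simps) (simp add: det2_def algebra_simps)
qed

locale cubic_form =
  fixes C :: "real^2 \<Rightarrow> real^2 \<Rightarrow> real^2 \<Rightarrow> real"
  assumes lin: "linear (\<lambda>w. C u v w)" and swap12: "C u v w = C v u w" and swap23: "C u v w = C u w v"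
begin

lemma add3: "C u v (w + w') = C u v w + C u v w'" and scale3: "C u v (r *\<^sub>R w) = r * C u v w"
  using linear_add[OF lin] linear_cmul[OF lin] by auto

lemma add2: "C u (v + v') w = C u v w + C u v' w" and scale2: "C u (r *\<^sub>R v) w = r * C u v w"
  using add3 scale3 swap23 by metis+

lemma add1: "C (u + u') v w = C u v w + C u' v w" and scale1: "C (r *\<^sub>R u) v w = r * C u v w"
  using add2 scale2 swap12 by metis+

lemmas expand = add1 add2 add3 scale1 scale2 scale3

definition hess :: "real^2 \<Rightarrow> real^2 \<Rightarrow> real^2 \<Rightarrow> real" where
  "hess e1 e2 v = (C e1 e2 v)\<^sup>2 - C e1 e1 v * C e2 e2 v"

lemma hess_change:
  "hess (a *\<^sub>R e1 + b *\<^sub>R e2) (c *\<^sub>R e1 + d *\<^sub>R e2) v = (a * d - b * c)\<^sup>2 * hess e1 e2 v"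
  unfolding hess_def expand swap12[of e2 e1] by (simp add: power2_eq_square algebra_simps)

lemma hess_basis: "hess v w z = (det2 v w)\<^sup>2 * hess e\<^sub>1 e\<^sub>2 z"
  by (subst vec2_eq[of v], subst vec2_eq[of w]) (simp add: hess_change det2_def)

text \<open>The second order condition on a frame, expressed for the tangent basis underlying its
  first two columns.\<close>

definition traceless :: "real^2 \<Rightarrow> real^2 \<Rightarrow> bool" where
  "traceless e1 e2 \<longleftrightarrow> (\<forall>v. C e1 e1 v + C e2 e2 v = 0)"

text \<open>The value of \<open>\<tau>\<^sup>2 \<omega>\<close> at the vector with coordinates
  \<open>t1\<close>, \<open>t2\<close> in the basis \<open>e1\<close>, \<open>e2\<close>.\<close>

definition fubini :: "real^2 \<Rightarrow> real^2 \<Rightarrow> real \<Rightarrow> real \<Rightarrow> complex" where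
  "fubini e1 e2 t1 t2 = (Complex t1 (- t2))\<^sup>2 *
     Complex ((C e1 e1 (t1 *\<^sub>R e1 + t2 *\<^sub>R e2) - C e2 e2 (t1 *\<^sub>R e1 + t2 *\<^sub>R e2)) / 2) (C e1 e2 (t1 *\<^sub>R e1 + t2 *\<^sub>R e2))"

lemma traceless_components:
  assumes "traceless e1 e2"
  shows "C e1 e2 e1 = C e1 e1 e2" "C e1 e2 e2 = - C e1 e1 e1" "C e2 e1 e2 = - C e1 e1 e1" "C e2 e1 e1 = C e1 e1 e2"
    "C e2 e2 e1 = - C e1 e1 e1" "C e2 e2 e2 = - C e1 e1 e2"
proof -
  have t: "C e1 e1 v + C e2 e2 v = 0" for v using assms by (simp add: traceless_def)
  show 1: "C e1 e2 e1 = C e1 e1 e2" by (rule swap23)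
  show 2: "C e1 e2 e2 = - C e1 e1 e1" using t[of e1] swap12[of e1 e2 e2] swap23[of e2 e1 e2] by simp
  show "C e2 e1 e2 = - C e1 e1 e1" using 2 swap12[of e1 e2 e2] by simp
  show "C e2 e1 e1 = C e1 e1 e2" using 1 swap12[of e1 e2 e1] by simp
  show "C e2 e2 e1 = - C e1 e1 e1" "C e2 e2 e2 = - C e1 e1 e2" using t[of e1] t[of e2] by simp_all
qed

lemma fubini_traceless:
  assumes "traceless e1 e2"
  shows "fubini e1 e2 t1 t2 = (Complex t1 (- t2))\<^sup>2 *
     Complex (C e1 e1 (t1 *\<^sub>R e1 + t2 *\<^sub>R e2)) (C e1 e2 (t1 *\<^sub>R e1 + t2 *\<^sub>R e2))"
proof -
  have "C e2 e2 v = - C e1 e1 v" for v using assms by (simp add: traceless_def eq_neg_iff_add_eq_0 add.commute)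
  then show ?thesis by (simp add: fubini_def)
qed

text \<open>With p = \<open>C e1 e1 e1\<close> and q = \<open>C e1 e1 e2\<close>, the trace
  condition turns \<open>fubini\<close> into (p + i q)(t1 - i t2)^3, and the real part of this cube
  is \<open>C v v v\<close>.\<close>

lemma Re_fubini:
  assumes "traceless e1 e2" and v: "v = t1 *\<^sub>R e1 + t2 *\<^sub>R e2"
  shows "Re (fubini e1 e2 t1 t2) = C v v v"
  unfolding fubini_traceless[OF assms(1)] v expand
  by (simp add: traceless_components[OF assms(1)] power2_eq_square algebra_simps)

text \<open>With \<open>s\<close> and \<open>t\<close> as below the two equations say (s - i t)(p +
  i q) = 0, so \<open>s\<close> and \<open>t\<close> vanish. Then the square identity and the
  positive determinant give 2(ad - bc) = a^2 + b^2 + c^2 + d^2, and the difference of the two sides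
  is a sum of two squares.\<close>

lemma traceless_conformal:
  fixes p q a b c d :: real
  assumes "p \<noteq> 0 \<or> q \<noteq> 0" "a * d - b * c > 0"
    "(a\<^sup>2 + c\<^sup>2) * p + 2 * (a * b + c * d) * q - (b\<^sup>2 + d\<^sup>2) * p = 0"
    "(a\<^sup>2 + c\<^sup>2) * q - 2 * (a * b + c * d) * p - (b\<^sup>2 + d\<^sup>2) * q = 0"
  shows "d = a" "b = - c"
proof -
  define s t where "s = a\<^sup>2 + c\<^sup>2 - b\<^sup>2 - d\<^sup>2" and "t = 2 * (a * b + c * d)"
  have 1: "s * p + t * q = 0" "s * q - t * p = 0" using assms(3,4) by (simp_all add: s_def t_def algebra_simps)
  have "s * (p\<^sup>2 + q\<^sup>2) = 0" using 1 by algebra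
  moreover have "t * (p\<^sup>2 + q\<^sup>2) = 0" using 1 by algebra
  moreover have "p\<^sup>2 + q\<^sup>2 \<noteq> 0" using assms(1) by (simp add: sum_power2_eq_zero_iff)
  ultimately have st: "s = 0" "t = 0" by auto
  have "(2 * (a * d - b * c))\<^sup>2 = (a\<^sup>2 + b\<^sup>2 + c\<^sup>2 + d\<^sup>2)\<^sup>2 - s\<^sup>2 - t\<^sup>2"
    unfolding s_def t_def by algebra
  then have "2 * (a * d - b * c) = a\<^sup>2 + b\<^sup>2 + c\<^sup>2 + d\<^sup>2"
    using assms(2) st by - (rule power2_eq_imp_eq, auto)
  then have "(d - a)\<^sup>2 + (b + c)\<^sup>2 = 0" by (simp add: power2_eq_square algebra_simps)
  then show "d = a" "b = - c" by (auto simp: sum_power2_eq_zero_iff)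
qed

text \<open>The two bases differ by a complex number a + i c: t1 - i t2 = (a + i c)(s1 - i s2),
  while the coefficient p + i q of the cube is multiplied by (a + i c)^3 on passing to
  \<open>f1\<close>, \<open>f2\<close>. The product (p + i q)(t1 - i t2)^3 is unchanged.\<close>

lemma fubini_unique:
  assumes "traceless e1 e2" "traceless f1 f2" "det2 e1 e2 < 0" "det2 f1 f2 < 0"
    and nz: "C e1 e1 e1 \<noteq> 0 \<or> C e1 e1 e2 \<noteq> 0"
    and v: "t1 *\<^sub>R e1 + t2 *\<^sub>R e2 = s1 *\<^sub>R f1 + s2 *\<^sub>R f2"
  shows "fubini e1 e2 t1 t2 = fubini f1 f2 s1 s2"
proof -
  obtain a b where f1: "f1 = a *\<^sub>R e1 + b *\<^sub>R e2" using det2_basis assms(3) by (metis less_irrefl)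
  obtain c d where f2: "f2 = c *\<^sub>R e1 + d *\<^sub>R e2" using det2_basis assms(3) by (metis less_irrefl)
  note tr = traceless_components[OF assms(1)]
  have "a * d - b * c > 0" using assms(3,4) by (simp add: f1 f2 det2_combination mult_less_0_iff)
  moreover have "C f1 f1 e1 + C f2 f2 e1 = 0" "C f1 f1 e2 + C f2 f2 e2 = 0"
    using assms(2) by (simp_all add: traceless_def)
  ultimately have dc: "d = a" "b = - c"
    using traceless_conformal[OF nz, of a d b c] unfolding f1 f2 expand tr
    by (simp_all add: power2_eq_square algebra_simps)
  have "(t1 - (s1 * a + s2 * c)) *\<^sub>R e1 + (t2 - (s2 * a - s1 * c)) *\<^sub>R e2 = 0"
    using v by (simp add: f1 f2 dc algebra_simps)
  \<comment> \<open>Cramer's rule: the area with \<open>e2\<close> and with \<open>e1\<close>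
    isolates each coefficient.\<close>
  then have "det2 ((t1 - (s1 * a + s2 * c)) *\<^sub>R e1 + (t2 - (s2 * a - s1 * c)) *\<^sub>R e2) (0 *\<^sub>R e1 + 1 *\<^sub>R e2) = 0"
    "det2 ((t1 - (s1 * a + s2 * c)) *\<^sub>R e1 + (t2 - (s2 * a - s1 * c)) *\<^sub>R e2) (1 *\<^sub>R e1 + 0 *\<^sub>R e2) = 0"
    by (simp_all add: det2_def)
  then have t: "t1 = s1 * a + s2 * c" "t2 = s2 * a - s1 * c"
    unfolding det2_combination using assms(3) by auto
  show ?thesis
    unfolding fubini_traceless[OF assms(1)] fubini_traceless[OF assms(2)] v[symmetric] unfolding f1 f2 dc expand tr t
    by (simp add: complex_eq_iff power2_eq_square algebra_simps)
qed

lemma polarization: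
  "6 * C u v w = C (u + v + w) (u + v + w) (u + v + w) - C (u + v) (u + v) (u + v) - C (v + w) (v + w) (v + w)
     - C (u + w) (u + w) (u + w) + C u u u + C v v v + C w w w"
proof -
  have "C u w v = C u v w" "C v u w = C u v w" "C v w u = C u v w" "C w u v = C u v w" "C w v u = C u v w"
    "C u v u = C u u v" "C v u u = C u u v" "C u w u = C u u w" "C w u u = C u u w"
    "C v u v = C v v u" "C u v v = C v v u" "C v w v = C v v w" "C w v v = C v v w"
    "C w u w = C w w u" "C u w w = C w w u" "C w v w = C w w v" "C v w w = C w w v"
    using swap12 swap23 by metis+
  then show ?thesis by (simp add: expand)
qed

text \<open>With \<open>g\<close> the quadratic form \<open>hess e\<^sub>1 e\<^sub>2\<close> and \<open>\<Delta>\<close> its determinant, the basis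
  \<open>\<surd>\<Delta> e\<^sub>1\<close>, \<open>g\<^sub>1\<^sub>2 e\<^sub>1 - g\<^sub>1\<^sub>1 e\<^sub>2\<close> is orthogonal for \<open>g\<close> with vectors of equal length, and \<open>C\<close> is apolar to \<open>g\<close>.\<close>

definition g11 where "g11 = (C e\<^sub>1 e\<^sub>1 e\<^sub>2)\<^sup>2 - C e\<^sub>1 e\<^sub>1 e\<^sub>1 * C e\<^sub>1 e\<^sub>2 e\<^sub>2"
definition g12 where "g12 = (C e\<^sub>1 e\<^sub>1 e\<^sub>2 * C e\<^sub>1 e\<^sub>2 e\<^sub>2 - C e\<^sub>1 e\<^sub>1 e\<^sub>1 * C e\<^sub>2 e\<^sub>2 e\<^sub>2) / 2"
definition g22 where "g22 = (C e\<^sub>1 e\<^sub>2 e\<^sub>2)\<^sup>2 - C e\<^sub>1 e\<^sub>1 e\<^sub>2 * C e\<^sub>2 e\<^sub>2 e\<^sub>2"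
definition ortho1 where "ortho1 = sqrt (g11 * g22 - g12\<^sup>2) *\<^sub>R e\<^sub>1"
definition ortho2 where "ortho2 = g12 *\<^sub>R e\<^sub>1 - g11 *\<^sub>R e\<^sub>2"

lemma components: "C e\<^sub>1 e\<^sub>2 e\<^sub>1 = C e\<^sub>1 e\<^sub>1 e\<^sub>2" "C e\<^sub>2 e\<^sub>1 e\<^sub>1 = C e\<^sub>1 e\<^sub>1 e\<^sub>2"
    "C e\<^sub>2 e\<^sub>1 e\<^sub>2 = C e\<^sub>1 e\<^sub>2 e\<^sub>2" "C e\<^sub>2 e\<^sub>2 e\<^sub>1 = C e\<^sub>1 e\<^sub>2 e\<^sub>2"
  using swap12 swap23 by metis+

lemma hess_quadratic: "hess e\<^sub>1 e\<^sub>2 (a *\<^sub>R e\<^sub>1 + b *\<^sub>R e\<^sub>2) = g11 * a\<^sup>2 + 2 * g12 * a * b + g22 * b\<^sup>2"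
  unfolding hess_def g11_def g12_def g22_def expand components
  by (simp add: power2_eq_square field_simps)

lemma
  assumes pos: "\<And>v. v \<noteq> 0 \<Longrightarrow> hess e\<^sub>1 e\<^sub>2 v > 0"
  shows g11_pos: "g11 > 0" and disc_pos: "g11 * g22 - g12\<^sup>2 > 0"
    and det2_ortho: "det2 ortho1 ortho2 < 0" and traceless_ortho: "traceless ortho1 ortho2"
proof -
  have "e\<^sub>1 \<noteq> 0" by simp
  from pos[OF this] hess_quadratic[of 1 0] show g11: "g11 > 0" by simp
  \<comment> \<open>This vector is orthogonal to \<open>e\<^sub>1\<close> for the quadratic form,
    and its value is \<open>g11\<close> times the determinant.\<close>
  have "g12 *\<^sub>R e\<^sub>1 + (- g11) *\<^sub>R e\<^sub>2 \<noteq> 0"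
    using g11 by (auto simp: vec_eq_iff forall_2 axis_def)
  from pos[OF this] have "g11 * (g11 * g22 - g12\<^sup>2) > 0"
    unfolding hess_quadratic by (simp add: power2_eq_square algebra_simps)
  then show D: "g11 * g22 - g12\<^sup>2 > 0" using g11 by (simp add: zero_less_mult_iff)
  \<comment> \<open>The sign of \<open>ortho2\<close> was chosen for this: the Gauss map carries the
    reversed orientation.\<close>
  show "det2 ortho1 ortho2 < 0"
    using g11 D by (simp add: det2_def ortho1_def ortho2_def axis_def)
  have "g22 * C e\<^sub>1 e\<^sub>1 v - 2 * g12 * C e\<^sub>1 e\<^sub>2 v + g11 * C e\<^sub>2 e\<^sub>2 v = 0" for v
    by (subst (1 2 3) vec2_eq[of v])
      (simp add: expand components g11_def g12_def g22_def power2_eq_square field_simps)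
  then have "g11 * (g22 * C e\<^sub>1 e\<^sub>1 v - 2 * g12 * C e\<^sub>1 e\<^sub>2 v + g11 * C e\<^sub>2 e\<^sub>2 v) = 0" for v by simp
  \<comment> \<open>The sum of the symmetric squares of \<open>ortho1\<close> and
    \<open>ortho2\<close> is \<open>g11\<close> times the adjugate of the quadratic form, so the
    trace is a multiple of the apolarity expression.\<close>
  moreover have "C ortho1 ortho1 v + C ortho2 ortho2 v = g11 * (g22 * C e\<^sub>1 e\<^sub>1 v - 2 * g12 * C e\<^sub>1 e\<^sub>2 v + g11 * C e\<^sub>2 e\<^sub>2 v)" for v
  proof -
    have o2: "ortho2 = g12 *\<^sub>R e\<^sub>1 + (- g11) *\<^sub>R e\<^sub>2" by (simp add: ortho2_def)
    have "sqrt (g11 * g22 - g12\<^sup>2) * sqrt (g11 * g22 - g12\<^sup>2) = g11 * g22 - g12\<^sup>2" using D by simp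
    then have "C ortho1 ortho1 v = (g11 * g22 - g12\<^sup>2) * C e\<^sub>1 e\<^sub>1 v"
      by (simp add: ortho1_def expand mult.assoc[symmetric])
    then show ?thesis unfolding o2 expand swap12[of e\<^sub>2 e\<^sub>1] by (simp add: power2_eq_square algebra_simps)
  qed
  ultimately show "traceless ortho1 ortho2" by (simp add: traceless_def)
qed

end

lemma (in lagrangian_patch) cubic_form_cubic: "x \<in> U \<Longrightarrow> cubic_form (cubic x)"
  by (rule cubic_form.intro) (use linear_cubic cubic_swap12 cubic_swap23 in auto)

section \<open>Charts\<close>

locale oriented_surface =
  fixes M :: "'m::{t2_space, second_countable_topology} set" and A :: "'m atlas"
  assumes surface: "oriented_smooth_surface M A"
begin

lemma dom_open: "c \<in> A \<Longrightarrow> open (chart_dom c)" and img_open: "c \<in> A \<Longrightarrow> open (chart_map c ` chart_dom c)"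
  and homeo: "c \<in> A \<Longrightarrow> homeomorphism (chart_dom c) (chart_map c ` chart_dom c) (chart_map c) (chart_inv c)"
  and cover: "(\<Union>c\<in>A. chart_dom c) = M"
  and compatible: "c \<in> A \<Longrightarrow> c' \<in> A \<Longrightarrow> oriented_compatible c c'"
  using surface by (auto simp: oriented_smooth_surface_def is_chart_def)

lemma M_open: "open M"
  using cover dom_open by blast

lemma dom_subset: "c \<in> A \<Longrightarrow> chart_dom c \<subseteq> M"
  using cover by blast

lemma chart_at: "q \<in> M \<Longrightarrow> \<exists>c\<in>A. q \<in> chart_dom c"
  using cover by blast

lemma inv_map [simp]: "c \<in> A \<Longrightarrow> q \<in> chart_dom c \<Longrightarrow> chart_inv c (chart_map c q) = q"
  using homeo by (auto simp: homeomorphism_def)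

lemma inv_in_dom: "c \<in> A \<Longrightarrow> x \<in> chart_map c ` chart_dom c \<Longrightarrow> chart_inv c x \<in> chart_dom c"
  by auto

lemma map_inv: "c \<in> A \<Longrightarrow> x \<in> chart_map c ` chart_dom c \<Longrightarrow> chart_map c (chart_inv c x) = x"
  by auto

lemma image_open:
  assumes "c \<in> A" "open W"
  shows "open (chart_map c ` (chart_dom c \<inter> W))"
proof -
  have "openin (top_of_set (chart_map c ` chart_dom c)) (chart_map c ` (chart_dom c \<inter> W))"
    using homeomorphism_imp_open_map[OF homeo[OF assms(1)], of "chart_dom c \<inter> W"] assms dom_open
    by (auto simp: openin_open)
  then show ?thesis using img_open[OF assms(1)] openin_open_eq by blast
qed

lemma inv_image_open:
  assumes "c \<in> A" "open V" "V \<subseteq> chart_map c ` chart_dom c"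
  shows "open (chart_inv c ` V)"
proof -
  have "openin (top_of_set (chart_dom c)) (chart_inv c ` V)"
    using homeomorphism_imp_open_map[OF homeomorphism_symD[OF homeo[OF assms(1)]], of V] assms
    by (auto simp: openin_open)
  then show ?thesis using dom_open[OF assms(1)] openin_open_eq by blast
qed

lemma continuous_map_inv: "c \<in> A \<Longrightarrow> continuous_on (chart_map c ` chart_dom c) (chart_inv c)"
  and continuous_map: "c \<in> A \<Longrightarrow> continuous_on (chart_dom c) (chart_map c)"
  using homeo by (auto simp: homeomorphism_def)

text \<open>The Jacobian that turns components with respect to \<open>c'\<close> into components
  with respect to \<open>c\<close>.\<close>

definition trans :: "'m chart \<Rightarrow> 'm chart \<Rightarrow> 'm \<Rightarrow> real^2 \<Rightarrow> real^2" where
  "trans c' c q v = frechet_derivative (chart_map c \<circ> chart_inv c') (at (chart_map c' q)) v"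

lemma transition:
  assumes "c \<in> A" "c' \<in> A"
  shows "smooth_on (chart_map c' ` (chart_dom c' \<inter> chart_dom c)) (chart_map c \<circ> chart_inv c')"
    and "q \<in> chart_dom c \<inter> chart_dom c' \<Longrightarrow> linear (trans c' c q)"
    and "q \<in> chart_dom c \<inter> chart_dom c' \<Longrightarrow> det (matrix (trans c' c q)) > 0"
proof -
  note comp = compatible[OF assms(2,1)]
  show sm: "smooth_on (chart_map c' ` (chart_dom c' \<inter> chart_dom c)) (chart_map c \<circ> chart_inv c')"
    using comp by (simp add: oriented_compatible_def Let_def)
  assume q: "q \<in> chart_dom c \<inter> chart_dom c'"
  then have x: "chart_map c' q \<in> chart_map c' ` (chart_dom c' \<inter> chart_dom c)" by blast
  show "linear (trans c' c q)"
    using smooth_on_has_derivative[OF sm image_open[OF assms(2) dom_open[OF assms(1)]] x] has_derivative_linear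
    by (auto simp: trans_def[abs_def] eta_contract_eq)
  show "det (matrix (trans c' c q)) > 0"
    using comp x by (auto simp: oriented_compatible_def Let_def trans_def[abs_def] eta_contract_eq)
qed

lemma differential_dird: "differential F c q v = dird v (F \<circ> chart_inv c) (chart_map c q)"
  by (simp add: differential_def dird_def)

lemma
  assumes c: "c \<in> A" "c' \<in> A" and W: "open W" "W \<subseteq> chart_dom c"
    and F: "smooth_on (chart_map c ` W) (F \<circ> chart_inv c)"
  shows smooth_other_chart: "smooth_on (chart_map c' ` (chart_dom c' \<inter> W)) (F \<circ> chart_inv c')"
    and differential_other_chart: "q \<in> chart_dom c' \<inter> W \<Longrightarrow> differential F c' q v = differential F c q (trans c' c q v)"
proof -
  let ?D = "chart_map c' ` (chart_dom c' \<inter> W)" and ?h = "chart_map c \<circ> chart_inv c'"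
  have D: "open ?D" by (rule image_open[OF c(2) W(1)])
  have W': "open (chart_map c ` W)" using image_open[OF c(1) W(1)] W(2) by (simp add: Int_absorb1)
  have h: "smooth_on ?D ?h" by (rule smooth_on_subset[OF transition(1)[OF c]]) (use W in auto)
  have hD: "?h ` ?D \<subseteq> chart_map c ` W" using c by auto
  have eq: "((F \<circ> chart_inv c) \<circ> ?h) x = (F \<circ> chart_inv c') x" if "x \<in> ?D" for x
    using that c W by auto
  have sm: "smooth_on ?D ((F \<circ> chart_inv c) \<circ> ?h)"
    unfolding o_def by (rule smooth_on_compose[OF D W' hD[unfolded o_def] h[unfolded o_def] F[unfolded o_def]])
  show s': "smooth_on ?D (F \<circ> chart_inv c')"
    by (rule smooth_on_cong[OF D eq sm])
  assume q: "q \<in> chart_dom c' \<inter> W"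
  then have x: "chart_map c' q \<in> ?D" by blast
  have hx: "?h (chart_map c' q) = chart_map c q" using q c by simp
  have "frechet_derivative (F \<circ> chart_inv c') (at (chart_map c' q)) = frechet_derivative ((F \<circ> chart_inv c) \<circ> ?h) (at (chart_map c' q))"
    by (rule frechet_derivative_transform_within_open[OF _ D x])
      (use smooth_on_has_derivative[OF s' D x] differentiableI eq in auto)
  also have "\<dots> = frechet_derivative (F \<circ> chart_inv c) (at (chart_map c q)) \<circ> frechet_derivative ?h (at (chart_map c' q))"
    using smooth_on_has_derivative[OF h D x] smooth_on_has_derivative[OF F W', of "chart_map c q"] q
    by (subst frechet_derivative_compose) (auto simp: hx[unfolded o_def] intro: differentiableI)
  finally show "differential F c' q v = differential F c q (trans c' c q v)"
    by (simp add: differential_def trans_def)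
qed

lemma smooth_map_onI:
  assumes "W \<subseteq> M" "\<And>q. q \<in> W \<Longrightarrow> \<exists>c\<in>A. \<exists>V. open V \<and> q \<in> V \<and> V \<subseteq> W \<inter> chart_dom c \<and> smooth_on (chart_map c ` V) (F \<circ> chart_inv c)"
    and "open W"
  shows "smooth_map_on A W F"
  unfolding smooth_map_on_def
proof
  fix c' assume c': "c' \<in> A"
  show "smooth_on (chart_map c' ` (chart_dom c' \<inter> W)) (F \<circ> chart_inv c')"
  proof (rule smooth_on_local[OF image_open[OF c' assms(3)]])
    fix x assume "x \<in> chart_map c' ` (chart_dom c' \<inter> W)"
    then obtain q where q: "q \<in> chart_dom c'" "q \<in> W" "x = chart_map c' q" by blast
    obtain c V where V: "c \<in> A" "open V" "q \<in> V" "V \<subseteq> W \<inter> chart_dom c" "smooth_on (chart_map c ` V) (F \<circ> chart_inv c)"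
      using assms(2)[OF q(2)] by blast
    show "\<exists>V g. open V \<and> x \<in> V \<and> V \<subseteq> chart_map c' ` (chart_dom c' \<inter> W) \<and> smooth_on V g \<and> (\<forall>y\<in>V. (F \<circ> chart_inv c') y = g y)"
      by (rule exI[of _ "chart_map c' ` (chart_dom c' \<inter> V)"], rule exI[of _ "F \<circ> chart_inv c'"])
        (use V q c' in \<open>auto intro: image_open smooth_other_chart\<close>)
  qed
qed

lemma smooth_map_on_subset: "smooth_map_on A W F \<Longrightarrow> V \<subseteq> W \<Longrightarrow> smooth_map_on A V F"
  unfolding smooth_map_on_def by (blast intro: smooth_on_subset)

lemma smooth_map_on_dom:
  assumes "smooth_map_on A W F" "c \<in> A"
  shows "smooth_on (chart_map c ` (chart_dom c \<inter> W)) (F \<circ> chart_inv c)"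
  using assms unfolding smooth_map_on_def by blast

lemma smooth_map_on_M:
  assumes "smooth_map_on A M F" "c \<in> A"
  shows "smooth_on (chart_map c ` chart_dom c) (F \<circ> chart_inv c)"
  using smooth_map_on_dom[OF assms] dom_subset[OF assms(2)] by (simp add: Int_absorb2)

lemma differential_change:
  assumes "smooth_map_on A W F" "open W" "c \<in> A" "c' \<in> A" "q \<in> W" "q \<in> chart_dom c" "q \<in> chart_dom c'"
  shows "differential F c' q v = differential F c q (trans c' c q v)"
  by (rule differential_other_chart[OF assms(3,4) open_Int[OF dom_open[OF assms(3)] assms(2)] _ smooth_map_on_dom[OF assms(1,3)]])
    (use assms in blast)+

end

section \<open>Frames and the Fubini form\<close>

context oriented_surface
begin

abbreviation img :: "'m chart \<Rightarrow> (real^2) set" where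
  "img c \<equiv> chart_map c ` chart_dom c"

abbreviation loc :: "('m \<Rightarrow> 'b) \<Rightarrow> 'm chart \<Rightarrow> real^2 \<Rightarrow> 'b" where
  "loc F c \<equiv> F \<circ> chart_inv c"

abbreviation cub :: "('m \<Rightarrow> real^4) \<Rightarrow> 'm chart \<Rightarrow> 'm \<Rightarrow> real^2 \<Rightarrow> real^2 \<Rightarrow> real^2 \<Rightarrow> real" where
  "cub f c q \<equiv> lagrangian_patch.cubic (loc f c) (chart_map c q)"

lemma lagrangian_patch_chart:
  assumes "lagrangian_immersion M A f" "c \<in> A"
  shows "lagrangian_patch (img c) (loc f c)"
proof
  show "open (img c)" by (rule img_open[OF assms(2)])
  show "smooth_on (img c) (loc f c)"
    by (rule smooth_map_on_M[OF _ assms(2)]) (use assms(1) in \<open>simp add: lagrangian_immersion_def\<close>)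
  show "Omega (dird u (loc f c) x) (dird v (loc f c) x) = 0" if "x \<in> img c" for x u v
    using that assms unfolding lagrangian_immersion_def differential_dird by blast
qed

lemma linear_differential:
  assumes "lagrangian_immersion M A f" "c \<in> A" "q \<in> chart_dom c"
  shows "linear (differential f c q)"
proof -
  interpret p: lagrangian_patch "img c" "loc f c" by (rule lagrangian_patch_chart[OF assms(1,2)])
  have "linear (\<lambda>v. dird v (loc f c) (chart_map c q))"
    by (rule linear_dird[OF p.smooth p.U]) (use assms(3) in blast)
  then show ?thesis by (simp add: differential_dird[abs_def])
qed

lemma cubic_form_cub:
  assumes "lagrangian_immersion M A f" "c \<in> A" "q \<in> chart_dom c"
  shows "cubic_form (cub f c q)"
  by (rule lagrangian_patch.cubic_form_cubic[OF lagrangian_patch_chart[OF assms(1,2)]]) (use assms(3) in blast)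

text \<open>Transition maps have positive Jacobian, so the sign of \<open>det2\<close> does not
  depend on the chart and one chart already yields every oriented basis.\<close>

lemma gauss_map_chart:
  assumes "lagrangian_immersion M A f" "c \<in> A" "q \<in> chart_dom c"
  shows "gauss_map A f q = {(differential f c q v, differential f c q w) | v w. det2 v w < 0}"
proof (intro set_eqI iffI)
  fix z assume "z \<in> gauss_map A f q"
  then obtain c' v w where c': "c' \<in> A" "q \<in> chart_dom c'" and z: "z = (differential f c' q v, differential f c' q w)" "det2 v w < 0"
    unfolding gauss_map_def det2_def by blast
  have f: "smooth_map_on A M f" using assms(1) by (simp add: lagrangian_immersion_def)
  have q: "q \<in> M" using c' dom_subset by blast
  have "det2 (trans c' c q v) (trans c' c q w) < 0"
    using transition(2,3)[OF assms(2) c'(1), of q] assms(3) c'(2) z(2) by (simp add: det2_linear mult_pos_neg)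
  then show "z \<in> {(differential f c q v, differential f c q w) | v w. det2 v w < 0}"
    using z(1) differential_change[OF f M_open assms(2) c'(1) q assms(3) c'(2)] by auto
next
  fix z assume "z \<in> {(differential f c q v, differential f c q w) | v w. det2 v w < 0}"
  then show "z \<in> gauss_map A f q" unfolding gauss_map_def det2_def using assms(2,3) by blast
qed

lemma gauss_map_oriented_plane:
  assumes f: "lagrangian_immersion M A f" "c \<in> A" "q \<in> chart_dom c" and e: "det2 e1 e2 < 0"
  shows "gauss_map A f q = oriented_plane (differential f c q e1) (differential f c q e2)"
proof -
  note lin = linear_differential[OF f]
  show ?thesis unfolding gauss_map_chart[OF f]
  proof (intro set_eqI iffI)
    fix z assume "z \<in> {(differential f c q v, differential f c q w) | v w. det2 v w < 0}"
    then obtain v w where z: "z = (differential f c q v, differential f c q w)" "det2 v w < 0" by blast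
    obtain r s where v: "v = r *\<^sub>R e1 + s *\<^sub>R e2" using det2_basis e by (metis less_irrefl)
    obtain r' s' where w: "w = r' *\<^sub>R e1 + s' *\<^sub>R e2" using det2_basis e by (metis less_irrefl)
    have "0 < r * s' - s * r'" using z(2) e by (simp add: v w det2_combination mult_less_0_iff)
    then show "z \<in> oriented_plane (differential f c q e1) (differential f c q e2)"
      unfolding oriented_plane_def z v w by (auto simp: linear_add[OF lin] linear_cmul[OF lin])
  next
    fix z assume "z \<in> oriented_plane (differential f c q e1) (differential f c q e2)"
    then obtain r s r' s' where z: "z = (differential f c q (r *\<^sub>R e1 + s *\<^sub>R e2), differential f c q (r' *\<^sub>R e1 + s' *\<^sub>R e2))"
      and "0 < r * s' - s * r'"
      unfolding oriented_plane_def by (auto simp: linear_add[OF lin] linear_cmul[OF lin])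
    then have "det2 (r *\<^sub>R e1 + s *\<^sub>R e2) (r' *\<^sub>R e1 + s' *\<^sub>R e2) < 0"
      using e by (simp add: det2_combination mult_pos_neg)
    then show "z \<in> {(differential f c q v, differential f c q w) | v w. det2 v w < 0}" unfolding z by blast
  qed
qed

text \<open>The two columns belong to the oriented plane they span, hence to the Gauss image, whose
  members are images of negatively oriented coordinate bases.\<close>

lemma first_order_basis:
  assumes "lagrangian_immersion M A f" "first_order_frame M A f W X" "c \<in> A" "q \<in> W" "q \<in> chart_dom c"
  obtains e1 e2 where "det2 e1 e2 < 0" "column 1 (X q) = differential f c q e1" "column 2 (X q) = differential f c q e2"
proof -
  have "(column 1 (X q), column 2 (X q)) \<in> oriented_plane (column 1 (X q)) (column 2 (X q))"
    unfolding oriented_plane_def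
    by (rule CollectI, rule exI[of _ 1], rule exI[of _ 0], rule exI[of _ 0], rule exI[of _ 1]) simp
  then have "(column 1 (X q), column 2 (X q)) \<in> {(differential f c q v, differential f c q w) | v w. det2 v w < 0}"
    using assms(2,4) gauss_map_chart[OF assms(1,3,5)] by (simp add: first_order_frame_def)
  then show ?thesis using that by blast
qed

lemma frame_smooth:
  assumes "first_order_frame M A f W X"
  shows "smooth_map_on A W X" "open W" "W \<subseteq> M" "q \<in> W \<Longrightarrow> X q \<in> Sp4"
proof -
  have sf: "symplectic_frame M A f W X" using assms by (simp add: first_order_frame_def)
  then show W: "open W" "W \<subseteq> M" "q \<in> W \<Longrightarrow> X q \<in> Sp4" by (auto simp: symplectic_frame_def affine_Sp4_def)
  show "smooth_map_on A W X" unfolding smooth_map_on_def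
  proof
    fix c assume c: "c \<in> A"
    then have "smooth_on (chart_map c ` (chart_dom c \<inter> W)) ((\<lambda>q. (f q, X q)) \<circ> chart_inv c)"
      using sf unfolding symplectic_frame_def smooth_map_on_def by blast
    from smooth_on_snd[OF image_open[OF c W(1)] this] show "smooth_on (chart_map c ` (chart_dom c \<inter> W)) (loc X c)" by (simp add: o_def)
  qed
qed

section \<open>Gamma in terms of the cubic form\<close>

text \<open>Column \<open>b\<close> stays tangent along the frame, so it is Omega-orthogonal to the
  derivative of \<open>f\<close> in the fixed direction \<open>ea\<close>. Differentiating this
  relation moves the derivative from the frame onto \<open>f\<close>; how the columns vary within
  the tangent planes does not matter.\<close>

lemma second_fundamental_form:
  assumes f: "lagrangian_immersion M A f" "first_order_frame M A f W X" "c \<in> A" "q \<in> W" "q \<in> chart_dom c"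
    and b: "b = 1 \<or> b = 2" "column b (X q) = differential f c q eb" and a: "column a (X q) = differential f c q ea"
  shows "Omega (column a (X q)) (column b (differential X c q v)) = cub f c q ea eb v"
proof -
  interpret p: lagrangian_patch "img c" "loc f c" by (rule lagrangian_patch_chart[OF f(1,3)])
  let ?a = "loc f c" and ?x = "chart_map c q" and ?D = "chart_map c ` (chart_dom c \<inter> W)"
  let ?b = "\<lambda>x. (loc X c) x *v axis b 1"
  note fr = frame_smooth[OF f(2)]
  have x: "?x \<in> img c" "?x \<in> ?D" using f by auto
  have D: "open ?D" by (rule image_open[OF f(3) fr(2)])
  have smX: "smooth_on ?D (loc X c)" by (rule smooth_map_on_dom[OF fr(1) f(3)])
  have smb: "smooth_on ?D ?b" by (intro smooth_on_matrix_vector_mult D smX smooth_on_const)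
  have sma: "smooth_on ?D (dird ea ?a)" by (rule smooth_on_subset[OF smooth_on_dird[OF p.smooth]]) blast
  have "Omega (?b y) (dird ea ?a y) = 0" if y: "y \<in> ?D" for y
  proof -
    obtain q' where q': "q' \<in> chart_dom c" "q' \<in> W" "y = chart_map c q'" using y by blast
    obtain e1 e2 where e: "column 1 (X q') = differential f c q' e1" "column 2 (X q') = differential f c q' e2"
      using first_order_basis[OF f(1,2,3) q'(2,1)] by metis
    have "Omega (differential f c q' u) (differential f c q' ea) = 0" for u
      unfolding differential_dird by (rule p.lagrangian) (use q' in blast)
    then have "Omega (column b (X q')) (differential f c q' ea) = 0" using b(1) e by auto
    then show ?thesis using q' f(3) by (simp add: matrix_vector_mult_basis differential_dird)
  qed
  then have "dird v (\<lambda>y. Omega (?b y) (dird ea ?a y)) ?x = dird v (\<lambda>y. 0) ?x"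
    by (intro dird_cong[OF D x(2)] smooth_on_Omega D smb sma)
  then have "Omega (?b ?x) (dird v (dird ea ?a) ?x) + Omega (dird v ?b ?x) (dird ea ?a ?x) = 0"
    by (subst (asm) dird_bilinear[OF bounded_bilinear_Omega smb sma D x(2)]) simp
  moreover have "dird v ?b ?x = column b (differential X c q v)"
    unfolding differential_dird
    by (subst dird_bounded_linear[OF mvec.bounded_linear_left smX D x(2)])
      (rule matrix_vector_mult_basis)
  moreover have "?b ?x = differential f c q eb" using f b(2) by (simp add: matrix_vector_mult_basis)
  ultimately have "Omega (dird ea ?a ?x) (column b (differential X c q v)) = p.cubic ?x ea v eb"
    using Omega_commute[of "dird ea ?a ?x"] by (simp add: p.cubic_def differential_dird)
  then show ?thesis using p.cubic_swap23[OF x(1)] a by (simp add: differential_dird)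
qed

lemma theta_entries:
  assumes "X q \<in> Sp4"
  shows "theta_form X c q v $ 3 $ j = Omega (column 1 (X q)) (column j (differential X c q v))"
    "theta_form X c q v $ 4 $ j = Omega (column 2 (X q)) (column j (differential X c q v))"
proof -
  have "theta_form X c q v $ i $ j = (symp_inv (X q) *v column j (differential X c q v)) $ i" for i
    by (simp add: theta_form_def matrix_inv_Sp4[OF assms] matrix_matrix_mult_def matrix_vector_mult_def column_def)
  then show "theta_form X c q v $ 3 $ j = Omega (column 1 (X q)) (column j (differential X c q v))"
    "theta_form X c q v $ 4 $ j = Omega (column 2 (X q)) (column j (differential X c q v))"
    by (simp_all add: symp_inv_nth)
qed

lemma gamma_eq:
  assumes f: "lagrangian_immersion M A f" "first_order_frame M A f W X" "c \<in> A" "q \<in> W" "q \<in> chart_dom c"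
    and e: "column 1 (X q) = differential f c q e1" "column 2 (X q) = differential f c q e2"
  shows "gamma11 X c q v = cub f c q e1 e1 v" "gamma21 X c q v = cub f c q e1 e2 v" "gamma22 X c q v = cub f c q e2 e2 v"
proof -
  interpret C: cubic_form "cub f c q" by (rule cubic_form_cub[OF f(1,3,5)])
  note sf = second_fundamental_form[OF f]
  show "gamma11 X c q v = cub f c q e1 e1 v" "gamma21 X c q v = cub f c q e1 e2 v" "gamma22 X c q v = cub f c q e2 e2 v"
    unfolding gamma11_def gamma21_def gamma22_def theta_entries[of X q, OF frame_smooth(4)[OF f(2,4)]]
    using sf[of 1, OF _ e(1) e(1)] sf[of 1, OF _ e(1) e(2)] sf[of 2, OF _ e(2) e(2)] C.swap12 by auto
qed

lemma gamma_change:
  assumes "first_order_frame M A f W X" "c \<in> A" "c' \<in> A" "q \<in> W" "q \<in> chart_dom c" "q \<in> chart_dom c'"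
  shows "gamma11 X c' q v = gamma11 X c q (trans c' c q v)" "gamma22 X c' q v = gamma22 X c q (trans c' c q v)"
  using differential_change[OF frame_smooth(1,2)[OF assms(1)] assms(2,3,4,5,6), of v]
  by (simp_all add: gamma11_def gamma22_def theta_form_def)

text \<open>For an \<open>f\<close> that is only Lagrangian, second derivatives cannot serve as a
  complement as in \<open>elliptic_patch.frame\<close>. The images of the tangent vectors under
  \<open>- J4\<close> can: Omega pairs them by the Euclidean product, so \<open>dual_det\<close> is
  a Gram determinant.\<close>

lemma ex_first_order_frame:
  assumes f: "lagrangian_immersion M A f" "c \<in> A" "q \<in> chart_dom c"
    and e: "smooth_on (img c) e1" "smooth_on (img c) e2" "\<And>x. x \<in> img c \<Longrightarrow> det2 (e1 x) (e2 x) < 0"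
  obtains W X where "first_order_frame M A f W X" "q \<in> W" "W \<subseteq> chart_dom c"
    "\<And>q'. q' \<in> W \<Longrightarrow> column 1 (X q') = differential f c q' (e1 (chart_map c q'))"
    "\<And>q'. q' \<in> W \<Longrightarrow> column 2 (X q') = differential f c q' (e2 (chart_map c q'))"
proof -
  interpret p: lagrangian_patch "img c" "loc f c" by (rule lagrangian_patch_chart[OF f(1,2)])
  let ?a = "loc f c"
  define X1 X2 where "X1 x = dird (e1 x) ?a x" and "X2 x = dird (e2 x) ?a x" for x
  define Xl where "Xl x = completion (X1 x) (X2 x) (- (J4 *v X1 x)) (- (J4 *v X2 x))" for x
  have sm: "smooth_on (img c) (\<lambda>x. dird (e x) ?a x)" if "smooth_on (img c) e" for e
  proof (rule smooth_on_cong[OF p.U])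
    show "smooth_on (img c) (\<lambda>x. e x $ 1 *\<^sub>R dird e\<^sub>1 ?a x + e x $ 2 *\<^sub>R dird e\<^sub>2 ?a x)"
      by (intro smooth_on_add smooth_on_scaleR smooth_on_vec_nth that p.U smooth_on_dird p.smooth)
    show "e x $ 1 *\<^sub>R dird e\<^sub>1 ?a x + e x $ 2 *\<^sub>R dird e\<^sub>2 ?a x = dird (e x) ?a x" if "x \<in> img c" for x
      using linear_vec2[OF linear_dird[OF p.smooth p.U that], of "e x"] by simp
  qed
  have sm12: "smooth_on (img c) X1" "smooth_on (img c) X2" unfolding X1_def[abs_def] X2_def[abs_def] by (intro sm e)+
  have OJ: "Omega Y (- (J4 *v Z)) = Y \<bullet> Z" for Y Z
    by (simp add: Omega_eq J4_mult vector_4 inner_vec_def sum_4)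
  have nz: "dual_det (X1 x) (X2 x) (- (J4 *v X1 x)) (- (J4 *v X2 x)) \<noteq> 0" if x: "x \<in> img c" for x
  proof
    assume "dual_det (X1 x) (X2 x) (- (J4 *v X1 x)) (- (J4 *v X2 x)) = 0"
    then have z: "(X1 x \<bullet> X1 x) * (X2 x \<bullet> X2 x) - (X1 x \<bullet> X2 x) * (X1 x \<bullet> X2 x) = 0"
      unfolding dual_det_def OJ by (simp add: inner_commute)
    \<comment> \<open>A multiple of the part of \<open>X2 x\<close> perpendicular to
      \<open>X1 x\<close>; its squared length is the squared length of \<open>X1 x\<close> times the
      Gram determinant.\<close>
    let ?Z = "(X1 x \<bullet> X1 x) *\<^sub>R X2 x - (X1 x \<bullet> X2 x) *\<^sub>R X1 x"
    have "?Z \<bullet> ?Z = (X1 x \<bullet> X1 x) * ((X1 x \<bullet> X1 x) * (X2 x \<bullet> X2 x) - (X1 x \<bullet> X2 x) * (X1 x \<bullet> X2 x))"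
      by (simp add: inner_diff_left inner_diff_right inner_commute algebra_simps)
    then have "?Z = 0" unfolding z by simp
    note lin = linear_dird[OF p.smooth p.U x]
    obtain q' where q': "q' \<in> chart_dom c" "x = chart_map c q'" using x by blast
    have inj: "v = 0" if "dird v ?a x = 0" for v
    proof -
      have "inj (differential f c q')" using f(1,2) q' by (auto simp: lagrangian_immersion_def)
      moreover have "differential f c q' v = differential f c q' 0"
        using that linear_0[OF lin] by (simp add: differential_dird q'(2))
      ultimately show ?thesis by (rule injD)
    qed
    have "dird ((X1 x \<bullet> X1 x) *\<^sub>R e2 x - (X1 x \<bullet> X2 x) *\<^sub>R e1 x) ?a x = 0"
      using \<open>?Z = 0\<close> by (simp add: linear_diff[OF lin] linear_cmul[OF lin] X1_def X2_def)
    then have v0: "(X1 x \<bullet> X1 x) *\<^sub>R e2 x - (X1 x \<bullet> X2 x) *\<^sub>R e1 x = 0" by (rule inj)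
    have "det2 (1 *\<^sub>R e1 x + 0 *\<^sub>R e2 x) ((- (X1 x \<bullet> X2 x)) *\<^sub>R e1 x + (X1 x \<bullet> X1 x) *\<^sub>R e2 x) = 0"
      using v0 by (simp add: det2_def vec_eq_iff forall_2 algebra_simps)
    then have "X1 x \<bullet> X1 x = 0" unfolding det2_combination using e(3)[OF x] by simp
    then have "e1 x = 0" using inj by (simp add: X1_def)
    then show False using e(3)[OF x] by (simp add: det2_def)
  qed
  have l12: "Omega (X1 x) (X2 x) = 0" if "x \<in> img c" for x unfolding X1_def X2_def by (rule p.lagrangian[OF that])
  have XS: "Xl x \<in> Sp4" if "x \<in> img c" for x
    unfolding Xl_def by (rule completion_Sp4[OF l12[OF that] nz[OF that]])
  have smXl: "smooth_on (img c) Xl"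
    unfolding Xl_def[abs_def]
    by (intro smooth_on_completion p.U sm12 smooth_on_minus smooth_on_matrix_vector_mult smooth_on_const nz)
  define X where "X q' = Xl (chart_map c q')" for q'
  have "chart_map c q \<in> img c" using f(3) by blast
  then obtain r where r: "r > 0" "ball (chart_map c q) r \<subseteq> img c"
    using p.U unfolding open_contains_ball by blast
  \<comment> \<open>A ball, since the domain of a symplectic frame has to be connected.\<close>
  define W where "W = chart_inv c ` ball (chart_map c q) r"
  have Wd: "W \<subseteq> chart_dom c" using r(2) inv_in_dom[OF f(2)] unfolding W_def by blast
  have Wo: "open W" unfolding W_def by (rule inv_image_open[OF f(2) open_ball r(2)])
  have Wc: "connected W" unfolding W_def
    by (rule connected_continuous_image[OF continuous_on_subset[OF continuous_map_inv[OF f(2)] r(2)]]) simp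
  have qW: "q \<in> W" unfolding W_def using r(1) f by (auto intro!: image_eqI[of _ _ "chart_map c q"])
  have cols: "column 1 (X q') = differential f c q' (e1 (chart_map c q'))"
    "column 2 (X q') = differential f c q' (e2 (chart_map c q'))" for q'
    by (simp_all add: X_def Xl_def completion_def X1_def X2_def differential_dird)
  show ?thesis
  proof (rule that[OF _ qW Wd cols])
    have WM: "W \<subseteq> M" using Wd dom_subset[OF f(2)] by blast
    have "smooth_map_on A W (\<lambda>q. (f q, X q))"
    proof (rule smooth_map_onI[OF WM _ Wo])
      fix q' assume "q' \<in> W"
      moreover have "smooth_on (chart_map c ` W) ((\<lambda>q. (f q, X q)) \<circ> chart_inv c)"
      proof (rule smooth_on_cong)
        show o: "open (chart_map c ` W)" using image_open[OF f(2) Wo] Wd by (simp add: Int_absorb1)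
        have "chart_map c ` W \<subseteq> img c" using Wd by blast
        then show "smooth_on (chart_map c ` W) (\<lambda>x. (?a x, Xl x))"
          by (intro smooth_on_Pair o smooth_on_subset[OF p.smooth] smooth_on_subset[OF smXl])
        show "(?a x, Xl x) = ((\<lambda>q. (f q, X q)) \<circ> chart_inv c) x" if "x \<in> chart_map c ` W" for x
          using that Wd f(2) by (auto simp: X_def)
      qed
      ultimately show "\<exists>c\<in>A. \<exists>V. open V \<and> q' \<in> V \<and> V \<subseteq> W \<inter> chart_dom c \<and> smooth_on (chart_map c ` V) ((\<lambda>q. (f q, X q)) \<circ> chart_inv c)"
        using f(2) Wo Wd by blast
    qed
    moreover have "X q' \<in> Sp4" if "q' \<in> W" for q' unfolding X_def using XS Wd that by blast
    ultimately have "symplectic_frame M A f W X"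
      using WM Wo Wc by (simp add: symplectic_frame_def affine_Sp4_def)
    moreover have "gauss_map A f q' = oriented_plane (column 1 (X q')) (column 2 (X q'))" if "q' \<in> W" for q'
      unfolding cols using that Wd by (intro gauss_map_oriented_plane f e(3)) auto
    ultimately show "first_order_frame M A f W X" by (simp add: first_order_frame_def)
  qed
qed

lemma elliptic_patch_chart:
  assumes "elliptic_lagrangian_immersion M A f" "c \<in> A"
  shows "elliptic_patch (img c) (loc f c)"
proof -
  have f: "lagrangian_immersion M A f" using assms(1) by (simp add: elliptic_lagrangian_immersion_def)
  interpret p: lagrangian_patch "img c" "loc f c" by (rule lagrangian_patch_chart[OF f assms(2)])
  show ?thesis
  proof
    fix x v :: "real^2" assume x: "x \<in> img c" and v: "v \<noteq> 0"
    then obtain q where q: "q \<in> chart_dom c" "x = chart_map c q" by blast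
    interpret C: cubic_form "cub f c q" by (rule cubic_form_cub[OF f assms(2) q(1)])
    \<comment> \<open>The constant basis \<open>e\<^sub>1\<close>, \<open>- e\<^sub>2\<close> has
      the orientation required by the Gauss map; the sign disappears from \<open>hess\<close>, which
      changes by the square of the determinant.\<close>
    obtain W X where X: "first_order_frame M A f W X" "q \<in> W" "W \<subseteq> chart_dom c"
      "\<And>q'. q' \<in> W \<Longrightarrow> column 1 (X q') = differential f c q' e\<^sub>1"
      "\<And>q'. q' \<in> W \<Longrightarrow> column 2 (X q') = differential f c q' (- e\<^sub>2)"
      by (rule ex_first_order_frame[OF f assms(2) q(1) smooth_on_const smooth_on_const, OF p.U p.U])
        (auto simp: det2_def axis_def)
    have "0 < - gamma11 X c q v * gamma22 X c q v + (gamma21 X c q v)\<^sup>2"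
      using assms X(1,2) q(1) v unfolding elliptic_lagrangian_immersion_def by blast
    then have "C.hess e\<^sub>1 (- e\<^sub>2) v > 0"
      by (simp add: gamma_eq[OF f X(1) assms(2) X(2) q(1) X(4,5)[OF X(2)]] C.hess_def)
    moreover have "C.hess e\<^sub>1 (- e\<^sub>2) v = C.hess e\<^sub>1 e\<^sub>2 v"
      using C.hess_change[of 1 e\<^sub>1 0 e\<^sub>2 0 "-1" v] by simp
    ultimately show "(p.cubic x e\<^sub>1 e\<^sub>2 v)\<^sup>2 - p.cubic x e\<^sub>1 e\<^sub>1 v * p.cubic x e\<^sub>2 e\<^sub>2 v > 0"
      by (simp add: C.hess_def q(2))
  qed
qed

lemma elliptic_if_patches:
  assumes f: "lagrangian_immersion M A f" and ell: "\<And>c. c \<in> A \<Longrightarrow> elliptic_patch (img c) (loc f c)"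
  shows "elliptic_lagrangian_immersion M A f"
  unfolding elliptic_lagrangian_immersion_def
proof (intro conjI allI impI ballI f)
  fix W X c q and v :: "real^2"
  assume X: "first_order_frame M A f W X" and c: "c \<in> A" and q: "q \<in> W \<inter> chart_dom c" and v: "v \<noteq> 0"
  interpret p: elliptic_patch "img c" "loc f c" by (rule ell[OF c])
  have q': "q \<in> W" "q \<in> chart_dom c" using q by auto
  interpret C: cubic_form "cub f c q" by (rule cubic_form_cub[OF f c q'(2)])
  obtain e1 e2 where e: "det2 e1 e2 < 0" "column 1 (X q) = differential f c q e1" "column 2 (X q) = differential f c q e2"
    by (rule first_order_basis[OF f X c q'])
  have "C.hess e\<^sub>1 e\<^sub>2 v > 0" unfolding C.hess_def by (rule p.hessian_pos[OF _ v]) (use q' in blast)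
  then have "C.hess e1 e2 v > 0" using e(1) by (subst C.hess_basis) (auto intro!: mult_pos_pos)
  then show "0 < - gamma11 X c q v * gamma22 X c q v + (gamma21 X c q v)\<^sup>2"
    by (simp add: gamma_eq[OF f X c q' e(2,3)] C.hess_def)
qed

lemma hess_cub_pos:
  assumes "elliptic_lagrangian_immersion M A f" "c \<in> A" "q \<in> chart_dom c" "v \<noteq> 0"
  shows "cubic_form.hess (cub f c q) e\<^sub>1 e\<^sub>2 v > 0"
proof -
  have f: "lagrangian_immersion M A f" using assms(1) by (simp add: elliptic_lagrangian_immersion_def)
  interpret p: elliptic_patch "img c" "loc f c" by (rule elliptic_patch_chart[OF assms(1,2)])
  interpret C: cubic_form "cub f c q" by (rule cubic_form_cub[OF f assms(2,3)])
  show ?thesis unfolding C.hess_def by (rule p.hessian_pos[OF _ assms(4)]) (use assms in blast)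
qed

text \<open>The basis \<open>ortho1\<close>, \<open>ortho2\<close> of the cubic form at each point
  is traceless and negatively oriented, and varies smoothly because the discriminant under the root
  is positive.\<close>

lemma ex_second_order_frame:
  assumes "elliptic_lagrangian_immersion M A f" "c \<in> A" "q \<in> chart_dom c"
  obtains W X where "second_order_frame M A f W X" "q \<in> W"
proof -
  have f: "lagrangian_immersion M A f" using assms(1) by (simp add: elliptic_lagrangian_immersion_def)
  interpret p: elliptic_patch "img c" "loc f c" by (rule elliptic_patch_chart[OF assms(1,2)])
  define o1 o2 where "o1 x = cubic_form.ortho1 (p.cubic x)" and "o2 x = cubic_form.ortho2 (p.cubic x)" for x
  note cf = p.cubic_form_cubic
  have pos: "cubic_form.hess (p.cubic x) e\<^sub>1 e\<^sub>2 v > 0" if "x \<in> img c" "v \<noteq> 0" for x v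
    using p.hessian_pos[OF that] by (simp add: cubic_form.hess_def[OF cf[OF that(1)]])
  have "smooth_on (img c) o1"
  proof (rule smooth_on_cong[OF p.U])
    let ?C = p.cubic
    let ?g11 = "\<lambda>x. ?C x e\<^sub>1 e\<^sub>1 e\<^sub>2 * ?C x e\<^sub>1 e\<^sub>1 e\<^sub>2 - ?C x e\<^sub>1 e\<^sub>1 e\<^sub>1 * ?C x e\<^sub>1 e\<^sub>2 e\<^sub>2"
    let ?g12 = "\<lambda>x. (?C x e\<^sub>1 e\<^sub>1 e\<^sub>2 * ?C x e\<^sub>1 e\<^sub>2 e\<^sub>2 - ?C x e\<^sub>1 e\<^sub>1 e\<^sub>1 * ?C x e\<^sub>2 e\<^sub>2 e\<^sub>2) * (1 / 2)"
    let ?g22 = "\<lambda>x. ?C x e\<^sub>1 e\<^sub>2 e\<^sub>2 * ?C x e\<^sub>1 e\<^sub>2 e\<^sub>2 - ?C x e\<^sub>1 e\<^sub>1 e\<^sub>2 * ?C x e\<^sub>2 e\<^sub>2 e\<^sub>2"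
    have g: "cubic_form.g11 (?C x) = ?g11 x" "cubic_form.g12 (?C x) = ?g12 x" "cubic_form.g22 (?C x) = ?g22 x" if "x \<in> img c" for x
      using cf[OF that] by (simp_all add: cubic_form.g11_def cubic_form.g12_def cubic_form.g22_def power2_eq_square)
    have D: "?g11 x * ?g22 x - ?g12 x * ?g12 x > 0" if "x \<in> img c" for x
      using cubic_form.disc_pos[OF cf[OF that] pos[OF that]] unfolding g[OF that] power2_eq_square by simp
    have sg: "smooth_on (img c) ?g11" "smooth_on (img c) ?g12" "smooth_on (img c) ?g22"
      by (intro smooth_on_diff smooth_on_mult smooth_on_const p.smooth_on_cubic p.U)+
    show "smooth_on (img c) (\<lambda>x. sqrt (?g11 x * ?g22 x - ?g12 x * ?g12 x) *\<^sub>R e\<^sub>1)"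
      by (intro smooth_on_scaleR smooth_on_sqrt smooth_on_const smooth_on_diff smooth_on_mult sg p.U D)
    show "sqrt (?g11 x * ?g22 x - ?g12 x * ?g12 x) *\<^sub>R e\<^sub>1 = o1 x" if "x \<in> img c" for x
      unfolding o1_def cubic_form.ortho1_def[OF cf[OF that]] g[OF that] power2_eq_square ..
  qed
  have "smooth_on (img c) o2"
  proof (rule smooth_on_cong[OF p.U])
    let ?C = p.cubic
    let ?g11 = "\<lambda>x. ?C x e\<^sub>1 e\<^sub>1 e\<^sub>2 * ?C x e\<^sub>1 e\<^sub>1 e\<^sub>2 - ?C x e\<^sub>1 e\<^sub>1 e\<^sub>1 * ?C x e\<^sub>1 e\<^sub>2 e\<^sub>2"
    let ?g12 = "\<lambda>x. (?C x e\<^sub>1 e\<^sub>1 e\<^sub>2 * ?C x e\<^sub>1 e\<^sub>2 e\<^sub>2 - ?C x e\<^sub>1 e\<^sub>1 e\<^sub>1 * ?C x e\<^sub>2 e\<^sub>2 e\<^sub>2) * (1 / 2)"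
    show "smooth_on (img c) (\<lambda>x. ?g12 x *\<^sub>R e\<^sub>1 - ?g11 x *\<^sub>R e\<^sub>2)"
      by (intro smooth_on_diff smooth_on_scaleR smooth_on_mult smooth_on_const p.smooth_on_cubic p.U)
    show "?g12 x *\<^sub>R e\<^sub>1 - ?g11 x *\<^sub>R e\<^sub>2 = o2 x" if "x \<in> img c" for x
      unfolding o2_def cubic_form.ortho2_def[OF cf[OF that]] cubic_form.g11_def[OF cf[OF that]] cubic_form.g12_def[OF cf[OF that]]
      by (simp add: power2_eq_square)
  qed
  have det: "det2 (o1 x) (o2 x) < 0" if "x \<in> img c" for x
    unfolding o1_def o2_def by (rule cubic_form.det2_ortho[OF cf[OF that] pos[OF that]])
  obtain W X where X: "first_order_frame M A f W X" "q \<in> W" "W \<subseteq> chart_dom c"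
      "\<And>q'. q' \<in> W \<Longrightarrow> column 1 (X q') = differential f c q' (o1 (chart_map c q'))"
      "\<And>q'. q' \<in> W \<Longrightarrow> column 2 (X q') = differential f c q' (o2 (chart_map c q'))"
    by (rule ex_first_order_frame[OF f assms(2,3) \<open>smooth_on (img c) o1\<close> \<open>smooth_on (img c) o2\<close> det]) (assumption, rule that, blast+)
  have "gamma11 X c' q' v + gamma22 X c' q' v = 0" if c': "c' \<in> A" "q' \<in> W \<inter> chart_dom c'" for c' q' v
  proof -
    have q': "q' \<in> W" "q' \<in> chart_dom c" "q' \<in> chart_dom c'" using c' X(3) by auto
    have "chart_map c q' \<in> img c" using q' by blast
    then have "cubic_form.traceless (cub f c q') (o1 (chart_map c q')) (o2 (chart_map c q'))"
      unfolding o1_def o2_def by (intro cubic_form.traceless_ortho cf pos)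
    then show ?thesis
      unfolding gamma_change[OF X(1) assms(2) c'(1) q'] gamma_eq[OF f X(1) assms(2) q'(1,2) X(4,5)[OF q'(1)]]
      using cubic_form.traceless_def[OF cubic_form_cub[OF f assms(2) q'(2)]] by blast
  qed
  then have "second_order_frame M A f W X" using X(1) unfolding second_order_frame_def by blast
  then show ?thesis using that X(2) by blast
qed

text \<open>Any negatively oriented traceless basis of a single tangent space may be used to
  evaluate the form: \<open>fubini_unique\<close> compares it with the basis coming from a frame
  around the point.\<close>

lemma fubini_form_eq:
  assumes ell: "elliptic_lagrangian_immersion M A f" and c: "c \<in> A" "q \<in> chart_dom c"
    and e: "det2 e1 e2 < 0" "cubic_form.traceless (cub f c q) e1 e2" and v: "v = t1 *\<^sub>R e1 + t2 *\<^sub>R e2"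
  shows "fubini_form M A f c q v = cubic_form.fubini (cub f c q) e1 e2 t1 t2"
proof -
  have f: "lagrangian_immersion M A f" using ell by (simp add: elliptic_lagrangian_immersion_def)
  interpret C: cubic_form "cub f c q" by (rule cubic_form_cub[OF f c])
  \<comment> \<open>For a traceless basis the Hessian at \<open>e1\<close> is the sum of the squares
    of these two components, and ellipticity makes it positive.\<close>
  have nz: "cub f c q e1 e1 e1 \<noteq> 0 \<or> cub f c q e1 e1 e2 \<noteq> 0"
  proof -
    have "e1 \<noteq> 0" using e(1) by (auto simp: det2_def)
    then have "C.hess e\<^sub>1 e\<^sub>2 e1 > 0" by (rule hess_cub_pos[OF ell c])
    then have "C.hess e1 e2 e1 > 0" using e(1) by (subst C.hess_basis) (auto intro!: mult_pos_pos)
    then show ?thesis by (auto simp: C.hess_def C.traceless_components[OF e(2)])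
  qed
  have val: "(tau_complex f X c q v)\<^sup>2 * omega_form X c q v = C.fubini e1 e2 t1 t2"
    if X: "second_order_frame M A f W X" and q: "q \<in> W" for W X
  proof -
    have X1: "first_order_frame M A f W X" using X by (simp add: second_order_frame_def)
    obtain f1 f2 where fb: "det2 f1 f2 < 0" "column 1 (X q) = differential f c q f1" "column 2 (X q) = differential f c q f2"
      by (rule first_order_basis[OF f X1 c(1) q c(2)])
    note gam = gamma_eq[OF f X1 c(1) q c(2) fb(2,3)]
    have tr: "C.traceless f1 f2"
      unfolding C.traceless_def using X c q gam unfolding second_order_frame_def by (metis IntI)
    obtain s1 s2 where s: "v = s1 *\<^sub>R f1 + s2 *\<^sub>R f2" using det2_basis fb(1) by (metis less_irrefl)
    note lin = linear_differential[OF f c]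
    have "tau_form f X c q v = symp_inv (X q) *v (X q *v (s1 *\<^sub>R axis 1 1 + s2 *\<^sub>R axis 2 1))"
      unfolding tau_form_def matrix_inv_Sp4[OF frame_smooth(4)[OF X1 q]]
      by (simp add: s linear_add[OF lin] linear_cmul[OF lin] fb(2,3)[symmetric] matrix_vector_right_distrib
        matrix_vector_mult_scaleR matrix_vector_mult_basis)
    then have "tau_form f X c q v = s1 *\<^sub>R axis 1 1 + s2 *\<^sub>R axis 2 1"
      by (simp add: symp_inv_mult(1)[OF frame_smooth(4)[OF X1 q]])
    then have "tau_complex f X c q v = Complex s1 (- s2)"
      by (simp add: tau_complex_def axis_def)
    then have "(tau_complex f X c q v)\<^sup>2 * omega_form X c q v = C.fubini f1 f2 s1 s2"
      by (simp add: omega_form_def gam C.fubini_def s)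
    also have "\<dots> = C.fubini e1 e2 t1 t2"
      by (rule C.fubini_unique[OF e(2) tr e(1) fb(1) nz, symmetric]) (use s v in simp)
    finally show ?thesis .
  qed
  obtain W X where "second_order_frame M A f W X" "q \<in> W" by (rule ex_second_order_frame[OF ell c])
  then show ?thesis unfolding fubini_form_def
    by (intro the_equality) (use val in \<open>metis+\<close>)
qed

text \<open>The real part gives the cubic form on the diagonal, and polarization recovers all of it.
  Conversely, a basis traceless for one immersion is traceless for the other, and
  \<open>fubini\<close> depends on the cubic form alone.\<close>

lemma same_fubini_form_iff:
  assumes f: "elliptic_lagrangian_immersion M A f" and f': "elliptic_lagrangian_immersion M A f'"
  shows "same_fubini_form M A f f' \<longleftrightarrow> (\<forall>c\<in>A. \<forall>q\<in>chart_dom c. cub f c q = cub f' c q)"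
proof
  have lf: "lagrangian_immersion M A f" "lagrangian_immersion M A f'"
    using f f' by (simp_all add: elliptic_lagrangian_immersion_def)
  have ortho: "\<exists>e1 e2. det2 e1 e2 < 0 \<and> cubic_form.traceless (cub f c q) e1 e2"
    if f: "elliptic_lagrangian_immersion M A f" "lagrangian_immersion M A f" and c: "c \<in> A" "q \<in> chart_dom c" for f c q
    using cubic_form.det2_ortho[OF cubic_form_cub[OF f(2) c] hess_cub_pos[OF f(1) c]]
      cubic_form.traceless_ortho[OF cubic_form_cub[OF f(2) c] hess_cub_pos[OF f(1) c]] by blast
  {
    assume same: "same_fubini_form M A f f'"
    have Re: "Re (fubini_form M A f c q v) = cub f c q v v v"
      if f: "elliptic_lagrangian_immersion M A f" "lagrangian_immersion M A f" and c: "c \<in> A" "q \<in> chart_dom c" for f c q v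
    proof -
      obtain e1 e2 where e: "det2 e1 e2 < 0" "cubic_form.traceless (cub f c q) e1 e2" using ortho[OF f c] by blast
      obtain s1 s2 where s: "v = s1 *\<^sub>R e1 + s2 *\<^sub>R e2" using det2_basis e(1) by (metis less_irrefl)
      show ?thesis unfolding fubini_form_eq[OF f(1) c e s]
        by (rule cubic_form.Re_fubini[OF cubic_form_cub[OF f(2) c] e(2) s])
    qed
    show "\<forall>c\<in>A. \<forall>q\<in>chart_dom c. cub f c q = cub f' c q"
    proof (intro ballI ext)
      fix c q u v w assume c: "c \<in> A" "q \<in> chart_dom c"
      have d: "cub f c q v v v = cub f' c q v v v" for v
        using same c Re[OF f lf(1) c, of v] Re[OF f' lf(2) c, of v] by (simp add: same_fubini_form_def)
      show "cub f c q u v w = cub f' c q u v w"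
        using cubic_form.polarization[OF cubic_form_cub[OF lf(1) c], of u v w]
          cubic_form.polarization[OF cubic_form_cub[OF lf(2) c], of u v w] unfolding d by linarith
    qed
  }
  assume same: "\<forall>c\<in>A. \<forall>q\<in>chart_dom c. cub f c q = cub f' c q"
  show "same_fubini_form M A f f'" unfolding same_fubini_form_def
  proof (intro ballI allI)
    fix c q v assume c: "c \<in> A" "q \<in> chart_dom c"
    obtain e1 e2 where e: "det2 e1 e2 < 0" "cubic_form.traceless (cub f c q) e1 e2" using ortho[OF f lf(1) c] by blast
    obtain s1 s2 where s: "v = s1 *\<^sub>R e1 + s2 *\<^sub>R e2" using det2_basis e(1) by (metis less_irrefl)
    have "cub f c q = cub f' c q" using same c by blast
    then show "fubini_form M A f c q v = fubini_form M A f' c q v"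
      using fubini_form_eq[OF f c e s] fubini_form_eq[OF f' c e(1) _ s] e(2) by simp
  qed
qed

end

section \<open>The associated family\<close>

context oriented_surface
begin

lemma in_M: "c \<in> A \<Longrightarrow> q \<in> chart_dom c \<Longrightarrow> q \<in> M"
  using dom_subset by blast

lemma has_derivative_chart:
  assumes "smooth_map_on A W F" "open W" "c \<in> A" "q \<in> W" "q \<in> chart_dom c"
  shows "((F \<circ> chart_inv c) has_derivative differential F c q) (at (chart_map c q))"
  using smooth_on_has_derivative[OF smooth_map_on_dom[OF assms(1,3)] image_open[OF assms(3,2)], of "chart_map c q"] assms(4,5)
  by (auto simp: differential_def[abs_def])

lemma differential_eqI:
  assumes "((F \<circ> chart_inv c) has_derivative F') (at (chart_map c q))"
  shows "differential F c q v = F' v"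
  unfolding differential_dird by (rule dird_eqI[OF assms])

lemma eventually_nhds_chart:
  assumes "c \<in> A" "q \<in> chart_dom c" "open V" "chart_map c q \<in> V" "V \<subseteq> img c"
    "\<And>x. x \<in> V \<Longrightarrow> Q (chart_inv c x)"
  shows "\<forall>\<^sub>F q' in nhds q. Q q'"
  unfolding eventually_nhds
proof (intro exI conjI ballI)
  show "open (chart_inv c ` V)" by (rule inv_image_open[OF assms(1,3,5)])
  show "q \<in> chart_inv c ` V" using assms(1,2,4) by (auto intro!: image_eqI[of _ _ "chart_map c q"])
qed (use assms(6) in blast)

lemma ex_chart_ball:
  assumes "c \<in> A" "q \<in> chart_dom c" "open W" "q \<in> W"
  obtains r where "r > 0" "cball (chart_map c q) r \<subseteq> chart_map c ` (chart_dom c \<inter> W)"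
  using image_open[OF assms(1,3)] assms(2,4) unfolding open_contains_cball by blast

lemma constant_if_differential_zero:
  fixes G :: "'m \<Rightarrow> 'b::euclidean_space"
  assumes "connected M" "smooth_map_on A M G" "\<And>c q v. c \<in> A \<Longrightarrow> q \<in> chart_dom c \<Longrightarrow> differential G c q v = 0"
    and "q \<in> M" "q' \<in> M"
  shows "G q = G q'"
proof (rule connected_local_const[OF assms(1,4,5)], rule ballI)
  fix q assume q: "q \<in> M"
  obtain c where c: "c \<in> A" "q \<in> chart_dom c" using chart_at[OF q] by blast
  obtain r where r: "r > 0" "cball (chart_map c q) r \<subseteq> chart_map c ` (chart_dom c \<inter> M)"
    using ex_chart_ball[OF c M_open q] .
  have sub: "ball (chart_map c q) r \<subseteq> img c" using r(2) ball_subset_cball by fastforce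
  have "\<forall>\<^sub>F q' in nhds q. G q = G q'"
  proof (rule eventually_nhds_chart[OF c open_ball _ sub])
    fix x assume x: "x \<in> ball (chart_map c q) r"
    have d: "((G \<circ> chart_inv c) has_derivative (\<lambda>v. 0)) (at y within ball (chart_map c q) r)" if y: "y \<in> ball (chart_map c q) r" for y
    proof -
      obtain q'' where q'': "q'' \<in> chart_dom c" "y = chart_map c q''" using y sub by blast
      have "((G \<circ> chart_inv c) has_derivative differential G c q'') (at y)"
        unfolding q''(2) by (rule has_derivative_chart[OF assms(2) M_open c(1)]) (use q'' in_M[OF c(1)] in auto)
      then show ?thesis using assms(3)[OF c(1) q''(1)] by (metis ext has_derivative_at_withinI)
    qed
    have "(loc G c) (chart_map c q) = (loc G c) x"
      using has_derivative_zero_unique[OF convex_ball d, of x "chart_map c q"] x r(1) by simp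
    then show "G q = G (chart_inv c x)" using c by simp
  qed (use r in simp)
  then show "\<forall>\<^sub>F q' in at q within M. G q = G q'" by (simp add: eventually_at_filter eventually_mono)
qed

end

section \<open>The global map Phi and the global system\<close>

locale same_fubini_pair = oriented_surface M A
  for M :: "'m::{t2_space, second_countable_topology} set" and A :: "'m atlas" +
  fixes f f' :: "'m \<Rightarrow> real^4"
  assumes ell: "elliptic_lagrangian_immersion M A f" "elliptic_lagrangian_immersion M A f'"
    and same: "same_fubini_form M A f f'"
begin

lemma lagr: "lagrangian_immersion M A f" "lagrangian_immersion M A f'"
  using ell by (simp_all add: elliptic_lagrangian_immersion_def)

lemma smooth_f: "smooth_map_on A M f" "smooth_map_on A M f'"
  using lagr by (simp_all add: lagrangian_immersion_def)

lemma patch: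
  assumes "c \<in> A"
  shows "applicable_patch (img c) (loc f c) (loc f' c)"
proof -
  interpret a: elliptic_patch "img c" "loc f c" by (rule elliptic_patch_chart[OF ell(1) assms])
  interpret b: lagrangian_patch "img c" "loc f' c" by (rule lagrangian_patch_chart[OF lagr(2) assms])
  have "cub f c q = cub f' c q" if "q \<in> chart_dom c" for q
    using same same_fubini_form_iff[OF ell] assms that by blast
  then show ?thesis by unfold_locales auto
qed

abbreviation PhiC :: "'m chart \<Rightarrow> real^2 \<Rightarrow> real^4^4" where
  "PhiC c \<equiv> applicable_patch.Phi (loc f c) (loc f' c)"

text \<open>The map built in chart \<open>c'\<close>, read in chart \<open>c\<close>, satisfies the
  hypotheses of \<open>Phi_unique\<close>: both sides of the first condition transform by the same
  Jacobian, and the second is homogeneous.\<close>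

lemma PhiC_compatible:
  assumes c: "c \<in> A" "c' \<in> A" and q: "q \<in> chart_dom c" "q \<in> chart_dom c'"
  shows "PhiC c' (chart_map c' q) = PhiC c (chart_map c q)"
proof -
  interpret p: applicable_patch "img c" "loc f c" "loc f' c" by (rule patch[OF c(1)])
  interpret p': applicable_patch "img c'" "loc f c'" "loc f' c'" by (rule patch[OF c(2)])
  define F where "F q = PhiC c' (chart_map c' q)" for q
  have F': "smooth_on (img c') (loc F c')"
    by (rule smooth_on_cong[OF p'.a.U _ p'.smooth_on_Phi]) (auto simp: F_def c(2))
  let ?V = "chart_map c ` (chart_dom c \<inter> chart_dom c')"
  have V: "open ?V" by (rule image_open[OF c(1) dom_open[OF c(2)]])
  have Fc: "smooth_on ?V (loc F c)"
    by (rule smooth_other_chart[OF c(2,1) dom_open[OF c(2)] subset_refl F'])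
  have dF': "differential F c' q v = dird v (PhiC c') (chart_map c' q)" if "q \<in> chart_dom c'" for q v
    unfolding differential_dird by (rule dird_cong[OF p'.a.U _ F']) (use that c(2) in \<open>auto simp: F_def\<close>)
  have trans: "differential F c q v = differential F c' q (trans c c' q v)"
    "differential f c q v = differential f c' q (trans c c' q v)"
    "differential f' c q v = differential f' c' q (trans c c' q v)"
    if "q \<in> chart_dom c" "q \<in> chart_dom c'" for q v
    using that in_M[OF c(1)]
    by (auto intro!: differential_other_chart[OF c(2,1) dom_open[OF c(2)] subset_refl F']
      differential_change[OF smooth_f(1) M_open c(2,1)] differential_change[OF smooth_f(2) M_open c(2,1)])
  have Fq: "F q *v differential f c q u = differential f' c q u" "differential F c q v *v differential f c q u = 0"
    if "q \<in> chart_dom c" "q \<in> chart_dom c'" for q u v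
    unfolding trans[OF that] dF'[OF that(2)]
    using p'.Phi_dird[of "chart_map c' q" "trans c c' q u"] p'.dird_Phi_dird[of "chart_map c' q" "trans c c' q v" "trans c c' q u"] that(2)
    by (auto simp: differential_dird F_def)
  have "(loc F c) (chart_map c q) = PhiC c (chart_map c q)"
  proof (rule p.Phi_unique[OF V _ Fc])
    show "(loc F c) x *v dird u (loc f c) x = dird u (loc f' c) x" if "x \<in> ?V" for x u
      using that Fq(1) c(1) by (auto simp: differential_dird)
    show "dird v (loc F c) (chart_map c q) *v dird u (loc f c) (chart_map c q) = 0" for u v
      using Fq(2)[OF q] by (simp add: differential_dird)
  qed (use q in auto)
  then show ?thesis using c q by (simp add: F_def)
qed

definition Phi :: "'m \<Rightarrow> real^4^4" where
  "Phi q = (let c = SOME c. c \<in> A \<and> q \<in> chart_dom c in PhiC c (chart_map c q))"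

lemma Phi_chart:
  assumes "c \<in> A" "q \<in> chart_dom c"
  shows "Phi q = PhiC c (chart_map c q)"
proof -
  have "(SOME c. c \<in> A \<and> q \<in> chart_dom c) \<in> A \<and> q \<in> chart_dom (SOME c. c \<in> A \<and> q \<in> chart_dom c)"
    by (rule someI[of _ c]) (use assms in blast)
  then show ?thesis unfolding Phi_def Let_def using PhiC_compatible[OF assms(1) _ assms(2)] by blast
qed

lemma smooth_Phi_chart:
  assumes "c \<in> A"
  shows "smooth_on (img c) (loc Phi c)"
proof -
  interpret p: applicable_patch "img c" "loc f c" "loc f' c" by (rule patch[OF assms])
  show ?thesis by (rule smooth_on_cong[OF p.a.U _ p.smooth_on_Phi]) (use assms in \<open>auto simp: Phi_chart[OF assms]\<close>)
qed

lemma smooth_Phi: "smooth_map_on A M Phi"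
proof (rule smooth_map_onI[OF subset_refl _ M_open])
  fix q assume "q \<in> M"
  then obtain c where "c \<in> A" "q \<in> chart_dom c" using chart_at by blast
  then show "\<exists>c\<in>A. \<exists>V. open V \<and> q \<in> V \<and> V \<subseteq> M \<inter> chart_dom c \<and> smooth_on (chart_map c ` V) (loc Phi c)"
    using smooth_Phi_chart[of c] dom_open[of c] dom_subset[of c] by blast
qed

lemma differential_Phi:
  assumes "c \<in> A" "q \<in> chart_dom c"
  shows "differential Phi c q v = dird v (PhiC c) (chart_map c q)"
  unfolding differential_dird
  by (rule dird_cong[OF img_open[OF assms(1)] _ smooth_Phi_chart[OF assms(1)]]) (use assms in \<open>auto simp: Phi_chart[OF assms(1)]\<close>)

lemma Phi_Sp4: "q \<in> M \<Longrightarrow> Phi q \<in> Sp4"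
  using chart_at applicable_patch.Phi_Sp4[OF patch] Phi_chart by (metis image_eqI)

lemma Phi_differential:
  assumes "c \<in> A" "q \<in> chart_dom c"
  shows "Phi q *v differential f c q v = differential f' c q v"
  using applicable_patch.Phi_dird[OF patch[OF assms(1)]] assms by (simp add: Phi_chart differential_dird)

definition T :: "real \<Rightarrow> 'm chart \<Rightarrow> 'm \<Rightarrow> real^2 \<Rightarrow> (real^4^4) \<times> (real^4) \<Rightarrow> (real^4^4) \<times> (real^4)" where
  "T l c q v p = (l *\<^sub>R (fst p ** (symp_inv (Phi q) ** differential Phi c q v)), fst p *v differential f c q v)"

lemma T_chart:
  assumes "c \<in> A" "q \<in> chart_dom c"
  shows "T l c q v p = applicable_patch.T (loc f c) (loc f' c) l (chart_map c q) v p"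
proof -
  interpret p: applicable_patch "img c" "loc f c" "loc f' c" by (rule patch[OF assms(1)])
  show ?thesis
    by (simp add: T_def p.T_def p.B_def Phi_chart[OF assms] differential_Phi[OF assms] differential_dird[of f])
qed

lemma T_change:
  assumes "c \<in> A" "c' \<in> A" "q \<in> chart_dom c" "q \<in> chart_dom c'"
  shows "T l c' q v p = T l c q (trans c' c q v) p"
proof -
  have "q \<in> M" using assms dom_subset by blast
  then show ?thesis
    by (simp add: T_def differential_change[OF smooth_Phi M_open assms(1,2) _ assms(3,4)]
      differential_change[OF smooth_f(1) M_open assms(1,2) _ assms(3,4)])
qed

section \<open>Local and global solutions\<close>

text \<open>The sheets to which \<open>local_solutions\<close> is applied. With symplecticity built
  in, the fibre is \<open>Sp4 \<times> UNIV\<close>, on which the affine symplectic group acts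
  transitively from the left.\<close>

definition sols :: "real \<Rightarrow> ('m set \<times> ('m \<Rightarrow> (real^4^4) \<times> (real^4))) set" where
  "sols l = {(U, P). open U \<and> U \<subseteq> M \<and> (\<forall>q\<in>U. fst (P q) \<in> Sp4) \<and> smooth_map_on A U P \<and>
     (\<forall>c\<in>A. \<forall>q\<in>U \<inter> chart_dom c. \<forall>v. differential P c q v = T l c q v (P q))}"

lemma solsD:
  assumes "(U, P) \<in> sols l"
  shows "open U" "U \<subseteq> M" "q \<in> U \<Longrightarrow> fst (P q) \<in> Sp4" "smooth_map_on A U P"
    "c \<in> A \<Longrightarrow> q \<in> U \<Longrightarrow> q \<in> chart_dom c \<Longrightarrow> differential P c q v = T l c q v (P q)"
  using assms by (auto simp: sols_def)

lemma sols_chart: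
  assumes P: "(U, P) \<in> sols l" and c: "c \<in> A" and x: "x \<in> chart_map c ` (chart_dom c \<inter> U)"
  shows "((P \<circ> chart_inv c) has_derivative
     (\<lambda>v. applicable_patch.T (loc f c) (loc f' c) l x v ((P \<circ> chart_inv c) x))) (at x)"
proof -
  obtain q where q: "q \<in> chart_dom c" "q \<in> U" "x = chart_map c q" using x by blast
  note s = solsD[OF P]
  have "differential P c q = (\<lambda>v. T l c q v (P q))" using s(5)[OF c q(2,1)] by blast
  then show ?thesis
    using has_derivative_chart[OF s(4,1) c q(2,1)] q c by (simp add: T_chart[OF c q(1)])
qed

lemma sols_agree:
  assumes P: "(U, P) \<in> sols l" and R: "(V, R) \<in> sols l" and q: "q \<in> U \<inter> V" "P q = R q"
  shows "\<forall>\<^sub>F q' in nhds q. P q' = R q'"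
proof -
  obtain c where c: "c \<in> A" "q \<in> chart_dom c" using chart_at q solsD(2)[OF P] by blast
  interpret p: applicable_patch "img c" "loc f c" "loc f' c" by (rule patch[OF c(1)])
  let ?z = "chart_map c q"
  obtain r where r: "r > 0" "cball ?z r \<subseteq> chart_map c ` (chart_dom c \<inter> (U \<inter> V))"
    using ex_chart_ball[OF c open_Int[OF solsD(1)[OF P] solsD(1)[OF R]]] q by blast
  have sub: "ball ?z r \<subseteq> cball ?z r" "cball ?z r \<subseteq> img c" "ball ?z r \<subseteq> img c"
    using r(2) ball_subset_cball[of ?z r] by blast+
  show ?thesis
  proof (rule eventually_nhds_chart[OF c open_ball _ sub(3)])
    fix x assume x: "x \<in> ball ?z r"
    have "(loc P c) x = (loc R c) x"
    proof (rule p.T.solution_unique[OF compact_cball sub(2) convex_ball sub(1) _ _ _ _ x, where a = ?z and l = l])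
      show "((P \<circ> chart_inv c) has_derivative (\<lambda>v. p.T l x v ((P \<circ> chart_inv c) x))) (at x)" if "x \<in> ball ?z r" for x
        by (rule sols_chart[OF P c(1)]) (use that sub r(2) in blast)
      show "((R \<circ> chart_inv c) has_derivative (\<lambda>v. p.T l x v ((R \<circ> chart_inv c) x))) (at x)" if "x \<in> ball ?z r" for x
        by (rule sols_chart[OF R c(1)]) (use that sub r(2) in blast)
    qed (use r(1) q c in auto)
    then show "P (chart_inv c x) = R (chart_inv c x)" by simp
  qed (use r in simp)
qed

text \<open>Only continuity is involved; the differential equation enters in
  \<open>sols_agree\<close>.\<close>

lemma sols_disagree:
  assumes P: "(U, P) \<in> sols l" and R: "(V, R) \<in> sols l" and q: "q \<in> U \<inter> V" "P q \<noteq> R q"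
  shows "\<forall>\<^sub>F q' in nhds q. P q' \<noteq> R q'"
proof -
  obtain c where c: "c \<in> A" "q \<in> chart_dom c" using chart_at q solsD(2)[OF P] by blast
  let ?D = "chart_map c ` (chart_dom c \<inter> (U \<inter> V))"
  let ?d = "\<lambda>x. (loc P c) x - (loc R c) x"
  have D: "open ?D" by (rule image_open[OF c(1) open_Int[OF solsD(1)[OF P] solsD(1)[OF R]]])
  have "continuous_on ?D ?d"
    using smooth_on_imp_continuous_on[OF smooth_map_on_dom[OF solsD(4)[OF P] c(1)]]
      smooth_on_imp_continuous_on[OF smooth_map_on_dom[OF solsD(4)[OF R] c(1)]]
    by (intro continuous_on_diff) (auto elim!: continuous_on_subset)
  then have "open (?D \<inter> ?d -` (- {0}))" using D by (intro continuous_open_preimage) auto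
  then show ?thesis
    by (rule eventually_nhds_chart[OF c, of _ "\<lambda>q'. P q' \<noteq> R q'"]) (use q c in auto)
qed

lemma sols_from_chart:
  assumes c: "c \<in> A" and ball: "ball z r \<subseteq> img c"
    and Q: "smooth_on (ball z r) Q" "\<And>x. x \<in> ball z r \<Longrightarrow> fst (Q x) \<in> Sp4"
      "\<And>x. x \<in> ball z r \<Longrightarrow> (Q has_derivative (\<lambda>v. applicable_patch.T (loc f c) (loc f' c) l x v (Q x))) (at x)"
  shows "(chart_inv c ` ball z r, Q \<circ> chart_map c) \<in> sols l"
proof -
  let ?W = "chart_inv c ` ball z r" and ?P = "Q \<circ> chart_map c"
  have W: "open ?W" by (rule inv_image_open[OF c open_ball ball])
  have Wd: "?W \<subseteq> chart_dom c" using ball inv_in_dom[OF c] by blast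
  have inv: "chart_map c (chart_inv c x) = x" if "x \<in> ball z r" for x using map_inv[OF c] ball that by blast
  then have Wb: "chart_map c ` ?W = ball z r" unfolding image_image by simp
  have sm: "smooth_on (chart_map c ` ?W) (loc ?P c)"
    unfolding Wb by (rule smooth_on_cong[OF open_ball _ Q(1)]) (use ball map_inv[OF c] in auto)
  have d: "differential ?P c q v = T l c q v (?P q)" if q: "q \<in> ?W" for q v
  proof -
    have x: "chart_map c q \<in> ball z r" using q Wb by blast
    have "((?P \<circ> chart_inv c) has_derivative (\<lambda>v. applicable_patch.T (loc f c) (loc f' c) l (chart_map c q) v (Q (chart_map c q)))) (at (chart_map c q))"
      by (rule has_derivative_transform_within_open[OF Q(3)[OF x] open_ball x]) (use ball map_inv[OF c] in auto)
    moreover have "q \<in> chart_dom c" using q Wd by blast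
    ultimately show ?thesis using differential_eqI T_chart[OF c] by (metis (no_types, lifting) o_apply)
  qed
  have 1: "differential ?P c' q v = T l c' q v (?P q)" if c': "c' \<in> A" "q \<in> ?W \<inter> chart_dom c'" for c' q v
  proof -
    have q: "q \<in> ?W" "q \<in> chart_dom c" "q \<in> chart_dom c'" using c'(2) Wd by blast+
    have "differential ?P c' q v = differential ?P c q (trans c' c q v)"
      by (rule differential_other_chart[OF c c'(1) W Wd sm]) (use q in blast)
    then show ?thesis unfolding d[OF q(1)] T_change[OF c c'(1) q(2,3)] .
  qed
  have WM: "?W \<subseteq> M" using Wd dom_subset[OF c] by (rule order_trans)
  have 2: "smooth_map_on A ?W ?P"
    by (rule smooth_map_onI[OF WM _ W]) (use W Wd sm c in blast)
  have 3: "fst (?P q) \<in> Sp4" if "q \<in> ?W" for q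
  proof -
    have "chart_map c q \<in> ball z r" using Wb that by blast
    then show ?thesis unfolding o_apply by (rule Q(2))
  qed
  show ?thesis unfolding sols_def mem_Collect_eq case_prod_conv
    by (intro conjI ballI allI W WM 1 2 3)
qed

text \<open>The system is invariant under the left action of affine symplectic maps. So one solution
  on a ball yields, on the same domain, a solution through every value at every point: compose with
  the affine map that moves its value at \<open>q'\<close> to \<open>y\<close>.\<close>

lemma sols_exist:
  assumes "q \<in> M"
  shows "\<exists>U. path_connected U \<and> q \<in> U \<and> (\<forall>q'\<in>U. \<forall>y\<in>Sp4 \<times> UNIV. \<exists>P. (U, P) \<in> sols l \<and> P q' = y)"
proof -
  obtain c where c: "c \<in> A" "q \<in> chart_dom c" using chart_at assms by blast
  interpret p: applicable_patch "img c" "loc f c" "loc f' c" by (rule patch[OF c(1)])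
  have z: "chart_map c q \<in> img c" using c by blast
  let ?z = "chart_map c q"
  obtain r where r: "r > 0" "cball ?z r \<subseteq> img c"
    "\<forall>y0. \<exists>P. P ?z = y0 \<and> smooth_on (ball ?z r) P \<and> (\<forall>x\<in>ball ?z r. (P has_derivative (\<lambda>v. p.T l x v (P x))) (at x))"
    by (rule p.T.ex_local_solution[OF z, where l = l])
  obtain P where P: "P ?z = (mat 1, 0)" "smooth_on (ball ?z r) P"
    "\<And>x. x \<in> ball ?z r \<Longrightarrow> (P has_derivative (\<lambda>v. p.T l x v (P x))) (at x)"
    using r(3)[rule_format, of "(mat 1, 0)"] by blast
  have sub: "ball ?z r \<subseteq> img c" using r(2) ball_subset_cball by blast
  have PS: "fst (P x) \<in> Sp4" if "x \<in> ball ?z r" for x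
  proof (rule p.Sp4_solution[OF r(2), where P = "\<lambda>x. fst (P x)" and l = l])
    show "((\<lambda>x. fst (P x)) has_derivative (\<lambda>v. l *\<^sub>R (fst (P y) ** p.B y v))) (at y)" if "y \<in> ball ?z r" for y
      using has_derivative_fst[OF P(3)[OF that]] by (simp add: p.T_def)
    show "fst (P ?z) \<in> Sp4" by (simp add: P(1) Sp4_mat_1)
  qed (use r(1) that in auto)
  show ?thesis
  proof (rule exI, intro conjI ballI)
    let ?U = "chart_inv c ` ball ?z r"
    show "path_connected ?U"
      by (rule path_connected_continuous_image[OF continuous_on_subset[OF continuous_map_inv[OF c(1)] sub]])
        (simp add: convex_imp_path_connected)
    show "q \<in> ?U" using r(1) c by (auto intro!: image_eqI[of _ _ ?z])
    fix q' and y :: "(real^4^4) \<times> (real^4)" assume q': "q' \<in> ?U" and y: "y \<in> Sp4 \<times> UNIV"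
    obtain x' where x': "x' \<in> ball ?z r" "q' = chart_inv c x'" using q' by blast
    have mx': "chart_map c q' = x'" using x' sub map_inv[OF c(1)] by auto
    define Z where "Z = fst y ** symp_inv (fst (P x'))"
    define Q where "Q x = (Z ** fst (P x), Z *v (snd (P x) - snd (P x')) + snd y)" for x
    have Z: "Z \<in> Sp4" unfolding Z_def using y PS[OF x'(1)] by (auto intro: Sp4_mult Sp4_symp_inv)
    have "(?U, Q \<circ> chart_map c) \<in> sols l"
    proof (rule sols_from_chart[OF c(1) sub])
      show "smooth_on (ball ?z r) Q"
        unfolding Q_def[abs_def] by (intro smooth_intros open_ball P(2))
      show "fst (Q x) \<in> Sp4" if "x \<in> ball ?z r" for x using that by (simp add: Q_def Sp4_mult Z PS)
      fix x assume x: "x \<in> ball ?z r"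
      have "(Q has_derivative (\<lambda>v. (Z ** fst (p.T l x v (P x)), Z *v snd (p.T l x v (P x))))) (at x)"
        unfolding Q_def[abs_def]
        by (rule has_derivative_eq_rhs[OF has_derivative_Pair[OF
            bounded_linear.has_derivative[OF mmult.bounded_linear_right has_derivative_fst[OF P(3)[OF x]]]
            has_derivative_add[OF bounded_linear.has_derivative[OF mvec.bounded_linear_right
              has_derivative_diff[OF has_derivative_snd[OF P(3)[OF x]] has_derivative_const]] has_derivative_const]]]) simp
      then show "(Q has_derivative (\<lambda>v. p.T l x v (Q x))) (at x)"
        by (simp add: p.T_def Q_def matrix_mul_assoc matrix_vector_mul_assoc mmult.scaleR_right)
    qed
    moreover have "(Q \<circ> chart_map c) q' = y"
      using symp_inv_left[OF PS[OF x'(1)]] by (simp add: Q_def mx' Z_def matrix_mul_assoc[symmetric])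
    ultimately show "\<exists>P. (?U, P) \<in> sols l \<and> P q' = y" by blast
  qed
qed

lemma local_solutions_sols: "local_solutions M (Sp4 \<times> UNIV) (sols l)"
proof
  show "P q \<in> Sp4 \<times> UNIV" if "(U, P) \<in> sols l" "q \<in> U" for U P q
    using solsD(3)[OF that] by (cases "P q") simp
  show "\<exists>U. path_connected U \<and> q \<in> U \<and> (\<forall>q'\<in>U. \<forall>y\<in>Sp4 \<times> UNIV. \<exists>P. (U, P) \<in> sols l \<and> P q' = y)" if "q \<in> M" for q
    by (rule sols_exist[OF that])
qed (fact solsD(1) solsD(2) sols_agree sols_disagree)+

lemma ex_global_solution:
  assumes "simply_connected M"
  shows "\<exists>P. (M, P) \<in> sols l \<and> (l = 0 \<longrightarrow> (\<forall>q. snd (P q) = f q))"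
proof -
  \<comment> \<open>For \<open>l = 0\<close> the pair of the identity and \<open>f\<close> is an
    explicit solution, and it makes the member at 0 equal to \<open>f\<close> as a function, also
    outside \<open>M\<close>. For empty \<open>M\<close> there is no base point, and the same pair
    serves.\<close>
  consider "l = 0 \<or> M = {}" | q0 where "q0 \<in> M" "l \<noteq> 0" by blast
  then show ?thesis
  proof cases
    case 1
    have "smooth_map_on A M (\<lambda>q. (mat 1 :: real^4^4, f q))"
      unfolding smooth_map_on_def
    proof
      fix c assume c: "c \<in> A"
      have "smooth_on (chart_map c ` (chart_dom c \<inter> M)) (\<lambda>x. (mat 1 :: real^4^4, (loc f c) x))"
        by (intro smooth_on_Pair smooth_on_const image_open[OF c M_open] smooth_map_on_dom[OF smooth_f(1) c])
      then show "smooth_on (chart_map c ` (chart_dom c \<inter> M)) ((\<lambda>q. (mat 1 :: real^4^4, f q)) \<circ> chart_inv c)" by (simp add: o_def)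
    qed
    moreover have "differential (\<lambda>q. (mat 1 :: real^4^4, f q)) c q v = T l c q v (mat 1 :: real^4^4, f q)" if "c \<in> A" "q \<in> M \<inter> chart_dom c" for c q v
    proof -
      have "(((\<lambda>q. (mat 1 :: real^4^4, f q)) \<circ> chart_inv c) has_derivative (\<lambda>v. (0, differential f c q v))) (at (chart_map c q))"
        using has_derivative_Pair[OF has_derivative_const[of "mat 1 :: real^4^4"] has_derivative_chart[OF smooth_f(1) M_open that(1)]] that(2)
        by (simp add: o_def)
      moreover have "l = 0" using 1 that by blast
      ultimately show ?thesis using differential_eqI by (simp add: T_def)
    qed
    ultimately have "(M, \<lambda>q. (mat 1 :: real^4^4, f q)) \<in> sols l"
      by (simp add: sols_def M_open Sp4_mat_1)
    then show ?thesis by (intro exI[of _ "\<lambda>q. (mat 1 :: real^4^4, f q)"]) simp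
  next
    case 2
    have I: "(mat 1, 0) \<in> Sp4 \<times> (UNIV :: (real^4) set)" by (simp add: Sp4_mat_1)
    obtain P where "P q0 = (mat 1, 0)" and P: "\<forall>q\<in>M. \<exists>(U, p)\<in>sols l. q \<in> U \<and> (\<forall>\<^sub>F q' in nhds q. P q' = p q')"
      by (rule local_solutions.global_solution[OF local_solutions_sols assms 2(1) I])
    have loc: "\<exists>U p N. (U, p) \<in> sols l \<and> open N \<and> q \<in> N \<and> N \<subseteq> U \<and> (\<forall>q'\<in>N. P q' = p q')" if q: "q \<in> M" for q
    proof -
      obtain U p N where "(U, p) \<in> sols l" "q \<in> U" "open N" "q \<in> N" "\<forall>q'\<in>N. P q' = p q'"
        using P q unfolding eventually_nhds by blast
      then show ?thesis using solsD(1)[of U p l] by (intro exI[of _ U] exI[of _ p] exI[of _ "N \<inter> U"]) auto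
    qed
    have "fst (P q) \<in> Sp4" if "q \<in> M" for q using loc[OF that] solsD(3) by (metis subsetD)
    moreover have chart: "smooth_on (chart_map c ` (chart_dom c \<inter> N)) (loc P c)
        \<and> differential P c q v = T l c q v (P q)"
      if p: "(U, p) \<in> sols l" "open N" "N \<subseteq> U" "\<forall>q'\<in>N. P q' = p q'" and c: "c \<in> A" "q \<in> N" "q \<in> chart_dom c" for c q v U p N
    proof -
      let ?D = "chart_map c ` (chart_dom c \<inter> N)"
      have D: "open ?D" by (rule image_open[OF c(1) p(2)])
      have sm: "smooth_on ?D (p \<circ> chart_inv c)"
        by (rule smooth_map_on_dom[OF smooth_map_on_subset[OF solsD(4)[OF p(1)] p(3)] c(1)])
      have eq: "(p \<circ> chart_inv c) x = (loc P c) x" if "x \<in> ?D" for x using that p(4) c(1) by auto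
      have "differential p c q v = differential P c q v"
        unfolding differential_dird by (rule dird_cong[OF D _ sm eq]) (use c in auto)
      moreover have "differential p c q v = T l c q v (p q)"
        by (rule solsD(5)[OF p(1) c(1) _ c(3)]) (use p(3) c(2) in blast)
      moreover have "smooth_on ?D (loc P c)" by (rule smooth_on_cong[OF D eq sm])
      ultimately show ?thesis using p(4) c(2) by metis
    qed
    moreover have "smooth_map_on A M P"
    proof (rule smooth_map_onI[OF subset_refl _ M_open])
      fix q assume q: "q \<in> M"
      obtain U p N where p: "(U, p) \<in> sols l" "open N" "q \<in> N" "N \<subseteq> U" "\<forall>q'\<in>N. P q' = p q'" using loc[OF q] by blast
      obtain c where c: "c \<in> A" "q \<in> chart_dom c" using chart_at[OF q] by blast
      have "chart_dom c \<inter> N \<subseteq> M \<inter> chart_dom c" using dom_subset[OF c(1)] by blast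
      then show "\<exists>c\<in>A. \<exists>V. open V \<and> q \<in> V \<and> V \<subseteq> M \<inter> chart_dom c \<and> smooth_on (chart_map c ` V) (loc P c)"
        using chart[OF p(1,2,4,5) c(1) p(3) c(2)] p(2,3) c dom_open[OF c(1)] by (intro bexI[of _ c] exI[of _ "chart_dom c \<inter> N"]) auto
    qed
    moreover have "differential P c q v = T l c q v (P q)" if "c \<in> A" "q \<in> M \<inter> chart_dom c" for c q v
      using loc[of q] chart that by (metis IntD1 IntD2)
    ultimately have "(M, P) \<in> sols l" using M_open by (simp add: sols_def)
    then show ?thesis using 2(2) by blast
  qed
qed

context
  fixes P l
  assumes P: "(M, P) \<in> sols l"
begin

text \<open>In the second derivative of the new immersion the derivative of the linear part
  contributes a multiple of \<open>P B\<close> applied to a tangent vector, which is 0. Thus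
  \<open>fst P\<close> carries the whole 2-jet of \<open>f\<close> to that of
  \<open>snd P\<close>.\<close>

lemma chart_solution:
  assumes "c \<in> A" "x \<in> img c"
  shows "smooth_on (img c) (\<lambda>x. fst ((P \<circ> chart_inv c) x))" "smooth_on (img c) ((\<lambda>q. snd (P q)) \<circ> chart_inv c)"
    "dird v (\<lambda>x. fst ((P \<circ> chart_inv c) x)) x =
       l *\<^sub>R (fst ((P \<circ> chart_inv c) x) ** applicable_patch.B (loc f c) (loc f' c) x v)"
    "dird v ((\<lambda>q. snd (P q)) \<circ> chart_inv c) x = fst ((P \<circ> chart_inv c) x) *v dird v (loc f c) x"
    "dird w (dird v ((\<lambda>q. snd (P q)) \<circ> chart_inv c)) x = fst ((P \<circ> chart_inv c) x) *v dird w (dird v (loc f c)) x"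
    "fst ((P \<circ> chart_inv c) x) \<in> Sp4"
proof -
  interpret p: applicable_patch "img c" "loc f c" "loc f' c" by (rule patch[OF assms(1)])
  have sm: "smooth_on (img c) (loc P c)" by (rule smooth_map_on_M[OF solsD(4)[OF P] assms(1)])
  show s1: "smooth_on (img c) (\<lambda>x. fst ((P \<circ> chart_inv c) x))" by (rule smooth_on_fst[OF p.a.U sm])
  show "smooth_on (img c) ((\<lambda>q. snd (P q)) \<circ> chart_inv c)" using smooth_on_snd[OF p.a.U sm] by (simp add: o_def)
  have dP: "((P \<circ> chart_inv c) has_derivative (\<lambda>v. p.T l x v ((P \<circ> chart_inv c) x))) (at x)" if "x \<in> img c" for x
    by (rule sols_chart[OF P assms(1)]) (use that dom_subset[OF assms(1)] in blast)
  show d1: "dird v (\<lambda>x. fst ((P \<circ> chart_inv c) x)) x = l *\<^sub>R (fst ((P \<circ> chart_inv c) x) ** p.B x v)" for v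
    by (subst dird_eqI[OF has_derivative_fst[OF dP[OF assms(2)]]]) (simp add: p.T_def)
  have d2: "dird v ((\<lambda>q. snd (P q)) \<circ> chart_inv c) x = fst ((P \<circ> chart_inv c) x) *v dird v (loc f c) x" if "x \<in> img c" for x v
  proof -
    have "(\<lambda>q. snd (P q)) \<circ> chart_inv c = (\<lambda>x. snd ((P \<circ> chart_inv c) x))" by (simp add: o_def)
    then show ?thesis
      by (simp only:) (subst dird_eqI[OF has_derivative_snd[OF dP[OF that]]], simp add: p.T_def)
  qed
  show "dird v ((\<lambda>q. snd (P q)) \<circ> chart_inv c) x = fst ((P \<circ> chart_inv c) x) *v dird v (loc f c) x"
    by (rule d2[OF assms(2)])
  have "dird w (dird v ((\<lambda>q. snd (P q)) \<circ> chart_inv c)) x = dird w (\<lambda>x. fst ((P \<circ> chart_inv c) x) *v dird v (loc f c) x) x"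
    by (rule dird_cong[OF p.a.U assms(2) _ d2]) (intro smooth_on_dird, fact)
  also have "\<dots> = fst ((P \<circ> chart_inv c) x) *v dird w (dird v (loc f c)) x"
    unfolding dird_bilinear[OF bounded_bilinear_matrix_vector_mult s1 smooth_on_dird[OF p.a.smooth] p.a.U assms(2)] d1
      mvec.scaleR_left
    by (simp only: matrix_vector_mul_assoc[symmetric] p.B_dird[OF assms(2)]) simp
  finally show "dird w (dird v ((\<lambda>q. snd (P q)) \<circ> chart_inv c)) x = fst ((P \<circ> chart_inv c) x) *v dird w (dird v (loc f c)) x" .
  show "fst ((P \<circ> chart_inv c) x) \<in> Sp4" using solsD(3)[OF P] assms dom_subset[OF assms(1)] by auto
qed

text \<open>A symplectic matrix carries the 2-jet of \<open>f\<close> to that of the new immersion,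
  so the cubic form is unchanged; ellipticity and the Fubini form are read off from it.\<close>

lemma solution_elliptic: "elliptic_lagrangian_immersion M A (\<lambda>q. snd (P q))"
  and solution_same_fubini: "same_fubini_form M A f (\<lambda>q. snd (P q))"
proof -
  let ?g = "\<lambda>q. snd (P q)"
  have dg: "differential ?g c q v = fst (P q) *v differential f c q v" if "c \<in> A" "q \<in> chart_dom c" for c q v
    using chart_solution(4)[OF that(1), of "chart_map c q"] that by (simp add: differential_dird)
  have PS: "fst (P q) \<in> Sp4" if "q \<in> chart_dom c" "c \<in> A" for q c using solsD(3)[OF P] that dom_subset by blast
  have lg: "lagrangian_immersion M A ?g"
    unfolding lagrangian_immersion_def
  proof (intro conjI ballI allI)
    show "smooth_map_on A M ?g"
    proof (rule smooth_map_onI[OF subset_refl _ M_open])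
      fix q assume "q \<in> M"
      then obtain c where c: "c \<in> A" "q \<in> chart_dom c" using chart_at by blast
      then have "smooth_on (img c) (loc ?g c)" using chart_solution(2)[OF c(1), of "chart_map c q"] by blast
      then show "\<exists>c\<in>A. \<exists>V. open V \<and> q \<in> V \<and> V \<subseteq> M \<inter> chart_dom c \<and> smooth_on (chart_map c ` V) (loc ?g c)"
        using c dom_open dom_subset by blast
    qed
    fix c q assume c: "c \<in> A" "q \<in> chart_dom c"
    show "inj (differential ?g c q)"
    proof (rule injI)
      fix v w assume "differential ?g c q v = differential ?g c q w"
      then have "differential f c q v = differential f c q w"
        unfolding dg[OF c] by (metis symp_inv_mult(1)[OF PS[OF c(2,1)]])
      moreover have "inj (differential f c q)" using lagr(1) c by (auto simp: lagrangian_immersion_def)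
      ultimately show "v = w" by (simp add: injD)
    qed
    show "Omega (differential ?g c q v) (differential ?g c q w) = 0" for v w
      unfolding dg[OF c] Omega_Sp4[OF PS[OF c(2,1)]] using lagr(1) c by (auto simp: lagrangian_immersion_def)
  qed
  have cub_g: "lagrangian_patch.cubic (loc ?g c) x u v w = lagrangian_patch.cubic (loc f c) x u v w"
    if c: "c \<in> A" "x \<in> img c" for c x u v w
  proof -
    interpret p: lagrangian_patch "img c" "loc f c" by (rule lagrangian_patch_chart[OF lagr(1) c(1)])
    interpret g: lagrangian_patch "img c" "loc ?g c" by (rule lagrangian_patch_chart[OF lg c(1)])
    show ?thesis unfolding g.cubic_def p.cubic_def chart_solution(4,5)[OF c] by (rule Omega_Sp4[OF chart_solution(6)[OF c]])
  qed
  show ell_g: "elliptic_lagrangian_immersion M A ?g"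
  proof (rule elliptic_if_patches[OF lg])
    fix c assume c: "c \<in> A"
    interpret p: elliptic_patch "img c" "loc f c" by (rule elliptic_patch_chart[OF ell(1) c])
    interpret g: lagrangian_patch "img c" "loc ?g c" by (rule lagrangian_patch_chart[OF lg c])
    show "elliptic_patch (img c) (loc ?g c)"
      by unfold_locales (use p.hessian_pos cub_g[OF c] in simp)
  qed
  show "same_fubini_form M A f ?g"
    unfolding same_fubini_form_iff[OF ell(1) ell_g] using cub_g by (intro ballI ext) auto
qed

end

section \<open>Noncongruence\<close>

text \<open>The constant value of \<open>Phi\<close> is the linear part of the congruence. By
  \<open>Phi_differential\<close> the difference \<open>?G\<close> has zero differential, and its
  constant value is the translation.\<close>

lemma congruent_if_Phi_constant:
  assumes "connected M" "\<And>c q v. c \<in> A \<Longrightarrow> q \<in> chart_dom c \<Longrightarrow> differential Phi c q v = 0"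
  shows "congruent_maps M f f'"
proof (cases "M = {}")
  case True
  then show ?thesis by (auto simp: congruent_maps_def affine_Sp4_def intro: Sp4_mat_1)
next
  case False
  then obtain q0 where q0: "q0 \<in> M" by blast
  have Phi: "Phi q = Phi q0" if "q \<in> M" for q
    by (rule constant_if_differential_zero[OF assms(1) smooth_Phi assms(2) that q0])
  let ?G = "\<lambda>q. f' q - Phi q0 *v f q"
  have "smooth_map_on A M ?G"
    unfolding smooth_map_on_def
  proof
    fix c assume c: "c \<in> A"
    have "smooth_on (chart_map c ` (chart_dom c \<inter> M)) (\<lambda>x. (loc f' c) x - Phi q0 *v (loc f c) x)"
      by (intro smooth_on_diff smooth_on_matrix_vector_mult smooth_on_const image_open[OF c M_open] smooth_map_on_dom[OF smooth_f(1) c]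
        smooth_map_on_dom[OF smooth_f(2) c])
    then show "smooth_on (chart_map c ` (chart_dom c \<inter> M)) (loc ?G c)" by (simp add: o_def)
  qed
  moreover have "differential ?G c q v = 0" if c: "c \<in> A" "q \<in> chart_dom c" for c q v
  proof -
    have q: "q \<in> M" using c dom_subset by blast
    have "((?G \<circ> chart_inv c) has_derivative (\<lambda>v. differential f' c q v - Phi q0 *v differential f c q v)) (at (chart_map c q))"
      using has_derivative_diff[OF has_derivative_chart[OF smooth_f(2) M_open c(1) q c(2)]
        bounded_linear.has_derivative[OF mvec.bounded_linear_right
          has_derivative_chart[OF smooth_f(1) M_open c(1) q c(2)]]]
      by (simp add: o_def)
    from differential_eqI[OF this] show ?thesis using Phi_differential[OF c, of v] Phi[OF q] by simp
  qed
  ultimately have G: "?G q = ?G q0" if "q \<in> M" for q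
    using constant_if_differential_zero[OF assms(1) _ _ that q0, of ?G] by blast
  have "f' q = affine_act (?G q0, Phi q0) (f q)" if "q \<in> M" for q
    using G[OF that] by (simp add: affine_act_def algebra_simps)
  moreover have "(?G q0, Phi q0) \<in> affine_Sp4" using Phi_Sp4[OF q0] by (simp add: affine_Sp4_def)
  ultimately show ?thesis unfolding congruent_maps_def by blast
qed

text \<open>A congruence with linear part \<open>X\<close> carries 2-jets to 2-jets, so
  \<open>zero_on_2jets\<close> gives Q = X P for the linear parts. Differentiating and inserting
  both equations leaves (m - l) Q B = 0 with Q invertible, so \<open>B\<close> vanishes and
  \<open>Phi\<close> is constant.\<close>

lemma solutions_not_congruent:
  assumes M: "connected M" and P: "(M, P) \<in> sols l" and Q: "(M, Q) \<in> sols m" and lm: "l \<noteq> m"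
    and cong: "congruent_maps M (\<lambda>q. snd (P q)) (\<lambda>q. snd (Q q))"
  shows "congruent_maps M f f'"
proof (rule congruent_if_Phi_constant[OF M])
  fix c q v assume c: "c \<in> A" "q \<in> chart_dom c"
  interpret p: applicable_patch "img c" "loc f c" "loc f' c" by (rule patch[OF c(1)])
  obtain y X where X: "X \<in> Sp4" "\<And>q. q \<in> M \<Longrightarrow> snd (Q q) = y + X *v snd (P q)"
    using cong unfolding congruent_maps_def affine_Sp4_def affine_act_def by auto
  note mv = mvec.bounded_linear_right
  let ?p = "(\<lambda>q. snd (P q)) \<circ> chart_inv c" and ?q = "(\<lambda>q. snd (Q q)) \<circ> chart_inv c"
  let ?P = "\<lambda>x. fst ((P \<circ> chart_inv c) x)" and ?Q = "\<lambda>x. fst ((Q \<circ> chart_inv c) x)"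
  note sP = chart_solution[OF P c(1)] and sQ = chart_solution[OF Q c(1)]
  have z: "chart_map c q \<in> img c" using c by blast
  note smp = sP(2)[OF z] and smq = sQ(2)[OF z]
  have d1: "dird u ?q x = X *v dird u ?p x" if x: "x \<in> img c" for x u
  proof -
    have "dird u ?q x = dird u (\<lambda>x. y + X *v ?p x) x"
      by (rule dird_cong[OF p.a.U x smq]) (use X(2) in_M[OF c(1)] c(1) in auto)
    also have "\<dots> = 0 + X *v dird u ?p x"
      by (rule dird_eqI[OF has_derivative_add[OF has_derivative_const bounded_linear.has_derivative[OF mv has_derivative_dird[OF smp p.a.U x]]]])
    finally show ?thesis by simp
  qed
  have d2: "dird w (dird u ?q) x = X *v dird w (dird u ?p) x" if x: "x \<in> img c" for x u w
    by (subst dird_cong[OF p.a.U x smooth_on_dird[OF smq] d1], assumption)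
      (rule dird_bounded_linear[OF mv smooth_on_dird[OF smp] p.a.U x])
  have QP: "?Q x = X ** ?P x" if x: "x \<in> img c" for x
  proof -
    have "?Q x - X ** ?P x = 0"
    proof (rule p.a.zero_on_2jets[OF x])
      show "(?Q x - X ** ?P x) *v dird u (loc f c) x = 0" for u
        using d1[OF x, of u] unfolding sP(4)[OF x] sQ(4)[OF x]
        by (simp add: matrix_vector_mult_diff_rdistrib matrix_vector_mul_assoc)
      show "(?Q x - X ** ?P x) *v dird w (dird u (loc f c)) x = 0" for u w
        using d2[OF x, of w u] unfolding sP(5)[OF x] sQ(5)[OF x]
        by (simp add: matrix_vector_mult_diff_rdistrib matrix_vector_mul_assoc)
    qed
    then show ?thesis by simp
  qed
  let ?z = "chart_map c q"
  have "dird v ?Q ?z = dird v (\<lambda>x. X ** ?P x) ?z"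
    by (rule dird_cong[OF p.a.U z sQ(1)[OF z] QP])
  also have "\<dots> = X ** dird v ?P ?z"
    by (rule dird_bounded_linear[OF mmult.bounded_linear_right sP(1)[OF z] p.a.U z])
  finally have "m *\<^sub>R (?Q ?z ** p.B ?z v) = l *\<^sub>R (?Q ?z ** p.B ?z v)"
    unfolding sP(3)[OF z] sQ(3)[OF z]
    by (simp only: QP[OF z] mmult.scaleR_right matrix_mul_assoc)
  then have "?Q ?z ** p.B ?z v = 0" using lm by simp
  then have "p.B ?z v = 0" using symp_inv_cancel(1)[OF sQ(6)[OF z], of "p.B ?z v"] by simp
  then show "differential Phi c q v = 0"
    by (simp add: differential_Phi[OF c] p.dird_Phi[OF z])
qed

end

theorem mainTheorem5:
  fixes M :: "'m::{t2_space, second_countable_topology} set"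
    and A :: "'m atlas"
    and f :: "'m \<Rightarrow> real^4"
  assumes "oriented_smooth_surface M A"
    and "connected M"
    and "simply_connected M"
    and "applicable M A f"
  shows "\<exists>F :: real \<Rightarrow> 'm \<Rightarrow> real^4.
           F 0 = f \<and>
           (\<forall>l. elliptic_lagrangian_immersion M A (F l)) \<and>
           (\<forall>l. same_fubini_form M A f (F l)) \<and>
           (\<forall>l m. l \<noteq> m \<longrightarrow> \<not> congruent_maps M (F l) (F m))"
proof -
  obtain f' where f': "elliptic_lagrangian_immersion M A f" "elliptic_lagrangian_immersion M A f'"
    "\<not> congruent_maps M f f'" "same_fubini_form M A f f'"
    using assms(4) unfolding applicable_def by blast
  interpret same_fubini_pair M A f f' by unfold_locales (fact assms(1) f')+
  obtain P where P: "\<And>l. (M, P l) \<in> sols l" "\<And>l q. l = 0 \<Longrightarrow> snd (P l q) = f q"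
    using ex_global_solution[OF assms(3)] by metis
  show ?thesis
  proof (intro exI[of _ "\<lambda>l q. snd (P l q)"] conjI allI impI)
    show "(\<lambda>q. snd (P 0 q)) = f" using P(2) by auto
    show "elliptic_lagrangian_immersion M A (\<lambda>q. snd (P l q))" "same_fubini_form M A f (\<lambda>q. snd (P l q))" for l
      by (rule solution_elliptic[OF P(1)], rule solution_same_fubini[OF P(1)])
    show "\<not> congruent_maps M (\<lambda>q. snd (P l q)) (\<lambda>q. snd (P m q))" if "l \<noteq> m" for l m
      using solutions_not_congruent[OF assms(2) P(1) P(1) that] f'(3) by blast
  qed
qed

end
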